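(* Let $p:(P,\alpha)\to(S,\omega)$ be a prequantum bundle over a symplectic manifold, and let $(M,\mu)$ be a compact manifold with volume form $\mu$, $H^1(M)=0$, $\int_M\mu=1$ and $\dim M=\tfrac12\dim S$. Then the prequantum bundle $$\bar p:(\mathrm{Gr}^{M,\mu}_{\mathrm{hor}}(P),\alpha_0)\to(\mathrm{Gr}^{M,\mu}_{\mathrm{Lag}}(S),\omega_0),\qquad\bar p(Q,\nu)=(p(Q),p_*\nu),$$ and the prequantum bundle obtained by cotangent bundle reduction, $$(J^{-1}(1),\Theta)\to(\mathrm{Gr}^{M,\mu}_{\mathrm{Lag}}(S),\Omega_1),$$ coincide (under the identification $J^{-1}(1)\cong\mathrm{Gr}^{M,\mu}_{\mathrm{hor}}(P)$ described in the context).
   Context: A prequantum bundle is a principal circle bundle $p:P\to S$ with principal connection $\alpha$ such that $\mathbf d\alpha=p^*\omega$; $E$ denotes the infinitesimal generator of the circle action. Spaces of maps and submanifolds carry natural Fréchet manifold structures. $\mathrm{Diff}_{\mathrm{vol}}(M)$ is the group of diffeomorphisms preserving $\mu$. First bundle. Since $\dim M=\frac12\dim S$, isotropic embeddings $f:M\to S$ (those with $f^*\omega=0$) are Lagrangian; $\mathrm{Emb}_{\mathrm{Lag}}(M,S)$ is the manifold of these. $\mathrm{Gr}^{M,\mu}_{\mathrm{Lag}}(S)=\mathrm{Emb}_{\mathrm{Lag}}(M,S)/\mathrm{Diff}_{\mathrm{vol}}(M)$ is the manifold of pairs $(L,\nu_L)$, $L\subset S$ a Lagrangian submanifold of type $M$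 and $\nu_L$ a volume form on $L$ with $\int_L\nu_L=\int_M\mu$; quotient map $\pi^\mu(f)=(f(M),f_*\mu)$; $\omega_0$ is determined by $((\pi^\mu)^*\omega_0)_f(u_f,v_f)=\int_M\omega(u_f,v_f)\mu$. $\mathrm{Emb}_{\mathrm{hor}}(M,P)=\{F\in\mathrm{Emb}(M,P):F^*\alpha=0\}$, $\mathrm{Gr}^{M,\mu}_{\mathrm{hor}}(P)=\mathrm{Emb}_{\mathrm{hor}}(M,P)/\mathrm{Diff}_{\mathrm{vol}}(M)$ (pairs $(Q,\nu)$, quotient map $\pi^\mu(F)=(F(M),F_*\mu)$), with circle action induced from $P$, and $\alpha_0$ is determined by $((\pi^\mu)^*\alpha_0)_F(v_F)=\int_M\alpha(v_F)\mu$. Second bundle. $\mathrm{Gr}^M_{\mathrm{hor}}(P)=\mathrm{Emb}_{\mathrm{hor}}(M,P)/\mathrm{Diff}(M)$ is the manifold of Planckian (horizontal, covering Lagrangian) submanifolds $Q$ of $P$ of type $M$. For $h\in C^\infty(S)$, let $X_h$ be the Hamiltonian vector field with $\mathbf i_{X_h}\omega=\mathbf dh$, and $\xi_h=X_h^{\mathrm{hor}}-(h\circ p)E$ the corresponding connection preserving vector field on $P$, where $X_h^{\mathrm{hor}}$ is the horizontal lift. The tangent space $T_Q\mathrm{Gr}^M_{\mathrm{hor}}(P)$, with $L=p(Q)$, is identified with $C^\infty(L)$ by $[\xi_h|_Q]\mapsto h|_L$, where $[\,\cdot\,]$ is the class modulo $TQ$. The (regular) cotangent space is $T^*_Q\mathrm{Gr}^M_{\mathrm{hor}}(P)=\mathrm{Den}(L)$,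 the densities on $L$, paired with functions by integration. $\Theta$ is the canonical 1-form on $T^*\mathrm{Gr}^M_{\mathrm{hor}}(P)$, and $\Omega=\mathbf d\Theta$. The circle action on $T^*\mathrm{Gr}^M_{\mathrm{hor}}(P)$ is Hamiltonian with momentum map $J(Q,\nu_L)=\int_L\nu_L$, $L=p(Q)$. The preimage $J^{-1}(1)=\{(Q,\nu_L):\int_L\nu_L=\int_M\mu\}$ is identified with the nonlinear Grassmannian $\mathrm{Gr}^{M,\mu}_{\mathrm{hor}}(P)$ of weighted Planckian submanifolds, volume forms on $Q$ being in bijection with volume forms on $L=p(Q)$ through $p|_Q:Q\to L$. It is endowed with the restriction of $\Theta$. The reduced space is $J^{-1}(1)/S^1=\mathrm{Gr}^{M,\mu}_{\mathrm{hor}}(P)/S^1=\mathrm{Gr}^{M,\mu}_{\mathrm{Lag}}(S)$, and $\Omega_1$ is the reduced symplectic form, to which the restriction of $\Omega$ to $J^{-1}(1)$ descends.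
   Formalization: Θ is taken with the sign −Σp dq, since the context's conventions otherwise give Θ = −α0; volume forms are read as positive densities; Ω1 = ω0 is asserted on the image of p̄, which can miss Lagrangians with torsion holonomy (e.g. RP^n in CP^n). *)

theory Defs
  imports "HOL-Analysis.Analysis"
begin

section \<open>Smooth manifolds\<close>

primrec Ck_on :: "nat \<Rightarrow> 'e::real_normed_vector set \<Rightarrow> ('e \<Rightarrow> 'f::real_normed_vector) \<Rightarrow> bool" where
  "Ck_on 0 W f \<longleftrightarrow> continuous_on W f"
| "Ck_on (Suc k) W f \<longleftrightarrow> (\<forall>x\<in>W. f differentiable (at x)) \<and>
     (\<forall>v. Ck_on k W (\<lambda>x. frechet_derivative f (at x) v))"

definition Cinf_on :: "'e::euclidean_space set \<Rightarrow> ('e \<Rightarrow> 'f::euclidean_space) \<Rightarrow> bool" where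
  "Cinf_on W f \<longleftrightarrow> (\<forall>k. Ck_on k W f)"

text \<open>A manifold is a whole type together with an atlas (not necessarily maximal) of charts
  \<open>(U, \<phi>)\<close>; the values of \<open>\<phi>\<close> outside \<open>U\<close> are irrelevant. Hausdorffness and second countability
  are sort constraints where they are needed.\<close>

type_synonym ('a, 'e) atlas = "('a set \<times> ('a \<Rightarrow> 'e)) set"

definition smooth_atlas :: "('a::topological_space, 'e::euclidean_space) atlas \<Rightarrow> bool" where
  "smooth_atlas A \<longleftrightarrow> \<Union>(fst ` A) = UNIV \<and>
     (\<forall>(U, \<phi>)\<in>A. open U \<and> open (\<phi> ` U) \<and> inj_on \<phi> U \<and> homeomorphism U (\<phi> ` U) \<phi> (inv_into U \<phi>)) \<and>
     (\<forall>(U, \<phi>)\<in>A. \<forall>(V, \<psi>)\<in>A. Cinf_on (\<phi> ` (U \<inter> V)) (\<psi> \<circ> inv_into U \<phi>))"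

definition euclidean_atlas :: "('e, 'e) atlas" where
  "euclidean_atlas = {(UNIV, id)}"

definition prod_atlas :: "('a, 'e) atlas \<Rightarrow> ('b, 'f) atlas \<Rightarrow> ('a \<times> 'b, 'e \<times> 'f) atlas" where
  "prod_atlas A B = {(U \<times> V, map_prod \<phi> \<psi>) | U \<phi> V \<psi>. (U, \<phi>) \<in> A \<and> (V, \<psi>) \<in> B}"

text \<open>Meant for open \<open>W\<close>.\<close>

definition smooth_map_on :: "('a::topological_space, 'e::euclidean_space) atlas \<Rightarrow>
    ('b::topological_space, 'f::euclidean_space) atlas \<Rightarrow> 'a set \<Rightarrow> ('a \<Rightarrow> 'b) \<Rightarrow> bool" where
  "smooth_map_on A B W f \<longleftrightarrow> continuous_on W f \<and>
     (\<forall>(U, \<phi>)\<in>A. \<forall>(V, \<psi>)\<in>B. Cinf_on (\<phi> ` (U \<inter> W \<inter> f -` V)) (\<psi> \<circ> f \<circ> inv_into U \<phi>))"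

abbreviation smooth_map :: "('a::topological_space, 'e::euclidean_space) atlas \<Rightarrow>
    ('b::topological_space, 'f::euclidean_space) atlas \<Rightarrow> ('a \<Rightarrow> 'b) \<Rightarrow> bool" where
  "smooth_map A B f \<equiv> smooth_map_on A B UNIV f"

abbreviation smooth_function :: "('a::topological_space, 'e::euclidean_space) atlas \<Rightarrow> ('a \<Rightarrow> real) \<Rightarrow> bool" where
  "smooth_function A h \<equiv> smooth_map A euclidean_atlas h"

definition smooth_at :: "('a::topological_space, 'e::euclidean_space) atlas \<Rightarrow> 'a \<Rightarrow> ('a \<Rightarrow> real) \<Rightarrow> bool" where
  "smooth_at A x g \<longleftrightarrow> (\<exists>W. open W \<and> x \<in> W \<and> smooth_map_on A euclidean_atlas W g)"

section \<open>Tangent vectors and differential forms\<close>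

text \<open>A tangent vector at \<open>x\<close> is the velocity of a smooth curve through \<open>x\<close>, as an operator on the
  functions smooth near \<open>x\<close> (and, to make it unique, zero on all other functions). Linear
  combinations of tangent vectors are pointwise.\<close>

type_synonym 'a tvec = "('a \<Rightarrow> real) \<Rightarrow> real"

definition velocity :: "('a::topological_space, 'e::euclidean_space) atlas \<Rightarrow> (real \<Rightarrow> 'a) \<Rightarrow> 'a tvec" where
  "velocity A c = (\<lambda>g. if smooth_at A (c 0) g then deriv (\<lambda>t. g (c t)) 0 else 0)"

definition tangent :: "('a::topological_space, 'e::euclidean_space) atlas \<Rightarrow> 'a \<Rightarrow> 'a tvec set" where
  "tangent A x = {velocity A c | c. smooth_map euclidean_atlas A c \<and> c 0 = x}"

definition tmap :: "('b::topological_space, 'f::euclidean_space) atlas \<Rightarrow> ('a \<Rightarrow> 'b) \<Rightarrow> 'a \<Rightarrow> 'a tvec \<Rightarrow> 'b tvec" where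
  "tmap B f x v = (\<lambda>g. if smooth_at B (f x) g then v (g \<circ> f) else 0)"

text \<open>The constant field \<open>b\<close> of the chart \<open>(U, \<phi>)\<close>, at the point with coordinates \<open>y\<close>.\<close>

definition coord_vec :: "('a::topological_space, 'e::euclidean_space) atlas \<Rightarrow>
    'a set \<Rightarrow> ('a \<Rightarrow> 'e) \<Rightarrow> 'e \<Rightarrow> 'e \<Rightarrow> 'a tvec" where
  "coord_vec A U \<phi> y b = velocity A (\<lambda>t. inv_into U \<phi> (y + t *\<^sub>R b))"

text \<open>The values of a form outside the tangent spaces are irrelevant.\<close>

type_synonym 'a form1 = "'a \<Rightarrow> 'a tvec \<Rightarrow> real"
type_synonym 'a form2 = "'a \<Rightarrow> 'a tvec \<Rightarrow> 'a tvec \<Rightarrow> real"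

definition smooth_form1 :: "('a::topological_space, 'e::euclidean_space) atlas \<Rightarrow> 'a form1 \<Rightarrow> bool" where
  "smooth_form1 A \<beta> \<longleftrightarrow>
     (\<forall>x. \<forall>v\<in>tangent A x. \<forall>w\<in>tangent A x. \<forall>r s.
        \<beta> x (\<lambda>g. r * v g + s * w g) = r * \<beta> x v + s * \<beta> x w) \<and>
     (\<forall>(U, \<phi>)\<in>A. \<forall>b. Cinf_on (\<phi> ` U) (\<lambda>y. \<beta> (inv_into U \<phi> y) (coord_vec A U \<phi> y b)))"

definition smooth_form2 :: "('a::topological_space, 'e::euclidean_space) atlas \<Rightarrow> 'a form2 \<Rightarrow> bool" where
  "smooth_form2 A \<eta> \<longleftrightarrow>
     (\<forall>x. \<forall>v\<in>tangent A x. \<forall>w\<in>tangent A x. \<forall>w'\<in>tangent A x. \<forall>r s.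
        \<eta> x v (\<lambda>g. r * w g + s * w' g) = r * \<eta> x v w + s * \<eta> x v w' \<and>
        \<eta> x v w = - \<eta> x w v) \<and>
     (\<forall>(U, \<phi>)\<in>A. \<forall>a b. Cinf_on (\<phi> ` U)
        (\<lambda>y. \<eta> (inv_into U \<phi> y) (coord_vec A U \<phi> y a) (coord_vec A U \<phi> y b)))"

text \<open>\<open>d\<beta> = \<eta>\<close>, checked on coordinate fields, which commute:
  \<open>d\<beta>(a, b) = a(\<beta>(b)) - b(\<beta>(a))\<close>.\<close>

definition has_ext_deriv :: "('a::topological_space, 'e::euclidean_space) atlas \<Rightarrow> 'a form1 \<Rightarrow> 'a form2 \<Rightarrow> bool" where
  "has_ext_deriv A \<beta> \<eta> \<longleftrightarrow> (\<forall>(U, \<phi>)\<in>A. \<forall>y\<in>\<phi> ` U. \<forall>a b.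
     \<eta> (inv_into U \<phi> y) (coord_vec A U \<phi> y a) (coord_vec A U \<phi> y b) =
       frechet_derivative (\<lambda>y. \<beta> (inv_into U \<phi> y) (coord_vec A U \<phi> y b)) (at y) a -
       frechet_derivative (\<lambda>y. \<beta> (inv_into U \<phi> y) (coord_vec A U \<phi> y a)) (at y) b)"

definition closed_form2 :: "('a::topological_space, 'e::euclidean_space) atlas \<Rightarrow> 'a form2 \<Rightarrow> bool" where
  "closed_form2 A \<eta> \<longleftrightarrow> (\<forall>(U, \<phi>)\<in>A. \<forall>y\<in>\<phi> ` U. \<forall>a b c.
     (let D = \<lambda>a b c. frechet_derivative
        (\<lambda>y. \<eta> (inv_into U \<phi> y) (coord_vec A U \<phi> y b) (coord_vec A U \<phi> y c)) (at y) a
      in D a b c + D b c a + D c a b = 0))"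

definition symplectic_form :: "('a::topological_space, 'e::euclidean_space) atlas \<Rightarrow> 'a form2 \<Rightarrow> bool" where
  "symplectic_form A \<omega> \<longleftrightarrow> smooth_form2 A \<omega> \<and> closed_form2 A \<omega> \<and>
     (\<forall>x. \<forall>v\<in>tangent A x. (\<forall>w\<in>tangent A x. \<omega> x v w = 0) \<longrightarrow> v = (\<lambda>_. 0))"

text \<open>Vanishing of the first real (de Rham) cohomology.\<close>

definition H1_zero :: "('a::topological_space, 'e::euclidean_space) atlas \<Rightarrow> bool" where
  "H1_zero A \<longleftrightarrow> (\<forall>\<beta>. smooth_form1 A \<beta> \<and> has_ext_deriv A \<beta> (\<lambda>_ _ _. 0) \<longrightarrow>
     (\<exists>k. smooth_function A k \<and> (\<forall>x. \<forall>v\<in>tangent A x. \<beta> x v = v k)))"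

definition embedding :: "('a::topological_space, 'e::euclidean_space) atlas \<Rightarrow>
    ('b::topological_space, 'f::euclidean_space) atlas \<Rightarrow> ('a \<Rightarrow> 'b) \<Rightarrow> bool" where
  "embedding A B f \<longleftrightarrow> smooth_map A B f \<and>
     (\<forall>x. \<forall>v\<in>tangent A x. tmap B f x v = (\<lambda>_. 0) \<longrightarrow> v = (\<lambda>_. 0)) \<and>
     (\<exists>g. homeomorphism UNIV (range f) f g)"

section \<open>Volumes and densities\<close>

text \<open>A nowhere vanishing density, seen as the measure it defines. No orientation enters: under the
  identification of weighted submanifolds with cotangent vectors below, a volume \<open>\<nu>\<close> and its opposite
  \<open>- \<nu>\<close> name the same density.\<close>

definition volume_measure :: "('a::topological_space, 'e::euclidean_space) atlas \<Rightarrow> 'a measure \<Rightarrow> bool" where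
  "volume_measure A \<mu> \<longleftrightarrow> sets \<mu> = sets borel \<and>
     (\<forall>(U, \<phi>)\<in>A. \<exists>\<rho>::'e \<Rightarrow> real. Cinf_on (\<phi> ` U) \<rho> \<and> (\<forall>y\<in>\<phi> ` U. \<rho> y > 0) \<and>
        (\<forall>B\<in>sets borel. B \<subseteq> U \<longrightarrow>
           emeasure \<mu> B = (\<integral>\<^sup>+y. ennreal (\<rho> y) * indicator (\<phi> ` B) y \<partial>lborel)))"

text \<open>A (possibly signed) density on a compact submanifold of \<open>'x\<close> is represented by its pairing
  with functions, \<open>\<delta> k = \<integral> k \<delta>\<close>; it is set to zero on the functions that are not Borel. Since \<open>\<mu>\<close> vanishes nowhere,
  the densities on \<open>f(M)\<close> are the \<open>f\<^sub>*(\<rho>\<mu>)\<close> with \<open>\<rho>\<close> smooth, and the volumes those with \<open>\<rho> > 0\<close>.\<close>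

type_synonym 'x dens = "('x \<Rightarrow> real) \<Rightarrow> real"

definition push :: "'m measure \<Rightarrow> ('m \<Rightarrow> 'x::topological_space) \<Rightarrow> ('m \<Rightarrow> real) \<Rightarrow> 'x dens" where
  "push \<mu> f \<rho> = (\<lambda>k. if k \<in> borel_measurable borel then (\<integral>x. k (f x) * \<rho> x \<partial>\<mu>) else 0)"

definition dens_push :: "('x::topological_space \<Rightarrow> 'y::topological_space) \<Rightarrow> 'x dens \<Rightarrow> 'y dens" where
  "dens_push f \<delta> = (\<lambda>k. if k \<in> borel_measurable borel then \<delta> (k \<circ> f) else 0)"

definition dens_total :: "'x dens \<Rightarrow> real" where
  "dens_total \<delta> = \<delta> (\<lambda>_. 1)"

definition Den :: "('m::topological_space, 'e::euclidean_space) atlas \<Rightarrow> 'm measure \<Rightarrow>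
    ('m \<Rightarrow> 'x::topological_space) \<Rightarrow> 'x dens set" where
  "Den MA \<mu> f = {push \<mu> f \<rho> | \<rho>. smooth_function MA \<rho>}"

definition Vol :: "('m::topological_space, 'e::euclidean_space) atlas \<Rightarrow> 'm measure \<Rightarrow>
    ('m \<Rightarrow> 'x::topological_space) \<Rightarrow> 'x dens set" where
  "Vol MA \<mu> f = {push \<mu> f \<rho> | \<rho>. smooth_function MA \<rho> \<and> (\<forall>x. \<rho> x > 0)}"

section \<open>Prequantum bundles\<close>

text \<open>The circle is the group of unit complex numbers, so the infinitesimal generator is the
  derivative of \<open>t \<mapsto> act (exp(it))\<close>.\<close>

definition generator :: "('p::topological_space, 'g::euclidean_space) atlas \<Rightarrow> (complex \<Rightarrow> 'p \<Rightarrow> 'p) \<Rightarrow> 'p \<Rightarrow> 'p tvec" where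
  "generator PA act y = velocity PA (\<lambda>t. act (cis t) y)"

text \<open>In the last clause, \<open>(s, z) \<mapsto> act z (\<sigma> s)\<close> is an equivariant trivialisation over \<open>U\<close> with smooth inverse
  \<open>y \<mapsto> (p y, \<tau> y)\<close>.\<close>

definition principal_circle_bundle :: "('p::topological_space, 'g::euclidean_space) atlas \<Rightarrow>
    ('s::topological_space, 'f::euclidean_space) atlas \<Rightarrow> ('p \<Rightarrow> 's) \<Rightarrow> (complex \<Rightarrow> 'p \<Rightarrow> 'p) \<Rightarrow> bool" where
  "principal_circle_bundle PA SA p act \<longleftrightarrow>
     smooth_map PA SA p \<and>
     smooth_map (prod_atlas euclidean_atlas PA) PA (\<lambda>(t::real, y). act (cis t) y) \<and>
     (\<forall>y. act 1 y = y) \<and>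
     (\<forall>z\<in>sphere 0 1. \<forall>z'\<in>sphere 0 1. \<forall>y. act (z * z') y = act z (act z' y)) \<and>
     (\<forall>z\<in>sphere 0 1. \<forall>y. p (act z y) = p y) \<and>
     (\<forall>s. \<exists>U \<sigma> \<tau>. open U \<and> s \<in> U \<and> smooth_map_on SA PA U \<sigma> \<and>
        smooth_map_on PA (euclidean_atlas :: (complex, complex) atlas) (p -` U) \<tau> \<and>
        (\<forall>r\<in>U. p (\<sigma> r) = r \<and> (\<forall>z\<in>sphere 0 1. \<tau> (act z (\<sigma> r)) = z)) \<and>
        (\<forall>y\<in>p -` U. \<tau> y \<in> sphere 0 1 \<and> act (\<tau> y) (\<sigma> (p y)) = y))"

definition principal_connection :: "('p::topological_space, 'g::euclidean_space) atlas \<Rightarrow>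
    (complex \<Rightarrow> 'p \<Rightarrow> 'p) \<Rightarrow> 'p form1 \<Rightarrow> bool" where
  "principal_connection PA act \<alpha> \<longleftrightarrow> smooth_form1 PA \<alpha> \<and>
     (\<forall>z\<in>sphere 0 1. \<forall>y. \<forall>v\<in>tangent PA y. \<alpha> (act z y) (tmap PA (act z) y v) = \<alpha> y v) \<and>
     (\<forall>y. \<alpha> y (generator PA act y) = 1)"

record ('s, 'f, 'p, 'g) prequantum =
  base_atlas :: "('s, 'f) atlas"
  total_atlas :: "('p, 'g) atlas"
  proj :: "'p \<Rightarrow> 's"
  act :: "complex \<Rightarrow> 'p \<Rightarrow> 'p"
  conn :: "'p form1"
  symp :: "'s form2"

definition prequantum_bundle ::
    "('s::topological_space, 'f::euclidean_space, 'p::topological_space, 'g::euclidean_space) prequantum \<Rightarrow> bool" where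
  "prequantum_bundle B \<longleftrightarrow>
     principal_circle_bundle (total_atlas B) (base_atlas B) (proj B) (act B) \<and>
     principal_connection (total_atlas B) (act B) (conn B) \<and>
     has_ext_deriv (total_atlas B) (conn B) (\<lambda>y v w. symp B (proj B y)
       (tmap (base_atlas B) (proj B) y v) (tmap (base_atlas B) (proj B) y w))"

text \<open>The vector field \<open>X\<^sub>h\<close> with \<open>\<omega>(X\<^sub>h, \<cdot>) = dh\<close>, and \<open>\<xi>\<^sub>h = X\<^sub>h\<^sup>h\<^sup>o\<^sup>r - (h \<circ> p) E\<close>.\<close>

definition ham_field :: "('s::topological_space, 'f::euclidean_space, 'p, 'g) prequantum \<Rightarrow>
    ('s \<Rightarrow> real) \<Rightarrow> 's \<Rightarrow> 's tvec" where
  "ham_field B h s = (THE v. v \<in> tangent (base_atlas B) s \<and>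
     (\<forall>w\<in>tangent (base_atlas B) s. symp B s v w = w h))"

definition hor_lift ::
    "('s::topological_space, 'f::euclidean_space, 'p::topological_space, 'g::euclidean_space) prequantum \<Rightarrow>
     'p \<Rightarrow> 's tvec \<Rightarrow> 'p tvec" where
  "hor_lift B y v = (THE w. w \<in> tangent (total_atlas B) y \<and> conn B y w = 0 \<and>
     tmap (base_atlas B) (proj B) y w = v)"

definition xi ::
    "('s::topological_space, 'f::euclidean_space, 'p::topological_space, 'g::euclidean_space) prequantum \<Rightarrow>
     ('s \<Rightarrow> real) \<Rightarrow> 'p \<Rightarrow> 'p tvec" where
  "xi B h y = (\<lambda>g. hor_lift B y (ham_field B h (proj B y)) g -
     h (proj B y) * generator (total_atlas B) (act B) y g)"

section \<open>Spaces of embeddings and their forms\<close>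

definition Emb_Lag :: "('m::topological_space, 'e::euclidean_space) atlas \<Rightarrow>
    ('s::topological_space, 'f::euclidean_space, 'p, 'g) prequantum \<Rightarrow> ('m \<Rightarrow> 's) set" where
  "Emb_Lag MA B = {f. embedding MA (base_atlas B) f \<and>
     (\<forall>x. \<forall>v\<in>tangent MA x. \<forall>w\<in>tangent MA x.
        symp B (f x) (tmap (base_atlas B) f x v) (tmap (base_atlas B) f x w) = 0)}"

text \<open>Horizontality forces \<open>p \<circ> F\<close> to be an isotropic immersion, but not to be injective. That \<open>F(M)\<close> covers
  a Lagrangian \<^emph>\<open>submanifold\<close> diffeomorphic to it is therefore a separate requirement.\<close>

definition Emb_hor :: "('m::topological_space, 'e::euclidean_space) atlas \<Rightarrow>
    ('s::topological_space, 'f::euclidean_space, 'p::topological_space, 'g::euclidean_space) prequantum \<Rightarrow>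
    ('m \<Rightarrow> 'p) set" where
  "Emb_hor MA B = {F. embedding MA (total_atlas B) F \<and>
     (\<forall>x. \<forall>v\<in>tangent MA x. conn B (F x) (tmap (total_atlas B) F x v) = 0) \<and>
     proj B \<circ> F \<in> Emb_Lag MA B}"

text \<open>The smooth structure of the Frechet manifolds of maps and submanifolds is recorded by their smooth
  maps from the plane (plots). A smooth map from the plane to a space of embeddings is a map that is
  jointly smooth, and one to a quotient by a diffeomorphism group is one that lifts to embeddings (the
  quotient map is a principal bundle, and the plane is contractible). A \<open>k\<close>-form, \<open>k \<le> 2\<close>, is
  determined by its pullbacks to the plane: \<open>\<theta> c u a\<close> is the value on \<open>a\<close> at \<open>u\<close> of \<open>c\<^sup>*\<theta>\<close>,
  that is, the value of \<open>\<theta>\<close> on the derivative of \<open>c\<close> at \<open>u\<close> in the direction \<open>a\<close>.\<close>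

type_synonym plane = "real \<times> real"
type_synonym 'x plot_form1 = "(plane \<Rightarrow> 'x) \<Rightarrow> plane \<Rightarrow> plane \<Rightarrow> real"
type_synonym 'x plot_form2 = "(plane \<Rightarrow> 'x) \<Rightarrow> plane \<Rightarrow> plane \<Rightarrow> plane \<Rightarrow> real"

definition plot_form1 :: "(plane \<Rightarrow> 'x) set \<Rightarrow> 'x plot_form1 \<Rightarrow> bool" where
  "plot_form1 X \<theta> \<longleftrightarrow> (\<forall>c\<in>X.
     (\<forall>u. linear (\<theta> c u)) \<and> (\<forall>a. Cinf_on UNIV (\<lambda>u. \<theta> c u a)) \<and>
     (\<forall>\<phi>. Cinf_on UNIV \<phi> \<longrightarrow> (\<forall>u a.
        \<theta> (c \<circ> \<phi>) u a = \<theta> c (\<phi> u) (frechet_derivative \<phi> (at u) a))))"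

definition plot_form2 :: "(plane \<Rightarrow> 'x) set \<Rightarrow> 'x plot_form2 \<Rightarrow> bool" where
  "plot_form2 X \<eta> \<longleftrightarrow> (\<forall>c\<in>X.
     (\<forall>u a. linear (\<eta> c u a)) \<and> (\<forall>u a b. \<eta> c u a b = - \<eta> c u b a) \<and>
     (\<forall>a b. Cinf_on UNIV (\<lambda>u. \<eta> c u a b)) \<and>
     (\<forall>\<phi>. Cinf_on UNIV \<phi> \<longrightarrow> (\<forall>u a b. \<eta> (c \<circ> \<phi>) u a b =
        \<eta> c (\<phi> u) (frechet_derivative \<phi> (at u) a) (frechet_derivative \<phi> (at u) b))))"

definition plot_d :: "'x plot_form1 \<Rightarrow> 'x plot_form2" where
  "plot_d \<theta> c u a b = frechet_derivative (\<lambda>u. \<theta> c u b) (at u) a -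
     frechet_derivative (\<lambda>u. \<theta> c u a) (at u) b"

definition families :: "('m::topological_space, 'e::euclidean_space) atlas \<Rightarrow>
    ('x::topological_space, 'h::euclidean_space) atlas \<Rightarrow> ('m \<Rightarrow> 'x) set \<Rightarrow> (plane \<Rightarrow> 'm \<Rightarrow> 'x) set" where
  "families MA XA E = {F. smooth_map (prod_atlas euclidean_atlas MA) XA (\<lambda>(u, x). F u x) \<and> (\<forall>u. F u \<in> E)}"

definition family_vel :: "('x::topological_space, 'h::euclidean_space) atlas \<Rightarrow>
    (plane \<Rightarrow> 'm \<Rightarrow> 'x) \<Rightarrow> plane \<Rightarrow> plane \<Rightarrow> 'm \<Rightarrow> 'x tvec" where
  "family_vel XA F u a x = velocity XA (\<lambda>t. F (u + t *\<^sub>R a) x)"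

section \<open>Weighted submanifolds\<close>

text \<open>For a set \<open>E\<close> of embeddings: the pairs \<open>(f(M), \<nu>)\<close> with \<open>f \<in> E\<close> and \<open>\<nu>\<close> a volume on \<open>f(M)\<close> with the same
  total as \<open>\<mu>\<close>, and the quotient map \<open>\<pi>\<^sup>\<mu>\<close> onto them, which defines the plots.\<close>

definition Gr_weighted :: "('m::topological_space, 'e::euclidean_space) atlas \<Rightarrow> 'm measure \<Rightarrow>
    ('m \<Rightarrow> 'x::topological_space) set \<Rightarrow> ('x set \<times> 'x dens) set" where
  "Gr_weighted MA \<mu> E = {(range f, \<nu>) | f \<nu>. f \<in> E \<and> \<nu> \<in> Vol MA \<mu> f \<and> dens_total \<nu> = measure \<mu> UNIV}"

definition weighted_image :: "'m measure \<Rightarrow> ('m \<Rightarrow> 'x::topological_space) \<Rightarrow> 'x set \<times> 'x dens" where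
  "weighted_image \<mu> f = (range f, push \<mu> f (\<lambda>_. 1))"

definition Gr_weighted_plots :: "('m::topological_space, 'e::euclidean_space) atlas \<Rightarrow> 'm measure \<Rightarrow>
    ('x::topological_space, 'h::euclidean_space) atlas \<Rightarrow> ('m \<Rightarrow> 'x) set \<Rightarrow> (plane \<Rightarrow> 'x set \<times> 'x dens) set" where
  "Gr_weighted_plots MA \<mu> XA E = {(\<lambda>u. weighted_image \<mu> (F u)) | F. F \<in> families MA XA E}"

abbreviation Gr_Lag where "Gr_Lag MA \<mu> B \<equiv> Gr_weighted MA \<mu> (Emb_Lag MA B)"
abbreviation Gr_hor where "Gr_hor MA \<mu> B \<equiv> Gr_weighted MA \<mu> (Emb_hor MA B)"
abbreviation Gr_Lag_plots where
  "Gr_Lag_plots MA \<mu> B \<equiv> Gr_weighted_plots MA \<mu> (base_atlas B) (Emb_Lag MA B)"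
abbreviation Gr_hor_plots where
  "Gr_hor_plots MA \<mu> B \<equiv> Gr_weighted_plots MA \<mu> (total_atlas B) (Emb_hor MA B)"

definition Gr_proj :: "('s::topological_space, 'f, 'p::topological_space, 'g) prequantum \<Rightarrow>
    'p set \<times> 'p dens \<Rightarrow> 's set \<times> 's dens" where
  "Gr_proj B = (\<lambda>(Q, \<nu>). (proj B ` Q, dens_push (proj B) \<nu>))"

definition Gr_act :: "('s, 'f, 'p::topological_space, 'g) prequantum \<Rightarrow>
    complex \<Rightarrow> 'p set \<times> 'p dens \<Rightarrow> 'p set \<times> 'p dens" where
  "Gr_act B z = (\<lambda>(Q, \<nu>). (act B z ` Q, dens_push (act B z) \<nu>))"

definition is_alpha0 :: "('m::topological_space, 'e::euclidean_space) atlas \<Rightarrow> 'm measure \<Rightarrow>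
    ('s::topological_space, 'f::euclidean_space, 'p::topological_space, 'g::euclidean_space) prequantum \<Rightarrow>
    ('p set \<times> 'p dens) plot_form1 \<Rightarrow> bool" where
  "is_alpha0 MA \<mu> B \<alpha>0 \<longleftrightarrow> plot_form1 (Gr_hor_plots MA \<mu> B) \<alpha>0 \<and>
     (\<forall>F\<in>families MA (total_atlas B) (Emb_hor MA B). \<forall>u a.
        \<alpha>0 (\<lambda>u. weighted_image \<mu> (F u)) u a =
          (\<integral>x. conn B (F u x) (family_vel (total_atlas B) F u a x) \<partial>\<mu>))"

definition is_omega0 :: "('m::topological_space, 'e::euclidean_space) atlas \<Rightarrow> 'm measure \<Rightarrow>
    ('s::topological_space, 'f::euclidean_space, 'p, 'g) prequantum \<Rightarrow>
    ('s set \<times> 's dens) plot_form2 \<Rightarrow> bool" where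
  "is_omega0 MA \<mu> B \<omega>0 \<longleftrightarrow> plot_form2 (Gr_Lag_plots MA \<mu> B) \<omega>0 \<and>
     (\<forall>f\<in>families MA (base_atlas B) (Emb_Lag MA B). \<forall>u a b.
        \<omega>0 (\<lambda>u. weighted_image \<mu> (f u)) u a b =
          (\<integral>x. symp B (f u x) (family_vel (base_atlas B) f u a x) (family_vel (base_atlas B) f u b x) \<partial>\<mu>))"

section \<open>The cotangent bundle of the space of Planckian submanifolds\<close>

text \<open>Pairs \<open>(Q, \<delta>)\<close> with \<open>\<delta>\<close> a density on \<open>p(Q)\<close>.\<close>

definition cotangent :: "('m::topological_space, 'e::euclidean_space) atlas \<Rightarrow> 'm measure \<Rightarrow>
    ('s::topological_space, 'f::euclidean_space, 'p::topological_space, 'g::euclidean_space) prequantum \<Rightarrow>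
    ('p set \<times> 's dens) set" where
  "cotangent MA \<mu> B = {(range F, \<delta>) | F \<delta>. F \<in> Emb_hor MA B \<and> \<delta> \<in> Den MA \<mu> (proj B \<circ> F)}"

definition cotangent_vec :: "'m measure \<Rightarrow> ('s::topological_space, 'f, 'p, 'g) prequantum \<Rightarrow>
    ('m \<Rightarrow> 'p) \<Rightarrow> ('m \<Rightarrow> real) \<Rightarrow> 'p set \<times> 's dens" where
  "cotangent_vec \<mu> B F \<rho> = (range F, push \<mu> (proj B \<circ> F) \<rho>)"

definition cotangent_plots :: "('m::topological_space, 'e::euclidean_space) atlas \<Rightarrow> 'm measure \<Rightarrow>
    ('s::topological_space, 'f::euclidean_space, 'p::topological_space, 'g::euclidean_space) prequantum \<Rightarrow>
    (plane \<Rightarrow> 'p set \<times> 's dens) set" where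
  "cotangent_plots MA \<mu> B = {(\<lambda>u. cotangent_vec \<mu> B (F u) (\<rho> u)) | F \<rho>.
     F \<in> families MA (total_atlas B) (Emb_hor MA B) \<and> \<rho> \<in> families MA euclidean_atlas UNIV}"

text \<open>The tangent vector at \<open>Q = F(M)\<close> given by the field \<open>v\<close> along \<open>F\<close> is \<open>[\<xi>\<^sub>h|\<^sub>Q]\<close>, the class being modulo \<open>TQ\<close>.
  It is then identified with the function \<open>h|\<^sub>L\<close> on \<open>L = p(Q)\<close>.\<close>

definition represents :: "('m::topological_space, 'e::euclidean_space) atlas \<Rightarrow>
    ('s::topological_space, 'f::euclidean_space, 'p::topological_space, 'g::euclidean_space) prequantum \<Rightarrow>
    ('m \<Rightarrow> 'p) \<Rightarrow> ('m \<Rightarrow> 'p tvec) \<Rightarrow> ('s \<Rightarrow> real) \<Rightarrow> bool" where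
  "represents MA B F v h \<longleftrightarrow> smooth_function (base_atlas B) h \<and>
     (\<forall>x. \<exists>w\<in>tangent MA x. v x = (\<lambda>g. xi B h (F x) g + tmap (total_atlas B) F x w g))"

text \<open>\<open>\<Theta>\<close> is the tautological pairing of the covector with the projected velocity, with the sign
  convention \<open>\<Theta> = - \<Sum> p\<^sub>i dq\<^sub>i\<close>, i.e. \<open>d\<Theta> = \<Sum> dq\<^sub>i \<and> dp\<^sub>i\<close>, which goes with \<open>\<omega>(X\<^sub>h, \<cdot>) = dh\<close>. The sign matters:
  the generator of the circle action is \<open>\<xi>\<^sub>h\<close> for \<open>h = - 1\<close>, so \<open>\<Theta>\<close> takes on it the value of the momentum map
  at \<open>(Q, \<delta>)\<close>, namely \<open>\<integral> \<delta>\<close>. In particular it takes the value \<open>1\<close>, as a connection form must, on the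
  level one, where the opposite sign would give \<open>- 1\<close>.\<close>

definition is_canonical_form :: "('m::topological_space, 'e::euclidean_space) atlas \<Rightarrow> 'm measure \<Rightarrow>
    ('s::topological_space, 'f::euclidean_space, 'p::topological_space, 'g::euclidean_space) prequantum \<Rightarrow>
    ('p set \<times> 's dens) plot_form1 \<Rightarrow> bool" where
  "is_canonical_form MA \<mu> B \<Theta> \<longleftrightarrow> plot_form1 (cotangent_plots MA \<mu> B) \<Theta> \<and>
     (\<forall>F\<in>families MA (total_atlas B) (Emb_hor MA B). \<forall>\<rho>\<in>families MA euclidean_atlas UNIV. \<forall>u a h.
        represents MA B (F u) (family_vel (total_atlas B) F u a) h \<longrightarrow>
          \<Theta> (\<lambda>u. cotangent_vec \<mu> B (F u) (\<rho> u)) u a = - snd (cotangent_vec \<mu> B (F u) (\<rho> u)) h)"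

text \<open>The cotangent lift of \<open>Q \<mapsto> act z ` Q\<close>: the flows of the \<open>\<xi>\<^sub>h\<close> commute with the circle action, so the lift
  fixes the density.\<close>

definition cotangent_act :: "('s, 'f, 'p, 'g) prequantum \<Rightarrow> complex \<Rightarrow> 'p set \<times> 's dens \<Rightarrow> 'p set \<times> 's dens" where
  "cotangent_act B z = (\<lambda>(Q, \<delta>). (act B z ` Q, \<delta>))"

definition momentum :: "'p set \<times> 's dens \<Rightarrow> real" where
  "momentum = (\<lambda>(Q, \<delta>). dens_total \<delta>)"

text \<open>Only the volumes among the densities are kept, as required for the comparison with weighted
  submanifolds.\<close>

definition J_level_one :: "('m::topological_space, 'e::euclidean_space) atlas \<Rightarrow> 'm measure \<Rightarrow>
    ('s::topological_space, 'f::euclidean_space, 'p::topological_space, 'g::euclidean_space) prequantum \<Rightarrow>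
    ('p set \<times> 's dens) set" where
  "J_level_one MA \<mu> B = {\<zeta> \<in> cotangent MA \<mu> B. momentum \<zeta> = 1 \<and>
     (\<exists>F\<in>Emb_hor MA B. fst \<zeta> = range F \<and> snd \<zeta> \<in> Vol MA \<mu> (proj B \<circ> F))}"

definition J_level_one_plots :: "('m::topological_space, 'e::euclidean_space) atlas \<Rightarrow> 'm measure \<Rightarrow>
    ('s::topological_space, 'f::euclidean_space, 'p::topological_space, 'g::euclidean_space) prequantum \<Rightarrow>
    (plane \<Rightarrow> 'p set \<times> 's dens) set" where
  "J_level_one_plots MA \<mu> B = {c \<in> cotangent_plots MA \<mu> B. \<forall>u. c u \<in> J_level_one MA \<mu> B}"

text \<open>The projection to \<open>J\<^sup>-\<^sup>1(1)/S\<^sup>1\<close>, where the orbit of \<open>(Q, \<delta>)\<close> is identified with the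
  weighted Lagrangian submanifold \<open>(p(Q), \<delta>)\<close>.\<close>

definition reduced_proj :: "('s, 'f, 'p, 'g) prequantum \<Rightarrow> 'p set \<times> 's dens \<Rightarrow> 's set \<times> 's dens" where
  "reduced_proj B = (\<lambda>(Q, \<delta>). (proj B ` Q, \<delta>))"

definition reduced_plots :: "('m::topological_space, 'e::euclidean_space) atlas \<Rightarrow> 'm measure \<Rightarrow>
    ('s::topological_space, 'f::euclidean_space, 'p::topological_space, 'g::euclidean_space) prequantum \<Rightarrow>
    (plane \<Rightarrow> 's set \<times> 's dens) set" where
  "reduced_plots MA \<mu> B = {reduced_proj B \<circ> c | c. c \<in> J_level_one_plots MA \<mu> B}"

definition is_reduced_form :: "('m::topological_space, 'e::euclidean_space) atlas \<Rightarrow> 'm measure \<Rightarrow>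
    ('s::topological_space, 'f::euclidean_space, 'p::topological_space, 'g::euclidean_space) prequantum \<Rightarrow>
    ('p set \<times> 's dens) plot_form2 \<Rightarrow> ('s set \<times> 's dens) plot_form2 \<Rightarrow> bool" where
  "is_reduced_form MA \<mu> B \<Omega> \<Omega>1 \<longleftrightarrow> plot_form2 (reduced_plots MA \<mu> B) \<Omega>1 \<and>
     (\<forall>c\<in>J_level_one_plots MA \<mu> B. \<Omega>1 (reduced_proj B \<circ> c) = \<Omega> c)"

text \<open>A volume on \<open>Q\<close> is transported to \<open>L = p(Q)\<close>.\<close>

definition level_ident :: "('s::topological_space, 'f, 'p::topological_space, 'g) prequantum \<Rightarrow>
    'p set \<times> 'p dens \<Rightarrow> 'p set \<times> 's dens" where
  "level_ident B = (\<lambda>(Q, \<nu>). (Q, dens_push (proj B) \<nu>))"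

end

theory Submission
  imports Defs
begin

text \<open>Let \<open>F u\<close> be a family of horizontal embeddings covering the Lagrangian embeddings \<open>f u = p \<circ> F u\<close>, with
  velocity \<open>v\<close> in a direction \<open>a\<close>. The structure equation \<open>d\<alpha> = p\<^sup>*\<omega>\<close> on the surfaces
  \<open>(s, t) \<mapsto> F (u + s a) (\<gamma> t)\<close> gives \<open>\<omega> (Tp v, Tf \<gamma>') = - d(\<alpha> v) (\<gamma>')\<close>, because \<open>\<alpha>\<close> vanishes on the \<open>t\<close>-curves. Extend
  \<open>- \<alpha>(v)\<close> from the compact submanifold \<open>f u (M)\<close> to a smooth function \<open>h\<close> on \<open>S\<close>. Then \<open>Tp v - X\<^sub>h\<close> is \<open>\<omega>\<close>-orthogonal to
  the Lagrangian \<open>f u (M)\<close>, hence tangent to it, so that \<open>v\<close> and \<open>\<xi>\<^sub>h\<close> differ by a vector tangent to \<open>F u (M)\<close>. Thus \<open>h\<close>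
  represents \<open>v\<close>, and \<open>\<Theta> = - \<integral> h \<mu> = \<integral> \<alpha>(v) \<mu> = \<alpha>\<^sub>0\<close>. Differentiating under the integral and using
  \<open>d\<alpha> = p\<^sup>*\<omega>\<close> once more turns \<open>d\<Theta>\<close> into \<open>\<integral> \<omega>(u\<^sub>f, v\<^sub>f) \<mu> = \<omega>\<^sub>0\<close>.\<close>

section \<open>Calculus of smooth maps between Euclidean spaces\<close>

text \<open>\<open>is_canonical_form\<close> prescribes \<Theta> only on velocities represented by
  some \<open>h\<close> that is smooth on the whole base, so everything hinges on finding such an
  \<open>h\<close> for every velocity of every family. The extension comes from local smooth
  retractions onto the embedded submanifold, obtained from the inverse function theorem; compactness
  of \<open>M\<close> leaves finitely many of them to glue with bump functions. Two linear facts
  then identify the velocity: a tangent vector of \<open>P\<close> killed by both \<open>Tp\<close>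
  and \<alpha> vanishes, because vertical vectors are multiples of the generator; and an isotropic
  subspace of half dimension is its own symplectic complement. Plots of weighted submanifolds push
  forward the fixed \<mu>, so they correspond to cotangent plots with constant weight 1. Smoothness
  of the integrals in the parameter is part of \<Theta> being a form on plots, so only the values of
  their derivatives remain to be computed. Exterior derivatives are prescribed on coordinate fields
  only; symmetry of second derivatives carries the structure equation over to arbitrary
  families.\<close>

lemma Ck_on_cong:
  assumes "open W" "Ck_on k W f" "\<And>x. x \<in> W \<Longrightarrow> f x = g x"
  shows "Ck_on k W g"
  using assms(2,3)
proof (induction k arbitrary: f g)
  case 0
  then show ?case by (simp cong: continuous_on_cong)
next
  case (Suc k)
  have "g differentiable (at x)" if "x \<in> W" for x
    using Suc.prems that \<open>open W\<close> unfolding differentiable_def Ck_on.simps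
    by (meson has_derivative_transform_within_open)
  moreover have "frechet_derivative f (at x) = frechet_derivative g (at x)" if "x \<in> W" for x
    using frechet_derivative_transform_within_open[of f x W g] Suc.prems that \<open>open W\<close> by simp
  ultimately show ?case
    using Suc.IH[of "\<lambda>x. frechet_derivative f (at x) v" "\<lambda>x. frechet_derivative g (at x) v" for v]
      Suc.prems by simp
qed

text \<open>The recursion in \<open>Ck_on\<close> speaks of \<open>frechet_derivative\<close>, a
  choice operator; uniqueness of derivatives lets the rules below work with an explicit formula
  instead.\<close>

lemma Ck_on_SucI:
  assumes "open W" "\<And>x. x \<in> W \<Longrightarrow> (f has_derivative f' x) (at x)" "\<And>v. Ck_on k W (\<lambda>x. f' x v)"
  shows "Ck_on (Suc k) W f"
proof -
  have eq: "f' x = frechet_derivative f (at x)" if "x \<in> W" for x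
    by (rule frechet_derivative_at[OF assms(2)[OF that]])
  have "Ck_on k W (\<lambda>x. frechet_derivative f (at x) v)" for v
    by (rule Ck_on_cong[OF assms(1) assms(3)[of v]]) (simp add: eq)
  then show ?thesis
    using assms(2) by (auto simp: differentiable_def)
qed

lemma Ck_on_Suc_has_derivative:
  "Ck_on (Suc k) W f \<Longrightarrow> x \<in> W \<Longrightarrow> (f has_derivative frechet_derivative f (at x)) (at x)"
  by (simp add: frechet_derivative_works)

lemma Ck_on_subset: "Ck_on k W f \<Longrightarrow> V \<subseteq> W \<Longrightarrow> Ck_on k V f"
  by (induction k arbitrary: f) (auto intro: continuous_on_subset)

lemma Ck_on_imp_continuous_on: "Ck_on k W f \<Longrightarrow> continuous_on W f"
  by (cases k) (auto intro!: continuous_at_imp_continuous_on differentiable_imp_continuous_within)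

lemma Ck_on_SucD: "Ck_on (Suc k) W f \<Longrightarrow> Ck_on k W f"
proof (induction k arbitrary: f)
  case 0
  then show ?case using Ck_on_imp_continuous_on[of "Suc 0"] by simp
qed simp

lemma Ck_on_local:
  assumes "\<And>x. x \<in> W \<Longrightarrow> \<exists>V. open V \<and> x \<in> V \<and> Ck_on k V f"
  shows "Ck_on k W f"
  using assms
proof (induction k arbitrary: f)
  case 0
  then show ?case
    by (auto intro!: continuous_at_imp_continuous_on) (metis continuous_on_eq_continuous_at)
next
  case (Suc k)
  then show ?case by simp metis
qed

lemma Ck_on_const: "Ck_on k W (\<lambda>x. c)"
  by (induction k arbitrary: c) auto

lemma Ck_on_bounded_linear:
  assumes "bounded_linear L" "open W" "Ck_on k W f"
  shows "Ck_on k W (\<lambda>x. L (f x))"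
  using assms(3)
proof (induction k arbitrary: f)
  case 0
  then show ?case
    using bounded_linear.continuous_on[OF assms(1)] by simp
next
  case (Suc k)
  show ?case
  proof (rule Ck_on_SucI[OF assms(2)])
    show "((\<lambda>x. L (f x)) has_derivative (\<lambda>v. L (frechet_derivative f (at x) v))) (at x)" if "x \<in> W" for x
      using bounded_linear.has_derivative[OF assms(1)] Ck_on_Suc_has_derivative[OF Suc.prems that] by blast
    show "Ck_on k W (\<lambda>x. L (frechet_derivative f (at x) v))" for v
      using Suc by simp
  qed
qed

lemma Ck_on_linear: "bounded_linear L \<Longrightarrow> open W \<Longrightarrow> Ck_on k W L"
proof (induction k)
  case 0
  then show ?case by (simp add: linear_continuous_on)
next
  case (Suc k)
  show ?case
    by (rule Ck_on_SucI[where f' = "\<lambda>_. L"])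
      (use Suc in \<open>auto intro: bounded_linear_imp_has_derivative Ck_on_const\<close>)
qed

lemma Ck_on_add:
  assumes "open W" "Ck_on k W f" "Ck_on k W g"
  shows "Ck_on k W (\<lambda>x. f x + g x)"
  using assms(2,3)
proof (induction k arbitrary: f g)
  case 0
  then show ?case by (simp add: continuous_on_add)
next
  case (Suc k)
  show ?case
    by (rule Ck_on_SucI[OF assms(1) has_derivative_add[OF
            Ck_on_Suc_has_derivative[OF Suc.prems(1)] Ck_on_Suc_has_derivative[OF Suc.prems(2)]]])
      (use Suc in auto)
qed

lemma Ck_on_sum:
  assumes "open W" "finite I" "\<And>i. i \<in> I \<Longrightarrow> Ck_on k W (f i)"
  shows "Ck_on k W (\<lambda>x. \<Sum>i\<in>I. f i x)"
  using assms(2,3)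
  by (induction I rule: finite_induct) (auto intro: Ck_on_add[OF assms(1)] Ck_on_const)

lemma Ck_on_bilinear:
  assumes "bounded_bilinear m" "open W" "Ck_on k W f" "Ck_on k W g"
  shows "Ck_on k W (\<lambda>x. m (f x) (g x))"
  using assms(3,4)
proof (induction k arbitrary: f g)
  case 0
  then show ?case by (simp add: bounded_bilinear.continuous_on[OF assms(1)])
next
  case (Suc k)
  show ?case
  proof (rule Ck_on_SucI[OF assms(2) bounded_bilinear.FDERIV[OF assms(1)
            Ck_on_Suc_has_derivative[OF Suc.prems(1)] Ck_on_Suc_has_derivative[OF Suc.prems(2)]]])
    show "Ck_on k W (\<lambda>x. m (f x) (frechet_derivative g (at x) v) + m (frechet_derivative f (at x) v) (g x))" for v
      using Suc.prems Suc.prems[THEN Ck_on_SucD] by (auto intro!: Ck_on_add Suc.IH assms)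
  qed
qed

lemma linear_Basis_expansion:
  fixes L :: "'a::euclidean_space \<Rightarrow> 'b::real_normed_vector"
  assumes "linear L"
  shows "L v = (\<Sum>i\<in>Basis. (v \<bullet> i) *\<^sub>R L i)"
proof -
  have "L (\<Sum>i\<in>Basis. (v \<bullet> i) *\<^sub>R i) = (\<Sum>i\<in>Basis. (v \<bullet> i) *\<^sub>R L i)"
    using assms by (simp add: linear_sum linear_scale)
  then show ?thesis by (simp add: euclidean_representation)
qed

lemma Ck_on_compose:
  fixes f :: "'a::real_normed_vector \<Rightarrow> 'b::euclidean_space" and g :: "'b \<Rightarrow> 'c::real_normed_vector"
  assumes "open W" "open V" "f ` W \<subseteq> V" "Ck_on k W f" "Ck_on k V g"
  shows "Ck_on k W (\<lambda>x. g (f x))"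
  using assms(4,5)
proof (induction k arbitrary: g)
  case 0
  then show ?case using assms(3) by (auto intro: continuous_on_compose2)
next
  case (Suc k)
  have dg: "(g has_derivative frechet_derivative g (at (f x))) (at (f x))" if "x \<in> W" for x
    using Ck_on_Suc_has_derivative[OF Suc.prems(2)] that assms(3) by blast
  show ?case
  proof (rule Ck_on_SucI[OF assms(1) has_derivative_compose[OF Ck_on_Suc_has_derivative[OF Suc.prems(1)] dg]])
    fix v
    \<comment> \<open>In the chain rule the argument of the outer derivative moves with
      \<open>x\<close>, while the hypothesis on \<open>g\<close> controls its derivative in fixed
      directions; expanding in the basis separates the two.\<close>
    have "Ck_on k W (\<lambda>x. \<Sum>i\<in>Basis. (frechet_derivative f (at x) v \<bullet> i) *\<^sub>R frechet_derivative g (at (f x)) i)"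
      using Suc.prems Suc.prems[THEN Ck_on_SucD]
      by (auto intro!: Ck_on_sum assms(1) Ck_on_bilinear[OF bounded_bilinear_scaleR]
          Ck_on_bounded_linear[OF bounded_linear_inner_left] Suc.IH)
    then show "Ck_on k W (\<lambda>x. frechet_derivative g (at (f x)) (frechet_derivative f (at x) v))"
      by (rule Ck_on_cong[OF assms(1)])
        (metis linear_Basis_expansion has_derivative_linear dg)
  qed
qed

lemma Cinf_on_cong:
  "open W \<Longrightarrow> Cinf_on W f \<Longrightarrow> (\<And>x. x \<in> W \<Longrightarrow> f x = g x) \<Longrightarrow> Cinf_on W g"
  unfolding Cinf_on_def using Ck_on_cong by blast

lemma Cinf_on_subset: "Cinf_on W f \<Longrightarrow> V \<subseteq> W \<Longrightarrow> Cinf_on V f"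
  unfolding Cinf_on_def using Ck_on_subset by blast

lemma Cinf_on_local:
  "(\<And>x. x \<in> W \<Longrightarrow> \<exists>V. open V \<and> x \<in> V \<and> Cinf_on V f) \<Longrightarrow> Cinf_on W f"
  unfolding Cinf_on_def by (metis Ck_on_local)

lemma Cinf_on_has_derivative:
  "Cinf_on W f \<Longrightarrow> x \<in> W \<Longrightarrow> (f has_derivative frechet_derivative f (at x)) (at x)"
  unfolding Cinf_on_def using Ck_on_Suc_has_derivative by blast

lemma Cinf_on_imp_continuous_on: "Cinf_on W f \<Longrightarrow> continuous_on W f"
  unfolding Cinf_on_def using Ck_on_imp_continuous_on by blast

lemma Cinf_on_frechet_derivative: "Cinf_on W f \<Longrightarrow> Cinf_on W (\<lambda>x. frechet_derivative f (at x) v)"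
  unfolding Cinf_on_def using Ck_on.simps(2) by blast

lemma Cinf_on_const: "Cinf_on W (\<lambda>x. c)"
  unfolding Cinf_on_def by (simp add: Ck_on_const)

lemma Cinf_on_linear: "bounded_linear L \<Longrightarrow> open W \<Longrightarrow> Cinf_on W L"
  unfolding Cinf_on_def by (simp add: Ck_on_linear)

lemma Cinf_on_bounded_linear:
  "bounded_linear L \<Longrightarrow> open W \<Longrightarrow> Cinf_on W f \<Longrightarrow> Cinf_on W (\<lambda>x. L (f x))"
  unfolding Cinf_on_def by (simp add: Ck_on_bounded_linear)

lemma Cinf_on_add:
  "open W \<Longrightarrow> Cinf_on W f \<Longrightarrow> Cinf_on W g \<Longrightarrow> Cinf_on W (\<lambda>x. f x + g x)"
  unfolding Cinf_on_def by (simp add: Ck_on_add)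

lemma Cinf_on_sum:
  "open W \<Longrightarrow> finite I \<Longrightarrow> (\<And>i. i \<in> I \<Longrightarrow> Cinf_on W (f i)) \<Longrightarrow> Cinf_on W (\<lambda>x. \<Sum>i\<in>I. f i x)"
  unfolding Cinf_on_def by (simp add: Ck_on_sum)

lemma Cinf_on_bilinear:
  "bounded_bilinear m \<Longrightarrow> open W \<Longrightarrow> Cinf_on W f \<Longrightarrow> Cinf_on W g \<Longrightarrow> Cinf_on W (\<lambda>x. m (f x) (g x))"
  unfolding Cinf_on_def by (simp add: Ck_on_bilinear)

lemmas Cinf_on_scaleR = Cinf_on_bilinear[OF bounded_bilinear_scaleR]
lemmas Cinf_on_mult = Cinf_on_bilinear[OF bounded_bilinear_mult]

lemma Cinf_on_inner_left: "open W \<Longrightarrow> Cinf_on W f \<Longrightarrow> Cinf_on W (\<lambda>x. f x \<bullet> c)"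
  by (rule Cinf_on_bounded_linear[OF bounded_linear_inner_left])

lemma Cinf_on_compose:
  "open W \<Longrightarrow> open V \<Longrightarrow> f ` W \<subseteq> V \<Longrightarrow> Cinf_on W f \<Longrightarrow> Cinf_on V g \<Longrightarrow> Cinf_on W (\<lambda>x. g (f x))"
  unfolding Cinf_on_def using Ck_on_compose by blast

lemma Cinf_on_Pair:
  assumes "open W" "Cinf_on W f" "Cinf_on W g"
  shows "Cinf_on W (\<lambda>x. (f x, g x))"
proof -
  have "Cinf_on W (\<lambda>x. (f x, 0) + (0, g x))"
    using assms by (intro Cinf_on_add)
      (auto intro!: Cinf_on_bounded_linear[of "\<lambda>y. (y, 0)"] Cinf_on_bounded_linear[of "Pair 0"]
        bounded_linear_Pair bounded_linear_zero bounded_linear_ident)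
  then show ?thesis by simp
qed

text \<open>A family closed under differentiation, up to constant combinations of two members, is
  smooth: the induction on the order treats all indices at once.\<close>

lemma Cinf_on_real_deriv_family:
  fixes f :: "'i \<Rightarrow> real \<Rightarrow> real"
  assumes "open W"
    and deriv: "\<And>i x. x \<in> W \<Longrightarrow> (f i has_real_derivative a i * f (r i) x + b i * f (s i) x) (at x)"
  shows "Cinf_on W (f i)"
proof -
  have "Ck_on k W (f i)" for k i
  proof (induction k arbitrary: i)
    case 0
    then show ?case
      using deriv by (auto intro!: continuous_at_imp_continuous_on DERIV_isCont)
  next
    case (Suc k)
    show ?case
    proof (rule Ck_on_SucI[OF assms(1), where f' = "\<lambda>x v. (a i * f (r i) x + b i * f (s i) x) * v"])
      show "(f i has_derivative (*) (a i * f (r i) x + b i * f (s i) x)) (at x)" if "x \<in> W" for x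
        using deriv[OF that] by (simp add: has_field_derivative_def)
      show "Ck_on k W (\<lambda>x. (a i * f (r i) x + b i * f (s i) x) * v)" for v
        by (intro Ck_on_add Ck_on_bilinear[OF bounded_bilinear_mult] Ck_on_const assms(1) Suc)
    qed
  qed
  then show ?thesis by (simp add: Cinf_on_def)
qed

lemma Cinf_on_sin: "Cinf_on UNIV (sin :: real \<Rightarrow> real)"
  \<comment> \<open>Index \<open>True\<close> is sine and \<open>False\<close> is cosine;
    \<open>Not\<close> swaps them, and -1 is the sign in the derivative of cosine.\<close>
  using Cinf_on_real_deriv_family[of UNIV "\<lambda>i. if i then sin else cos" "\<lambda>i. if i then 1 else -1" Not "\<lambda>_. 0" id True]
  by (simp add: DERIV_sin DERIV_cos)

text \<open>Bootstrap: the derivative of \<open>1 / f\<close> is a product of two factors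
  \<open>1 / f\<close> and a derivative of \<open>f\<close>, so class \<open>k\<close> of
  \<open>1 / f\<close> yields class \<open>k + 1\<close>.\<close>

lemma Cinf_on_inverse:
  assumes "open W" "Cinf_on W f" "\<And>x. x \<in> W \<Longrightarrow> f x \<noteq> (0::real)"
  shows "Cinf_on W (\<lambda>x. inverse (f x))"
proof -
  have "Ck_on k W (\<lambda>x. inverse (f x))" for k
  proof (induction k)
    case 0
    then show ?case
      using assms Cinf_on_imp_continuous_on by (auto intro: continuous_on_inverse)
  next
    case (Suc k)
    have f: "Ck_on k W (\<lambda>x. frechet_derivative f (at x) v)" for v
      using Cinf_on_frechet_derivative[OF assms(2)] by (simp add: Cinf_on_def)
    show ?case
    proof (rule Ck_on_SucI[OF assms(1) Deriv.has_derivative_inverse[OF _ Cinf_on_has_derivative[OF assms(2)]]])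
      show "Ck_on k W (\<lambda>x. - (inverse (f x) * frechet_derivative f (at x) v * inverse (f x)))" for v
        by (intro Ck_on_bounded_linear[of uminus] Ck_on_bilinear[OF bounded_bilinear_mult] Suc f assms(1)
              bounded_linear_minus bounded_linear_ident)
    qed (use assms in auto)
  qed
  then show ?thesis by (simp add: Cinf_on_def)
qed

lemma has_derivative_along:
  assumes "(q has_derivative D) (at x)"
  shows "((\<lambda>t. q (x + t *\<^sub>R d)) has_real_derivative D d) (at 0)"
proof -
  have "((\<lambda>t. x + t *\<^sub>R d) has_derivative (\<lambda>t. t *\<^sub>R d)) (at 0)"
    by (auto intro!: derivative_eq_intros)
  moreover have "(q has_derivative D) (at (x + 0 *\<^sub>R d))" using assms by simp
  ultimately have "((\<lambda>t. q (x + t *\<^sub>R d)) has_derivative (\<lambda>t. D (t *\<^sub>R d))) (at 0)"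
    by (rule has_derivative_compose)
  moreover have "(\<lambda>t. D (t *\<^sub>R d)) = (*) (D d)"
    using linear_scale[OF has_derivative_linear[OF assms]] by (auto simp: fun_eq_iff)
  ultimately show ?thesis by (simp add: has_field_derivative_def)
qed

subsection \<open>Bump functions\<close>

text \<open>For \<open>n = 0\<close> this is the classical flat function. The powers of
  \<open>x\<close> in the denominator make the family closed under differentiation in the sense of
  \<open>Cinf_on_real_deriv_family\<close>.\<close>

definition flat_exp :: "nat \<Rightarrow> real \<Rightarrow> real" where
  "flat_exp n x = (if x > 0 then exp (- (1 / x)) / x ^ n else 0)"

lemma flat_exp_tendsto_0: "(flat_exp n \<longlongrightarrow> 0) (at 0)"
proof -
  \<comment> \<open>Passing to the reciprocal turns the limit into the decay of a power against the
    exponential at infinity.\<close>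
  have "((\<lambda>x::real. (inverse x) ^ n / exp (inverse x)) \<longlongrightarrow> 0) (at_right 0)"
    by (rule filterlim_compose[OF tendsto_power_div_exp_0 filterlim_inverse_at_top_right])
  then have "(flat_exp n \<longlongrightarrow> 0) (at_right 0)"
    by (rule Lim_transform_eventually)
      (auto simp: eventually_at_filter flat_exp_def field_simps exp_minus)
  moreover have "(flat_exp n \<longlongrightarrow> 0) (at_left 0)"
    by (rule tendsto_eventually) (auto simp: eventually_at_filter flat_exp_def)
  ultimately show ?thesis by (simp add: filterlim_split_at)
qed

lemma flat_exp_has_derivative:
  "(flat_exp n has_real_derivative 1 * flat_exp (n + 2) x + (- real n) * flat_exp (n + 1) x) (at x)"
proof -
  consider "x < 0" | "x = 0" | "x > 0" by linarith
  then show ?thesis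
  proof cases
    case 1
    have "((\<lambda>_. 0) has_real_derivative 0) (at x)" by simp
    then have "(flat_exp n has_real_derivative 0) (at x)"
      by (rule has_field_derivative_transform_within_open[of _ _ _ "{..<0}"])
        (use 1 in \<open>auto simp: flat_exp_def\<close>)
    then show ?thesis using 1 by (simp add: flat_exp_def)
  next
    case 2
    \<comment> \<open>The difference quotient of member \<open>n\<close> at 0 is member
      \<open>n + 1\<close>, whose limit there is already known.\<close>
    have "(\<lambda>h. (flat_exp n (0 + h) - flat_exp n 0) / h) = flat_exp (n + 1)"
      by (auto simp: flat_exp_def field_simps)
    then have "(flat_exp n has_real_derivative 0) (at 0)"
      using flat_exp_tendsto_0[of "n + 1"] by (simp add: DERIV_def)
    then show ?thesis using 2 by (simp add: flat_exp_def)
  next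
    case 3
    have "((\<lambda>x. exp (- (1 / x)) / x ^ n) has_real_derivative
        1 * flat_exp (n + 2) x + (- real n) * flat_exp (n + 1) x) (at x)"
      using 3
      by (cases n; auto intro!: derivative_eq_intros simp: flat_exp_def field_simps power2_eq_square;
          metis One_nat_def power_eq_if)
    then show ?thesis
      by (rule has_field_derivative_transform_within_open[of _ _ _ "{0<..}"])
        (use 3 in \<open>auto simp: flat_exp_def\<close>)
  qed
qed

lemma Cinf_on_flat_exp: "Cinf_on UNIV (flat_exp n)"
  by (rule Cinf_on_real_deriv_family[of _ _ "\<lambda>_. 1" "\<lambda>n. n + 2" "\<lambda>n. - real n" "\<lambda>n. n + 1"])
    (rule open_UNIV flat_exp_has_derivative)+

lemma exists_Cinf_bump:
  fixes y :: "'a::euclidean_space"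
  assumes "r > 0"
  obtains b :: "'a \<Rightarrow> real" where "Cinf_on UNIV b" "\<And>x. b x \<ge> 0" "\<And>x. b x > 0 \<longleftrightarrow> x \<in> ball y r"
proof
  \<comment> \<open>The argument is \<open>r\<^sup>2 - |x - y|\<^sup>2\<close>, positive exactly on
    the ball, written with the sums and products that the smoothness rules treat.\<close>
  let ?b = "\<lambda>x. flat_exp 0 (r\<^sup>2 + (-1) * ((x + (- y)) \<bullet> (x + (- y))))"
  show "Cinf_on UNIV ?b"
    by (intro Cinf_on_compose[of UNIV UNIV, OF _ _ _ _ Cinf_on_flat_exp] Cinf_on_add Cinf_on_mult Cinf_on_const
          Cinf_on_bilinear[OF bounded_bilinear_inner] Cinf_on_linear bounded_linear_ident) auto
  show "?b x \<ge> 0" for x by (simp add: flat_exp_def)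
  show "?b x > 0 \<longleftrightarrow> x \<in> ball y r" for x
  proof -
    have "?b x > 0 \<longleftrightarrow> (norm (x - y))\<^sup>2 < r\<^sup>2"
      by (simp add: flat_exp_def power2_norm_eq_inner)
    also have "\<dots> \<longleftrightarrow> x \<in> ball y r"
      using assms power2_less_imp_less[of "norm (x - y)" r] power_strict_mono[of "norm (x - y)" r 2]
      by (auto simp: dist_norm norm_minus_commute)
    finally show ?thesis .
  qed
qed

subsection \<open>Symmetry of second derivatives\<close>

text \<open>The left side is a difference in direction \<open>a\<close> of differences in direction
  \<open>b\<close>; one mean value theorem per direction turns it into a mixed derivative at an
  intermediate point.\<close>

lemma second_difference_eq:
  fixes f :: "'a::euclidean_space \<Rightarrow> real"
  assumes f: "Cinf_on W f" and "ball x r \<subseteq> W" "0 < h" "h * (norm a + norm b) < r"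
  obtains \<xi> where "dist \<xi> x \<le> h * (norm a + norm b)"
    "f (x + h *\<^sub>R a + h *\<^sub>R b) - f (x + h *\<^sub>R a) - f (x + h *\<^sub>R b) + f x =
       h * (h * frechet_derivative (\<lambda>y. frechet_derivative f (at y) a) (at \<xi>) b)"
proof -
  let ?fa = "\<lambda>y. frechet_derivative f (at y) a"
  have near: "norm (s *\<^sub>R a + t *\<^sub>R b) \<le> h * (norm a + norm b)" if "0 \<le> s" "s \<le> h" "0 \<le> t" "t \<le> h" for s t
  proof -
    have "norm (s *\<^sub>R a + t *\<^sub>R b) \<le> s * norm a + t * norm b"
      using norm_triangle_ineq[of "s *\<^sub>R a" "t *\<^sub>R b"] that by simp
    also have "\<dots> \<le> h * norm a + h * norm b"
      by (intro add_mono mult_right_mono that norm_ge_zero)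
    finally show ?thesis by (simp add: distrib_left)
  qed
  have inW: "x + s *\<^sub>R a + t *\<^sub>R b \<in> W" if "0 \<le> s" "s \<le> h" "0 \<le> t" "t \<le> h" for s t
  proof (rule subsetD[OF assms(2)])
    show "x + s *\<^sub>R a + t *\<^sub>R b \<in> ball x r"
      using near[OF that] assms(4) by (subst mem_ball, subst dist_commute) (simp add: dist_norm add.assoc)
  qed
  have line: "((\<lambda>s. g (z + s *\<^sub>R c)) has_real_derivative frechet_derivative g (at (z + s *\<^sub>R c)) c) (at s)"
    if "Cinf_on W g" "z + s *\<^sub>R c \<in> W" for g :: "'a \<Rightarrow> real" and z c s
  proof -
    have "((\<lambda>s. z + s *\<^sub>R c) has_derivative (\<lambda>t. t *\<^sub>R c)) (at s)"
      by (auto intro!: derivative_eq_intros)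
    from has_derivative_compose[OF this Cinf_on_has_derivative[OF that]]
    have "((\<lambda>s. g (z + s *\<^sub>R c)) has_derivative (\<lambda>t. frechet_derivative g (at (z + s *\<^sub>R c)) (t *\<^sub>R c))) (at s)" .
    moreover have "frechet_derivative g (at (z + s *\<^sub>R c)) (t *\<^sub>R c) = frechet_derivative g (at (z + s *\<^sub>R c)) c * t" for t
      using has_derivative_linear[OF Cinf_on_has_derivative[OF that]] by (simp add: linear_scale)
    ultimately show ?thesis by (simp add: has_field_derivative_def)
  qed
  let ?\<phi> = "\<lambda>s. f (x + h *\<^sub>R b + s *\<^sub>R a) - f (x + s *\<^sub>R a)"
  have "(?\<phi> has_real_derivative ?fa (x + h *\<^sub>R b + s *\<^sub>R a) - ?fa (x + s *\<^sub>R a)) (at s)" if "0 \<le> s" "s \<le> h" for s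
    using inW[of s h] inW[of s 0] that \<open>0 < h\<close> by (intro DERIV_diff line f) (auto simp: algebra_simps)
  from MVT2[OF \<open>0 < h\<close> this] obtain s where s: "0 < s" "s < h"
    "?\<phi> h - ?\<phi> 0 = h * (?fa (x + h *\<^sub>R b + s *\<^sub>R a) - ?fa (x + s *\<^sub>R a))" by auto
  have "((\<lambda>t. ?fa (x + s *\<^sub>R a + t *\<^sub>R b)) has_real_derivative
      frechet_derivative ?fa (at (x + s *\<^sub>R a + t *\<^sub>R b)) b) (at t)" if "0 \<le> t" "t \<le> h" for t
    using inW[of s t] that s by (intro line Cinf_on_frechet_derivative f) auto
  from MVT2[OF \<open>0 < h\<close> this] obtain t where t: "0 < t" "t < h"
    "?fa (x + s *\<^sub>R a + h *\<^sub>R b) - ?fa (x + s *\<^sub>R a + 0 *\<^sub>R b) = h * frechet_derivative ?fa (at (x + s *\<^sub>R a + t *\<^sub>R b)) b"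
    by auto
  show ?thesis
  proof
    show "dist (x + s *\<^sub>R a + t *\<^sub>R b) x \<le> h * (norm a + norm b)"
      using near[of s t] s t by (simp add: dist_norm add.assoc)
    show "f (x + h *\<^sub>R a + h *\<^sub>R b) - f (x + h *\<^sub>R a) - f (x + h *\<^sub>R b) + f x =
        h * (h * frechet_derivative ?fa (at (x + s *\<^sub>R a + t *\<^sub>R b)) b)"
      using s(3) t(3) by (simp add: algebra_simps)
  qed
qed

text \<open>The second difference is symmetric in \<open>a\<close> and \<open>b\<close>, so for
  small \<open>h\<close> the two mixed derivatives take a common value at two points near
  \<open>x\<close>; being continuous, they cannot differ at \<open>x\<close>.\<close>

lemma frechet_derivative_symmetric_real:
  fixes f :: "'a::euclidean_space \<Rightarrow> real"
  assumes "open W" "Cinf_on W f" "x \<in> W"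
  shows "frechet_derivative (\<lambda>y. frechet_derivative f (at y) a) (at x) b =
    frechet_derivative (\<lambda>y. frechet_derivative f (at y) b) (at x) a"
proof (rule ccontr)
  define D where "D a b y = frechet_derivative (\<lambda>y. frechet_derivative f (at y) a) (at y) b" for a b y
  assume "\<not> ?thesis"
  then have e: "\<bar>D a b x - D b a x\<bar> / 2 > 0" by (simp add: D_def)
  have "isCont (D a b) x" for a b
    using Cinf_on_imp_continuous_on[OF Cinf_on_frechet_derivative[OF Cinf_on_frechet_derivative[OF assms(2)]]]
      assms(1,3) unfolding D_def by (simp add: continuous_on_eq_continuous_at)
  then have "\<exists>d>0. \<forall>y. dist y x < d \<longrightarrow> \<bar>D a b y - D a b x\<bar> < e" if "e > 0" for e a b
    using that unfolding continuous_at_eps_delta dist_real_def by (metis dist_commute)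
  from this[OF e, of a b] this[OF e, of b a] obtain d1 d2 where d: "d1 > 0" "d2 > 0"
    "\<And>y. dist y x < d1 \<Longrightarrow> \<bar>D a b y - D a b x\<bar> < \<bar>D a b x - D b a x\<bar> / 2"
    "\<And>y. dist y x < d2 \<Longrightarrow> \<bar>D b a y - D b a x\<bar> < \<bar>D a b x - D b a x\<bar> / 2"
    by blast
  obtain r where r: "r > 0" "ball x r \<subseteq> W" using assms(1,3) openE by blast
  define N where "N = norm a + norm b + 1"
  have N: "N > 0" by (simp add: N_def add_nonneg_pos)
  \<comment> \<open>The \<open>+ 1\<close> in \<open>N\<close> keeps it positive even for
    \<open>a = b = 0\<close>; the factor 2 leaves room for a strict inequality.\<close>
  define h where "h = min r (min d1 d2) / (2 * N)"
  have h: "h > 0" using r d N by (simp add: h_def)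
  have "h * (norm a + norm b) < h * N" using h by (simp add: N_def)
  also have "h * N = min r (min d1 d2) / 2" using N by (simp add: h_def)
  also have "\<dots> < min r (min d1 d2)" using r(1) d(1,2) by (auto simp: min_def)
  finally have small: "h * (norm a + norm b) < min r (min d1 d2)" .
  obtain \<xi> where \<xi>: "dist \<xi> x \<le> h * (norm a + norm b)"
    "f (x + h *\<^sub>R a + h *\<^sub>R b) - f (x + h *\<^sub>R a) - f (x + h *\<^sub>R b) + f x = h * (h * D a b \<xi>)"
    using second_difference_eq[OF assms(2) r(2) h, of a b] small unfolding D_def by auto
  obtain \<zeta> where \<zeta>: "dist \<zeta> x \<le> h * (norm b + norm a)"
    "f (x + h *\<^sub>R b + h *\<^sub>R a) - f (x + h *\<^sub>R b) - f (x + h *\<^sub>R a) + f x = h * (h * D b a \<zeta>)"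
    using second_difference_eq[OF assms(2) r(2) h, of b a] small unfolding D_def by (auto simp: add.commute)
  have "h * (h * D a b \<xi>) = h * (h * D b a \<zeta>)"
    using \<xi>(2) \<zeta>(2) by (simp add: algebra_simps)
  then have "D a b \<xi> = D b a \<zeta>" using h by simp
  moreover have "dist \<xi> x < d1" "dist \<zeta> x < d2" using \<xi>(1) \<zeta>(1) small by (auto simp: add.commute)
  ultimately show False using d(3)[of \<xi>] d(4)[of \<zeta>] by (smt (verit, best) field_sum_of_halves)
qed

lemma frechet_derivative_inner:
  "f differentiable (at x) \<Longrightarrow> frechet_derivative (\<lambda>y. f y \<bullet> i) (at x) v = frechet_derivative f (at x) v \<bullet> i"
  by (metis frechet_derivative_at frechet_derivative_works has_derivative_inner_left)

lemma frechet_derivative_symmetric: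
  fixes f :: "'a::euclidean_space \<Rightarrow> 'b::euclidean_space"
  assumes "open W" "Cinf_on W f" "x \<in> W"
  shows "frechet_derivative (\<lambda>y. frechet_derivative f (at y) a) (at x) b =
    frechet_derivative (\<lambda>y. frechet_derivative f (at y) b) (at x) a"
proof (rule euclidean_eqI)
  fix i :: 'b assume "i \<in> Basis"
  have d: "g differentiable (at y)" if "Cinf_on W g" "y \<in> W" for g :: "'a \<Rightarrow> 'b" and y
    using Cinf_on_has_derivative[OF that] by (auto simp: differentiable_def)
  have "frechet_derivative (\<lambda>y. frechet_derivative f (at y) a) (at x) b \<bullet> i =
      frechet_derivative (\<lambda>y. frechet_derivative (\<lambda>z. f z \<bullet> i) (at y) a) (at x) b" for a b
  proof -
    have "frechet_derivative (\<lambda>y. frechet_derivative f (at y) a) (at x) b \<bullet> i =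
        frechet_derivative (\<lambda>y. frechet_derivative f (at y) a \<bullet> i) (at x) b"
      using d[OF Cinf_on_frechet_derivative[OF assms(2)] assms(3)] by (simp add: frechet_derivative_inner)
    also have "frechet_derivative (\<lambda>y. frechet_derivative f (at y) a \<bullet> i) (at x) =
        frechet_derivative (\<lambda>y. frechet_derivative (\<lambda>z. f z \<bullet> i) (at y) a) (at x)"
    proof (rule frechet_derivative_transform_within_open[OF _ assms(1,3)])
      show "(\<lambda>y. frechet_derivative f (at y) a \<bullet> i) differentiable at x"
        using Cinf_on_has_derivative[OF Cinf_on_inner_left[OF assms(1) Cinf_on_frechet_derivative[OF assms(2)]] assms(3)]
        by (auto simp: differentiable_def)
    qed (simp add: frechet_derivative_inner d[OF assms(2)])
    finally show ?thesis .
  qed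
  then show "frechet_derivative (\<lambda>y. frechet_derivative f (at y) a) (at x) b \<bullet> i =
      frechet_derivative (\<lambda>y. frechet_derivative f (at y) b) (at x) a \<bullet> i"
    using frechet_derivative_symmetric_real[OF assms(1) Cinf_on_inner_left[OF assms(1,2)] assms(3)] by simp
qed

subsection \<open>Smooth local inverses\<close>

text \<open>A product rule in which the second factor is merely continuous. In the splitting
  \<open>p y c x + p y (c y - c x)\<close> the last term is of smaller order, because
  \<open>p\<close> vanishes at \<open>x\<close>.\<close>

lemma has_derivative_scaleR_vanishing:
  fixes p :: "'a::real_normed_vector \<Rightarrow> real" and c :: "'a \<Rightarrow> 'b::real_normed_vector"
  assumes "(p has_derivative p') (at x)" "p x = 0" "isCont c x"
  shows "((\<lambda>y. p y *\<^sub>R c y) has_derivative (\<lambda>w. p' w *\<^sub>R c x)) (at x)"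
proof -
  obtain K where K: "\<And>w. norm (p' w) \<le> norm w * K"
    using bounded_linear.bounded[OF has_derivative_bounded_linear[OF assms(1)]] by blast
  let ?e = "\<lambda>y. norm (p y - p' (y - x)) / norm (y - x)"
  have e: "(?e \<longlongrightarrow> 0) (at x)"
    using assms(1,2) by (simp add: has_derivative_iff_norm)
  have "((\<lambda>y. p y *\<^sub>R (c y - c x)) has_derivative (\<lambda>w. 0)) (at x)"
    unfolding has_derivative_iff_norm
  proof (rule conjI[OF bounded_linear_zero], rule tendsto_sandwich[OF _ _ tendsto_const])
    have "(c \<longlongrightarrow> c x) (at x)" using assms(3) by (simp add: isCont_def)
    then have "((\<lambda>y. (?e y + K) * norm (c y - c x)) \<longlongrightarrow> (0 + K) * norm (c x - c x)) (at x)"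
      by (intro tendsto_intros e)
    then show "((\<lambda>y. (?e y + K) * norm (c y - c x)) \<longlongrightarrow> 0) (at x)" by simp
    have "norm (p y) / norm (y - x) \<le> ?e y + K" if "y \<noteq> x" for y
    proof -
      have "norm (p y) \<le> norm (p y - p' (y - x)) + norm (p' (y - x))"
        using norm_triangle_ineq[of "p y - p' (y - x)" "p' (y - x)"] by simp
      also have "\<dots> \<le> norm (p y - p' (y - x)) + K * norm (y - x)"
        using K[of "y - x"] by (simp add: mult.commute)
      finally show ?thesis using that by (simp add: field_simps)
    qed
    then have "norm (p y) / norm (y - x) * norm (c y - c x) \<le> (?e y + K) * norm (c y - c x)" if "y \<noteq> x" for y
      using that by (intro mult_right_mono) auto
    then show "\<forall>\<^sub>F y in at x. norm (p y *\<^sub>R (c y - c x) - p x *\<^sub>R (c x - c x) - 0) / norm (y - x) \<le>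
        (?e y + K) * norm (c y - c x)"
      by (simp add: eventually_at_filter assms(2))
  qed simp
  moreover have "((\<lambda>y. p y *\<^sub>R c x) has_derivative (\<lambda>w. p' w *\<^sub>R c x)) (at x)"
    by (rule bounded_linear.has_derivative[OF bounded_linear_scaleR_left assms(1)])
  ultimately have "((\<lambda>y. p y *\<^sub>R c x + p y *\<^sub>R (c y - c x)) has_derivative (\<lambda>w. p' w *\<^sub>R c x + 0)) (at x)"
    by (rule has_derivative_add[rotated])
  then show ?thesis by (simp add: algebra_simps)
qed

text \<open>\<open>N x\<close> inverts the derivative of \<open>G\<close> at \<open>x\<close>. The
  identity \<open>N y - N x = N y (G' x - G' y) N x\<close> gives continuity through the uniform
  bound \<open>C\<close>, then the derivative \<open>- N G'' N\<close>; as this involves only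
  \<open>N\<close> and derivatives of \<open>G\<close>, induction gives smoothness.\<close>

lemma Cinf_on_inverse_derivative:
  fixes G :: "'a::euclidean_space \<Rightarrow> 'a" and N :: "'a \<Rightarrow> 'a \<Rightarrow> 'a"
  assumes "open U" and G: "Cinf_on U G"
    and lin: "\<And>x. x \<in> U \<Longrightarrow> linear (N x)"
    and left: "\<And>x v. x \<in> U \<Longrightarrow> N x (frechet_derivative G (at x) v) = v"
    and right: "\<And>x v. x \<in> U \<Longrightarrow> frechet_derivative G (at x) (N x v) = v"
    and bound: "\<And>x v. x \<in> U \<Longrightarrow> norm (N x v) \<le> C * norm v"
  shows "Cinf_on U (\<lambda>x. N x v)"
proof -
  let ?G' = "\<lambda>x. frechet_derivative G (at x)"
  define D2 where "D2 x u w = frechet_derivative (\<lambda>y. ?G' y u) (at x) w" for x u w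
  have G'lin: "linear (?G' x)" if "x \<in> U" for x
    using has_derivative_linear[OF Cinf_on_has_derivative[OF G that]] .
  have diff: "N y v - N x v = N y (?G' x (N x v) - ?G' y (N x v))" if "x \<in> U" "y \<in> U" for x y v
    using that by (simp add: linear_diff[OF lin] left right)
  have cont: "isCont (\<lambda>y. N y v) x" if x: "x \<in> U" for v x
  proof -
    let ?q = "\<lambda>y. ?G' x (N x v) - ?G' y (N x v)"
    have "isCont (\<lambda>y. ?G' y (N x v)) x"
      using Cinf_on_imp_continuous_on[OF Cinf_on_frechet_derivative[OF G]] \<open>open U\<close> x
      by (simp add: continuous_on_eq_continuous_at)
    then have "(?q \<longlongrightarrow> 0) (at x)"
      by (intro tendsto_eq_intros) (auto simp: isCont_def)
    then have "((\<lambda>y. N y v - N x v) \<longlongrightarrow> 0) (at x)"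
    proof (rule tendsto_0_le)
      show "\<forall>\<^sub>F y in at x. norm (N y v - N x v) \<le> norm (?q y) * C"
        using eventually_at_topological[of "\<lambda>y. y \<in> U" x UNIV] \<open>open U\<close> x
        by (auto elim!: eventually_mono simp: diff[OF x] mult.commute bound intro!: exI[of _ U])
    qed
    then show ?thesis by (simp add: isCont_def LIM_zero_iff)
  qed
  define N' where "N' x v w = (\<Sum>j\<in>Basis. ((- (\<Sum>i\<in>Basis. (N x v \<bullet> i) *\<^sub>R D2 x i w)) \<bullet> j) *\<^sub>R N x j)" for x v w
  have deriv: "((\<lambda>y. N y v) has_derivative N' x v) (at x)" if x: "x \<in> U" for x v
  proof -
    let ?q = "\<lambda>y. ?G' x (N x v) - (\<Sum>i\<in>Basis. (N x v \<bullet> i) *\<^sub>R ?G' y i)"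
    have "(?q has_derivative (\<lambda>w. 0 - (\<Sum>i\<in>Basis. (N x v \<bullet> i) *\<^sub>R D2 x i w))) (at x)"
      unfolding D2_def
      by (intro has_derivative_diff has_derivative_const has_derivative_sum
          bounded_linear.has_derivative[OF bounded_linear_scaleR_right]
          Cinf_on_has_derivative[OF Cinf_on_frechet_derivative[OF G] x])
    then have q: "(?q has_derivative (\<lambda>w. - (\<Sum>i\<in>Basis. (N x v \<bullet> i) *\<^sub>R D2 x i w))) (at x)" by simp
    have qx: "?q x = 0" using linear_Basis_expansion[OF G'lin[OF x], of "N x v"] by simp
    \<comment> \<open>At this point \<open>N y j\<close> is only known to be continuous, but its
      coefficient vanishes at \<open>y = x\<close>, so no derivative of \<open>N\<close>
      enters.\<close>
    have "((\<lambda>y. \<Sum>j\<in>Basis. (?q y \<bullet> j) *\<^sub>R N y j) has_derivative N' x v) (at x)"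
      unfolding N'_def
      by (intro has_derivative_sum has_derivative_scaleR_vanishing cont x
          bounded_linear.has_derivative[OF bounded_linear_inner_left q]) (simp only: qx inner_zero_left)
    then have "((\<lambda>y. N x v + (\<Sum>j\<in>Basis. (?q y \<bullet> j) *\<^sub>R N y j)) has_derivative N' x v) (at x)"
      by (rule has_derivative_add_const[of _ _ _ "N x v", simplified add.commute[of _ "N x v"]])
    then show ?thesis
    proof (rule has_derivative_transform_within_open[OF _ \<open>open U\<close> x])
      fix y assume y: "y \<in> U"
      have "(\<Sum>j\<in>Basis. (?q y \<bullet> j) *\<^sub>R N y j) = N y (?q y)"
        by (rule linear_Basis_expansion[OF lin[OF y], symmetric])
      also have "\<dots> = N y v - N x v"
        by (simp only: diff[OF x y] linear_Basis_expansion[OF G'lin[OF y], of "N x v"])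
      finally show "N x v + (\<Sum>j\<in>Basis. (?q y \<bullet> j) *\<^sub>R N y j) = N y v"
        by simp
    qed
  qed
  have "Ck_on k U (\<lambda>x. N x v)" for k v
  proof (induction k arbitrary: v)
    case 0
    then show ?case using cont by (auto intro: continuous_at_imp_continuous_on)
  next
    case (Suc k)
    have "Ck_on k U (\<lambda>x. D2 x i w)" for i w
      using Cinf_on_frechet_derivative[OF Cinf_on_frechet_derivative[OF G]] by (simp add: D2_def Cinf_on_def)
    then show ?case
      by (intro Ck_on_SucI[OF \<open>open U\<close> deriv])
        (auto simp: N'_def intro!: Ck_on_sum Ck_on_bilinear[OF bounded_bilinear_scaleR] \<open>open U\<close> Suc
          Ck_on_bounded_linear[OF bounded_linear_inner_left]
          Ck_on_bounded_linear[OF bounded_linear_minus[OF bounded_linear_ident]])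
  qed
  then show ?thesis by (simp add: Cinf_on_def)
qed

text \<open>The inverse function theorem gives \<open>H\<close> with derivative
  \<open>N (H y)\<close>; as \<open>N\<close> is smooth, this equation raises the order of
  differentiability of \<open>H\<close> without end. The normalisation at \<open>x0\<close> fits the
  later use, where a linear left inverse is composed in.\<close>

lemma Cinf_on_local_inverse:
  fixes G :: "'a::euclidean_space \<Rightarrow> 'a"
  assumes "open X" and G: "Cinf_on X G" and "x0 \<in> X" and id: "frechet_derivative G (at x0) = id"
  obtains U V H where "open U" "U \<subseteq> X" "x0 \<in> U" "open V" "homeomorphism U V G H" "Cinf_on V H"
proof -
  define f' where "f' x = Blinfun (frechet_derivative G (at x))" for x
  have f'_apply: "blinfun_apply (f' x) = frechet_derivative G (at x)" if "x \<in> X" for x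
    using has_derivative_bounded_linear[OF Cinf_on_has_derivative[OF G that]]
    by (simp add: f'_def bounded_linear_Blinfun_apply)
  have cont: "continuous_on X f'"
  proof (rule continuous_on_blinfun_componentwise)
    show "continuous_on X (\<lambda>x. blinfun_apply (f' x) i)" for i
      using Cinf_on_imp_continuous_on[OF Cinf_on_frechet_derivative[OF G]]
      by (rule continuous_on_eq) (simp add: f'_apply)
  qed
  \<comment> \<open>Within 1/2 of the identity the derivative has an inverse of norm at most 2: for
    \<open>w = N x v\<close> one gets \<open>|w| \<le> |v| + |w| / 2\<close>.\<close>
  define X1 where "X1 = X \<inter> f' -` ball id_blinfun (1/2)"
  have "open X1" unfolding X1_def using cont \<open>open X\<close> by (intro continuous_open_preimage) auto
  have "X1 \<subseteq> X" by (auto simp: X1_def)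
  have f'x0: "f' x0 = id_blinfun"
    by (rule blinfun_eqI) (simp add: f'_apply \<open>x0 \<in> X\<close> id)
  then have "x0 \<in> X1" by (simp add: X1_def \<open>x0 \<in> X\<close>)
  obtain U V H H' where *: "open U" "U \<subseteq> X1" "x0 \<in> U" "open V" "G x0 \<in> V" "homeomorphism U V G H"
    "\<And>y. y \<in> V \<Longrightarrow> (H has_derivative H' y) (at y)"
    "\<And>y. y \<in> V \<Longrightarrow> H' y = inv (blinfun_apply (f' (H y)))"
    "\<And>y. y \<in> V \<Longrightarrow> bij (blinfun_apply (f' (H y)))"
  proof (rule inverse_function_theorem[OF \<open>open X1\<close> _ _ \<open>x0 \<in> X1\<close>, of G f' id_blinfun])
    show "(G has_derivative blinfun_apply (f' x)) (at x)" if "x \<in> X1" for x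
      using Cinf_on_has_derivative[OF G] that \<open>X1 \<subseteq> X\<close> f'_apply by auto
    show "continuous_on X1 f'" using cont \<open>X1 \<subseteq> X\<close> continuous_on_subset by blast
    show "id_blinfun o\<^sub>L f' x0 = id_blinfun" by (rule blinfun_eqI) (simp add: f'x0)
  qed (rule that)
  have U: "x \<in> X1" "x \<in> X" if "x \<in> U" for x using that *(2) \<open>X1 \<subseteq> X\<close> by auto
  have bij: "bij (frechet_derivative G (at x))" if "x \<in> U" for x
    using *(9)[of "G x"] *(6) that f'_apply[OF U(2)] by (auto simp: homeomorphism_def)
  define N where "N x = inv (frechet_derivative G (at x))" for x
  have N: "Cinf_on U (\<lambda>x. N x v)" for v
  proof (rule Cinf_on_inverse_derivative[OF \<open>open U\<close>, of G N 2])
    show "Cinf_on U G" using G U(2) by (auto intro: Cinf_on_subset)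
    show right: "frechet_derivative G (at x) (N x v) = v" if "x \<in> U" for x v
      using bij[OF that] by (simp add: N_def bij_is_surj surj_f_inv_f)
    show left: "N x (frechet_derivative G (at x) v) = v" if "x \<in> U" for x v
      using bij[OF that] by (simp add: N_def bij_is_inj)
    show "linear (N x)" if "x \<in> U" for x
    proof -
      have "linear (frechet_derivative G (at x))"
        using has_derivative_linear[OF Cinf_on_has_derivative[OF G U(2)[OF that]]] .
      from linear_add[OF this] linear_scale[OF this] show ?thesis
        using left[OF that] right[OF that] by (intro linearI) metis+
    qed
    show "norm (N x v) \<le> 2 * norm v" if "x \<in> U" for x v
    proof -
      let ?w = "N x v"
      have "norm (f' x - id_blinfun) < 1/2"
        using U(1)[OF that] by (simp add: X1_def dist_norm norm_minus_commute)
      then have "norm (blinfun_apply (f' x - id_blinfun) ?w) \<le> 1/2 * norm ?w"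
        by (intro order_trans[OF norm_blinfun mult_right_mono]) auto
      moreover have "blinfun_apply (f' x - id_blinfun) ?w = v - ?w"
        using right[OF that] by (simp add: blinfun.diff_left f'_apply U(2)[OF that])
      ultimately show ?thesis using norm_triangle_ineq2[of ?w v] by (simp add: norm_minus_commute)
    qed
  qed
  have H'N: "H' y = N (H y)" "H y \<in> U" if "y \<in> V" for y
  proof -
    show "H y \<in> U" using *(6) that by (auto simp: homeomorphism_def)
    then show "H' y = N (H y)" using *(8)[OF that] by (simp add: N_def f'_apply U(2))
  qed
  have "Ck_on k V H" for k
  proof (induction k)
    case 0
    then show ?case using *(6) by (simp add: homeomorphism_def)
  next
    case (Suc k)
    show ?case
    proof (rule Ck_on_SucI[OF \<open>open V\<close>, where f' = "\<lambda>y. N (H y)"])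
      show "(H has_derivative N (H y)) (at y)" if "y \<in> V" for y using *(7)[OF that] H'N(1)[OF that] by simp
      show "Ck_on k V (\<lambda>y. N (H y) v)" for v
        by (rule Ck_on_compose[OF \<open>open V\<close> \<open>open U\<close> _ Suc]) (use N H'N(2) in \<open>auto simp: Cinf_on_def\<close>)
    qed
  qed
  then have "Cinf_on V H" by (simp add: Cinf_on_def)
  with *(2) \<open>X1 \<subseteq> X\<close> show ?thesis
    by (intro that[OF *(1) _ *(3,4,6)]) auto
qed

section \<open>Smooth maps between manifolds\<close>

lemma smooth_atlasD:
  assumes "smooth_atlas A" "(U, \<phi>) \<in> A"
  shows "open U" "open (\<phi> ` U)" "inj_on \<phi> U" "continuous_on U \<phi>" "continuous_on (\<phi> ` U) (inv_into U \<phi>)"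
  using assms by (auto simp: smooth_atlas_def homeomorphism_def)

lemma smooth_atlas_transition:
  "smooth_atlas A \<Longrightarrow> (U, \<phi>) \<in> A \<Longrightarrow> (V, \<psi>) \<in> A \<Longrightarrow> Cinf_on (\<phi> ` (U \<inter> V)) (\<psi> \<circ> inv_into U \<phi>)"
  by (auto simp: smooth_atlas_def)

lemma smooth_atlas_chart:
  assumes "smooth_atlas A"
  obtains U \<phi> where "(U, \<phi>) \<in> A" "x \<in> U"
proof -
  have "x \<in> \<Union>(fst ` A)" using assms by (simp add: smooth_atlas_def)
  then show ?thesis using that by auto
qed

lemma open_chart_image:
  assumes "smooth_atlas A" "(U, \<phi>) \<in> A" "open W" "W \<subseteq> U"
  shows "open (\<phi> ` W)"
proof -
  note c = smooth_atlasD[OF assms(1,2)]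
  have "\<phi> ` W = \<phi> ` U \<inter> inv_into U \<phi> -` W"
    using assms(4) c(3) by auto
  then show ?thesis using continuous_open_preimage[OF c(5,2) assms(3)] by simp
qed

lemma open_chart_Int:
  "smooth_atlas A \<Longrightarrow> (U, \<phi>) \<in> A \<Longrightarrow> open W \<Longrightarrow> open (\<phi> ` (U \<inter> W))"
  using open_chart_image[of A U \<phi> "U \<inter> W"] smooth_atlasD(1)[of A U \<phi>] by auto

lemma open_Int_vimage:
  "open W \<Longrightarrow> continuous_on W f \<Longrightarrow> open V \<Longrightarrow> open (W \<inter> f -` V)"
  by (rule continuous_open_preimage)

lemma continuous_on_local:
  fixes f :: "'a::topological_space \<Rightarrow> 'b::topological_space"
  assumes "\<And>x. x \<in> W \<Longrightarrow> \<exists>V. open V \<and> x \<in> V \<and> continuous_on V f"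
  shows "continuous_on W f"
proof -
  obtain V where V: "\<And>x. x \<in> W \<Longrightarrow> open (V x) \<and> x \<in> V x \<and> continuous_on (V x) f" using assms by metis
  then have "continuous_on (\<Union>x\<in>W. V x) f" by (intro continuous_on_open_UN) auto
  then show ?thesis by (rule continuous_on_subset) (use V in auto)
qed

lemma smooth_map_onD:
  assumes "smooth_map_on A B W f" "(U, \<phi>) \<in> A" "(V, \<psi>) \<in> B"
  shows "Cinf_on (\<phi> ` (U \<inter> W \<inter> f -` V)) (\<psi> \<circ> f \<circ> inv_into U \<phi>)"
  using assms by (auto simp: smooth_map_on_def)

lemma smooth_map_on_continuous: "smooth_map_on A B W f \<Longrightarrow> continuous_on W f"
  by (simp add: smooth_map_on_def)

lemma smooth_map_on_subset:
  assumes "smooth_map_on A B W f" "V \<subseteq> W"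
  shows "smooth_map_on A B V f"
  unfolding smooth_map_on_def
proof (intro conjI, goal_cases)
  case 1
  show ?case using continuous_on_subset[OF smooth_map_on_continuous[OF assms(1)] assms(2)] .
next
  case 2
  have "Cinf_on (\<phi> ` (U \<inter> V \<inter> f -` Z)) (\<psi> \<circ> f \<circ> inv_into U \<phi>)" if "(U, \<phi>) \<in> A" "(Z, \<psi>) \<in> B" for U \<phi> Z \<psi>
    by (rule Cinf_on_subset[OF smooth_map_onD[OF assms(1) that]]) (use assms(2) in auto)
  then show ?case by auto
qed

lemma smooth_map_on_cong:
  assumes "smooth_atlas A" "smooth_atlas B" "open W" "smooth_map_on A B W f" "\<And>x. x \<in> W \<Longrightarrow> f x = g x"
  shows "smooth_map_on A B W g"
  unfolding smooth_map_on_def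
proof (intro conjI, goal_cases)
  case 1
  show ?case using smooth_map_on_continuous[OF assms(4)] assms(5) by (simp cong: continuous_on_cong)
next
  case 2
  {
    fix U \<phi> V \<psi> assume U: "(U, \<phi>) \<in> A" and V: "(V, \<psi>) \<in> B"
    have eq: "U \<inter> W \<inter> g -` V = U \<inter> (W \<inter> f -` V)" using assms(5) by auto
    have "open (U \<inter> (W \<inter> f -` V))"
      using smooth_atlasD[OF assms(1) U] smooth_atlasD[OF assms(2) V] smooth_map_on_continuous[OF assms(4)] assms(3)
      by (intro open_Int open_Int_vimage) auto
    then have "open (\<phi> ` (U \<inter> (W \<inter> f -` V)))" by (intro open_chart_image[OF assms(1) U]) auto
    then have "Cinf_on (\<phi> ` (U \<inter> W \<inter> g -` V)) (\<psi> \<circ> g \<circ> inv_into U \<phi>)"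
      unfolding eq
      by (rule Cinf_on_cong[OF _ smooth_map_onD[OF assms(4) U V, unfolded Int_assoc]])
        (use smooth_atlasD(3)[OF assms(1) U] assms(5) in auto)
  }
  then show ?case by auto
qed

lemma smooth_map_on_local:
  assumes "smooth_atlas A" "smooth_atlas B"
    and loc: "\<And>x. x \<in> W \<Longrightarrow> \<exists>V. open V \<and> x \<in> V \<and> smooth_map_on A B V f"
  shows "smooth_map_on A B W f"
  unfolding smooth_map_on_def
proof (intro conjI, goal_cases)
  case 1
  show ?case
    by (rule continuous_on_local) (meson loc smooth_map_on_continuous)
next
  case 2
  {
    fix U \<phi> Z \<psi> assume U: "(U, \<phi>) \<in> A" and Z: "(Z, \<psi>) \<in> B"
    have "Cinf_on (\<phi> ` (U \<inter> W \<inter> f -` Z)) (\<psi> \<circ> f \<circ> inv_into U \<phi>)"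
    proof (rule Cinf_on_local)
      fix y assume "y \<in> \<phi> ` (U \<inter> W \<inter> f -` Z)"
      then obtain x where x: "x \<in> U" "x \<in> W" "f x \<in> Z" "y = \<phi> x" by auto
      obtain V where V: "open V" "x \<in> V" "smooth_map_on A B V f" using loc x by blast
      have "open (U \<inter> (V \<inter> f -` Z))"
        using smooth_atlasD[OF assms(1) U] smooth_atlasD[OF assms(2) Z] smooth_map_on_continuous[OF V(3)] V(1)
        by (intro open_Int open_Int_vimage) auto
      then have "open (\<phi> ` (U \<inter> (V \<inter> f -` Z)))" by (intro open_chart_image[OF assms(1) U]) auto
      then show "\<exists>V. open V \<and> y \<in> V \<and> Cinf_on V (\<psi> \<circ> f \<circ> inv_into U \<phi>)"
        using smooth_map_onD[OF V(3) U Z] x V(2)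
        by (intro exI[of _ "\<phi> ` (U \<inter> (V \<inter> f -` Z))"]) (auto simp: Int_assoc)
    qed
  }
  then show ?case by auto
qed

lemma smooth_map_on_compose:
  fixes f :: "'a::topological_space \<Rightarrow> 'b::topological_space" and g :: "'b \<Rightarrow> 'c::topological_space"
  assumes A: "smooth_atlas A" and B: "smooth_atlas B" and C: "smooth_atlas C"
    and "open W" "open V" "f ` W \<subseteq> V" and f: "smooth_map_on A B W f" and g: "smooth_map_on B C V g"
  shows "smooth_map_on A C W (\<lambda>x. g (f x))"
  unfolding smooth_map_on_def
proof (intro conjI, goal_cases)
  case 1
  show ?case
    using smooth_map_on_continuous[OF f] smooth_map_on_continuous[OF g] \<open>f ` W \<subseteq> V\<close>
    by (auto intro: continuous_on_compose2)
next
  case 2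
  {
    fix U \<phi> Z \<theta> assume U: "(U, \<phi>) \<in> A" and Z: "(Z, \<theta>) \<in> C"
    have "Cinf_on (\<phi> ` (U \<inter> W \<inter> (\<lambda>x. g (f x)) -` Z)) (\<theta> \<circ> (\<lambda>x. g (f x)) \<circ> inv_into U \<phi>)"
    proof (rule Cinf_on_local)
      fix y assume "y \<in> \<phi> ` (U \<inter> W \<inter> (\<lambda>x. g (f x)) -` Z)"
      then obtain x where x: "x \<in> U" "x \<in> W" "g (f x) \<in> Z" "y = \<phi> x" by auto
      obtain X \<psi> where X: "(X, \<psi>) \<in> B" "f x \<in> X" using smooth_atlas_chart[OF B] .
      \<comment> \<open>A chart domain need not be mapped into a single chart of the middle
        manifold; shrinking to the preimage of \<open>V'\<close> permits the factorisation through
        \<psi>.\<close>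
      define V' where "V' = X \<inter> (V \<inter> g -` Z)"
      have "open V'"
        unfolding V'_def using smooth_atlasD(1)[OF B X(1)] smooth_atlasD(1)[OF C Z]
        by (intro open_Int open_Int_vimage[OF \<open>open V\<close>] smooth_map_on_continuous[OF g])
      define W' where "W' = U \<inter> (W \<inter> f -` V')"
      have "open W'"
        unfolding W'_def using smooth_atlasD(1)[OF A U] \<open>open V'\<close>
        by (intro open_Int open_Int_vimage[OF \<open>open W\<close>] smooth_map_on_continuous[OF f])
      then have oW: "open (\<phi> ` W')" by (intro open_chart_image[OF A U]) (auto simp: W'_def)
      have oV: "open (\<psi> ` V')" using \<open>open V'\<close> by (intro open_chart_image[OF B X(1)]) (auto simp: V'_def)
      have f': "Cinf_on (\<phi> ` W') (\<psi> \<circ> f \<circ> inv_into U \<phi>)"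
        by (rule Cinf_on_subset[OF smooth_map_onD[OF f U X(1)]]) (auto simp: W'_def V'_def)
      have g': "Cinf_on (\<psi> ` V') (\<theta> \<circ> g \<circ> inv_into X \<psi>)"
        by (rule Cinf_on_subset[OF smooth_map_onD[OF g X(1) Z]]) (auto simp: V'_def)
      have "Cinf_on (\<phi> ` W') (\<lambda>y. (\<theta> \<circ> g \<circ> inv_into X \<psi>) ((\<psi> \<circ> f \<circ> inv_into U \<phi>) y))"
        using smooth_atlasD(3)[OF A U] by (intro Cinf_on_compose[OF oW oV _ f' g']) (auto simp: W'_def)
      then have "Cinf_on (\<phi> ` W') (\<theta> \<circ> (\<lambda>x. g (f x)) \<circ> inv_into U \<phi>)"
        by (rule Cinf_on_cong[OF oW])
          (use smooth_atlasD(3)[OF A U] smooth_atlasD(3)[OF B X(1)] in \<open>auto simp: W'_def V'_def\<close>)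
      then show "\<exists>V. open V \<and> y \<in> V \<and> Cinf_on V (\<theta> \<circ> (\<lambda>x. g (f x)) \<circ> inv_into U \<phi>)"
        using oW x X \<open>f ` W \<subseteq> V\<close> by (intro exI[of _ "\<phi> ` W'"]) (auto simp: W'_def V'_def)
    qed
  }
  then show ?case by auto
qed

lemma smooth_map_on_const: "smooth_map_on A B W (\<lambda>_. c)"
  by (auto simp: smooth_map_on_def o_def Cinf_on_const)

lemma smooth_map_on_id:
  assumes "smooth_atlas A"
  shows "smooth_map_on A A W (\<lambda>x. x)"
proof (rule smooth_map_on_subset[OF _ subset_UNIV])
  show "smooth_map A A (\<lambda>x. x)"
    unfolding smooth_map_on_def using smooth_atlas_transition[OF assms] by (auto simp: o_def)
qed

lemma smooth_atlas_euclidean: "smooth_atlas euclidean_atlas"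
  by (auto simp: smooth_atlas_def euclidean_atlas_def homeomorphism_def
      intro!: Cinf_on_linear[OF bounded_linear_ident, folded id_def])

lemma smooth_map_on_euclidean_iff:
  fixes f :: "'a::topological_space \<Rightarrow> 'b::euclidean_space"
  assumes A: "smooth_atlas A" and "open W"
  shows "smooth_map_on A euclidean_atlas W f \<longleftrightarrow> (\<forall>(U, \<phi>)\<in>A. Cinf_on (\<phi> ` (U \<inter> W)) (f \<circ> inv_into U \<phi>))"
    (is "?L \<longleftrightarrow> ?R")
proof
  assume ?L then show ?R by (fastforce simp: smooth_map_on_def euclidean_atlas_def)
next
  assume R: ?R
  have "continuous_on W f"
  proof (rule continuous_on_local)
    fix x assume "x \<in> W"
    obtain U \<phi> where U: "(U, \<phi>) \<in> A" "x \<in> U" using smooth_atlas_chart[OF A] .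
    have "continuous_on (U \<inter> W) ((f \<circ> inv_into U \<phi>) \<circ> \<phi>)"
      using R U(1) smooth_atlasD(4)[OF A U(1)]
      by (intro continuous_on_compose Cinf_on_imp_continuous_on) (auto intro: continuous_on_subset)
    then have "continuous_on (U \<inter> W) f"
      by (rule continuous_on_eq) (use smooth_atlasD(3)[OF A U(1)] in auto)
    then show "\<exists>V. open V \<and> x \<in> V \<and> continuous_on V f"
      using \<open>x \<in> W\<close> U(2) smooth_atlasD(1)[OF A U(1)] \<open>open W\<close> by blast
  qed
  then show ?L using R by (auto simp: smooth_map_on_def euclidean_atlas_def)
qed

lemma smooth_map_on_Cinf_on:
  "open W \<Longrightarrow> smooth_map_on euclidean_atlas euclidean_atlas W f \<longleftrightarrow> Cinf_on W f"
  by (simp add: smooth_map_on_euclidean_iff smooth_atlas_euclidean) (simp add: euclidean_atlas_def)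

lemma smooth_map_on_chart:
  "smooth_atlas A \<Longrightarrow> (U, \<phi>) \<in> A \<Longrightarrow> smooth_map_on A euclidean_atlas U \<phi>"
  by (auto simp: smooth_map_on_euclidean_iff smooth_atlasD intro: smooth_atlas_transition)

lemma smooth_map_on_chart_inverse:
  assumes A: "smooth_atlas A" and U: "(U, \<phi>) \<in> A"
  shows "smooth_map_on euclidean_atlas A (\<phi> ` U) (inv_into U \<phi>)"
proof -
  have "\<phi> ` U \<inter> inv_into U \<phi> -` V = \<phi> ` (U \<inter> V)" for V
    using smooth_atlasD(3)[OF A U] by auto
  then show ?thesis
    using smooth_atlasD(5)[OF A U] smooth_atlas_transition[OF A U]
    by (auto simp: smooth_map_on_def euclidean_atlas_def)
qed

lemma smooth_map_on_add:
  fixes f g :: "'a::topological_space \<Rightarrow> 'b::euclidean_space"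
  assumes "smooth_atlas A" "open W" "smooth_map_on A euclidean_atlas W f" "smooth_map_on A euclidean_atlas W g"
  shows "smooth_map_on A euclidean_atlas W (\<lambda>x. f x + g x)"
  using assms(3,4) by (auto simp: smooth_map_on_euclidean_iff[OF assms(1,2)] o_def
      intro!: Cinf_on_add open_chart_Int[OF assms(1) _ assms(2)])

lemma smooth_map_on_mult:
  fixes f g :: "'a::topological_space \<Rightarrow> real"
  assumes "smooth_atlas A" "open W" "smooth_map_on A euclidean_atlas W f" "smooth_map_on A euclidean_atlas W g"
  shows "smooth_map_on A euclidean_atlas W (\<lambda>x. f x * g x)"
  using assms(3,4) by (auto simp: smooth_map_on_euclidean_iff[OF assms(1,2)] o_def
      intro!: Cinf_on_mult open_chart_Int[OF assms(1) _ assms(2)])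

lemma smooth_map_on_sum:
  fixes f :: "'i \<Rightarrow> 'a::topological_space \<Rightarrow> 'b::euclidean_space"
  assumes "smooth_atlas A" "open W" "finite I" "\<And>i. i \<in> I \<Longrightarrow> smooth_map_on A euclidean_atlas W (f i)"
  shows "smooth_map_on A euclidean_atlas W (\<lambda>x. \<Sum>i\<in>I. f i x)"
  using assms(3,4)
  by (induction I rule: finite_induct) (auto intro: smooth_map_on_add assms(1,2) smooth_map_on_const)

lemma smooth_map_on_inverse:
  fixes f :: "'a::topological_space \<Rightarrow> real"
  assumes "smooth_atlas A" "open W" "smooth_map_on A euclidean_atlas W f" "\<And>x. x \<in> W \<Longrightarrow> f x \<noteq> 0"
  shows "smooth_map_on A euclidean_atlas W (\<lambda>x. inverse (f x))"
  using assms(3,4) smooth_atlasD(3)[OF assms(1)] by (auto simp: smooth_map_on_euclidean_iff[OF assms(1,2)] o_def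
      intro!: Cinf_on_inverse open_chart_Int[OF assms(1) _ assms(2)])

section \<open>Products of manifolds\<close>

lemma smooth_map_on_Pair:
  assumes A: "smooth_atlas A" and "smooth_atlas B" "smooth_atlas C"
    and "open W" and f: "smooth_map_on A B W f" and g: "smooth_map_on A C W g"
  shows "smooth_map_on A (prod_atlas B C) W (\<lambda>x. (f x, g x))"
  unfolding smooth_map_on_def
proof (intro conjI, goal_cases)
  case 1
  show ?case
    using smooth_map_on_continuous[OF f] smooth_map_on_continuous[OF g] by (rule continuous_on_Pair)
next
  case 2
  {
    fix U \<phi> V \<psi> X \<theta> assume U: "(U, \<phi>) \<in> A" and V: "(V, \<psi>) \<in> B" and X: "(X, \<theta>) \<in> C"
    let ?W = "U \<inter> W \<inter> (\<lambda>x. (f x, g x)) -` (V \<times> X)"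
    have "?W = U \<inter> ((W \<inter> f -` V) \<inter> (W \<inter> g -` X))" by auto
    moreover have "open (W \<inter> f -` V)" "open (W \<inter> g -` X)"
      using smooth_atlasD(1)[OF \<open>smooth_atlas B\<close> V] smooth_atlasD(1)[OF \<open>smooth_atlas C\<close> X]
      by (auto intro!: open_Int_vimage \<open>open W\<close> smooth_map_on_continuous[OF f] smooth_map_on_continuous[OF g])
    ultimately have "open ?W"
      using smooth_atlasD(1)[OF A U] open_Int by metis
    then have "open (\<phi> ` ?W)" by (rule open_chart_image[OF A U]) auto
    then have "Cinf_on (\<phi> ` ?W) (\<lambda>y. ((\<psi> \<circ> f \<circ> inv_into U \<phi>) y, (\<theta> \<circ> g \<circ> inv_into U \<phi>) y))"
      by (intro Cinf_on_Pair Cinf_on_subset[OF smooth_map_onD[OF f U V]] Cinf_on_subset[OF smooth_map_onD[OF g U X]])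
        auto
    then have "Cinf_on (\<phi> ` ?W) (map_prod \<psi> \<theta> \<circ> (\<lambda>x. (f x, g x)) \<circ> inv_into U \<phi>)"
      by (simp add: o_def)
  }
  then show ?case by (auto simp: prod_atlas_def)
qed

lemma inv_into_map_prod:
  assumes "inj_on \<phi> U" "inj_on \<psi> V" "y \<in> \<phi> ` U" "z \<in> \<psi> ` V"
  shows "inv_into (U \<times> V) (map_prod \<phi> \<psi>) (y, z) = (inv_into U \<phi> y, inv_into V \<psi> z)"
  using assms by (intro inv_into_f_eq map_prod_inj_on) auto

lemma smooth_atlas_prod:
  assumes A: "smooth_atlas A" and B: "smooth_atlas B"
  shows "smooth_atlas (prod_atlas A B)"
  unfolding smooth_atlas_def
proof (intro conjI, goal_cases)
  case 1
  show ?case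
  proof (rule UNIV_eq_I[symmetric], clarify)
    fix a b
    obtain U \<phi> V \<psi> where "(U, \<phi>) \<in> A" "a \<in> U" "(V, \<psi>) \<in> B" "b \<in> V"
      using smooth_atlas_chart[OF A] smooth_atlas_chart[OF B] by metis
    then have "(U \<times> V, map_prod \<phi> \<psi>) \<in> prod_atlas A B" "(a, b) \<in> U \<times> V"
      by (auto simp: prod_atlas_def)
    then show "(a, b) \<in> \<Union> (fst ` prod_atlas A B)" by (force intro: UN_I)
  qed
next
  case 2
  {
    fix U \<phi> V \<psi> assume U: "(U, \<phi>) \<in> A" and V: "(V, \<psi>) \<in> B"
    note cU = smooth_atlasD[OF A U] and cV = smooth_atlasD[OF B V]
    have im: "map_prod \<phi> \<psi> ` (U \<times> V) = \<phi> ` U \<times> \<psi> ` V" by (rule map_prod_surj_on) auto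
    have inj: "inj_on (map_prod \<phi> \<psi>) (U \<times> V)" by (rule map_prod_inj_on[OF cU(3) cV(3)])
    have "continuous_on (U \<times> V) (\<lambda>x. (\<phi> (fst x), \<psi> (snd x)))"
      by (intro continuous_on_Pair continuous_on_compose2[OF cU(4)] continuous_on_compose2[OF cV(4)]
          continuous_on_fst continuous_on_snd continuous_on_id) auto
    then have c: "continuous_on (U \<times> V) (map_prod \<phi> \<psi>)"
      by (simp add: map_prod_def case_prod_beta')
    have "continuous_on (\<phi> ` U \<times> \<psi> ` V) (\<lambda>x. (inv_into U \<phi> (fst x), inv_into V \<psi> (snd x)))"
      by (intro continuous_on_Pair continuous_on_compose2[OF cU(5)] continuous_on_compose2[OF cV(5)]
          continuous_on_fst continuous_on_snd continuous_on_id) auto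
    then have ci: "continuous_on (\<phi> ` U \<times> \<psi> ` V) (inv_into (U \<times> V) (map_prod \<phi> \<psi>))"
      by (rule continuous_on_eq) (auto simp: inv_into_map_prod[OF cU(3) cV(3)])
    have "open (U \<times> V)" "open (map_prod \<phi> \<psi> ` (U \<times> V))"
      unfolding im using cU cV by (auto intro: open_Times)
    moreover have "homeomorphism (U \<times> V) (map_prod \<phi> \<psi> ` (U \<times> V)) (map_prod \<phi> \<psi>) (inv_into (U \<times> V) (map_prod \<phi> \<psi>))"
      using inj c ci unfolding homeomorphism_def im[symmetric] by (auto simp: inv_into_into)
    ultimately have "open (U \<times> V) \<and> open (map_prod \<phi> \<psi> ` (U \<times> V)) \<and> inj_on (map_prod \<phi> \<psi>) (U \<times> V) \<and>
      homeomorphism (U \<times> V) (map_prod \<phi> \<psi> ` (U \<times> V)) (map_prod \<phi> \<psi>) (inv_into (U \<times> V) (map_prod \<phi> \<psi>))"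
      using inj by blast
  }
  then show ?case by (auto simp: prod_atlas_def)
next
  case 3
  {
    fix U \<phi> V \<psi> U' \<phi>' V' \<psi>'
    assume U: "(U, \<phi>) \<in> A" "(U', \<phi>') \<in> A" and V: "(V, \<psi>) \<in> B" "(V', \<psi>') \<in> B"
    note cU = smooth_atlasD[OF A U(1)] and cV = smooth_atlasD[OF B V(1)]
    let ?S = "\<phi> ` (U \<inter> U')" and ?T = "\<psi> ` (V \<inter> V')"
    have oS: "open ?S" and oT: "open ?T"
      using cU(1) smooth_atlasD(1)[OF A U(2)] cV(1) smooth_atlasD(1)[OF B V(2)]
      by (auto intro!: open_chart_image[OF A U(1)] open_chart_image[OF B V(1)])
    have im: "map_prod \<phi> \<psi> ` ((U \<times> V) \<inter> (U' \<times> V')) = ?S \<times> ?T"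
      unfolding Times_Int_Times by (rule map_prod_surj_on) auto
    have fs: "Cinf_on (?S \<times> ?T) (\<lambda>x. (\<phi>' \<circ> inv_into U \<phi>) (fst x))" "Cinf_on (?S \<times> ?T) (\<lambda>x. (\<psi>' \<circ> inv_into V \<psi>) (snd x))"
      by (rule Cinf_on_compose[OF open_Times[OF oS oT] _ _ Cinf_on_linear[OF bounded_linear_fst open_Times[OF oS oT]]
              smooth_atlas_transition[OF A U]] 
            Cinf_on_compose[OF open_Times[OF oS oT] _ _ Cinf_on_linear[OF bounded_linear_snd open_Times[OF oS oT]]
              smooth_atlas_transition[OF B V]]; use oS oT in force)+
    have "Cinf_on (?S \<times> ?T) (map_prod \<phi>' \<psi>' \<circ> inv_into (U \<times> V) (map_prod \<phi> \<psi>))"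
      by (rule Cinf_on_cong[OF open_Times[OF oS oT] Cinf_on_Pair[OF open_Times[OF oS oT] fs]])
        (auto simp: inv_into_map_prod[OF cU(3) cV(3)])
    then have "Cinf_on (map_prod \<phi> \<psi> ` ((U \<times> V) \<inter> (U' \<times> V'))) (map_prod \<phi>' \<psi>' \<circ> inv_into (U \<times> V) (map_prod \<phi> \<psi>))"
      unfolding im .
  }
  then show ?case by (auto simp: prod_atlas_def)
qed

lemma smooth_map_fst:
  assumes A: "smooth_atlas A" and B: "smooth_atlas B"
  shows "smooth_map (prod_atlas A B) A fst"
  unfolding smooth_map_on_def
proof (intro conjI continuous_on_fst continuous_on_id, goal_cases)
  case 1
  {
    fix U \<phi> V \<psi> X \<theta> assume U: "(U, \<phi>) \<in> A" and V: "(V, \<psi>) \<in> B" and X: "(X, \<theta>) \<in> A"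
    let ?W = "map_prod \<phi> \<psi> ` ((U \<times> V) \<inter> UNIV \<inter> fst -` X)"
    have oU: "open (\<phi> ` (U \<inter> X))" by (rule open_chart_Int[OF A U smooth_atlasD(1)[OF A X]])
    have "(U \<times> V) \<inter> UNIV \<inter> fst -` X = (U \<inter> X) \<times> V" by auto
    then have im: "?W = \<phi> ` (U \<inter> X) \<times> \<psi> ` V" by (simp add: map_prod_surj_on)
    have o: "open ?W" unfolding im using oU smooth_atlasD(2)[OF B V] by (rule open_Times)
    have "Cinf_on ?W (\<lambda>x. (\<theta> \<circ> inv_into U \<phi>) (fst x))"
      by (rule Cinf_on_compose[OF o oU _ Cinf_on_linear[OF bounded_linear_fst o] smooth_atlas_transition[OF A U X]])
        (unfold im, auto)
    then have "Cinf_on ?W (\<theta> \<circ> fst \<circ> inv_into (U \<times> V) (map_prod \<phi> \<psi>))"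
      by (rule Cinf_on_cong[OF o])
        (unfold im, auto simp: inv_into_map_prod[OF smooth_atlasD(3)[OF A U] smooth_atlasD(3)[OF B V]])
  }
  then show ?case by (auto simp: prod_atlas_def)
qed

lemma smooth_map_snd:
  assumes A: "smooth_atlas A" and B: "smooth_atlas B"
  shows "smooth_map (prod_atlas A B) B snd"
  unfolding smooth_map_on_def
proof (intro conjI continuous_on_snd continuous_on_id, goal_cases)
  case 1
  {
    fix U \<phi> V \<psi> X \<theta> assume U: "(U, \<phi>) \<in> A" and V: "(V, \<psi>) \<in> B" and X: "(X, \<theta>) \<in> B"
    let ?W = "map_prod \<phi> \<psi> ` ((U \<times> V) \<inter> UNIV \<inter> snd -` X)"
    have oV: "open (\<psi> ` (V \<inter> X))" by (rule open_chart_Int[OF B V smooth_atlasD(1)[OF B X]])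
    have "(U \<times> V) \<inter> UNIV \<inter> snd -` X = U \<times> (V \<inter> X)" by auto
    then have im: "?W = \<phi> ` U \<times> \<psi> ` (V \<inter> X)" by (simp add: map_prod_surj_on)
    have o: "open ?W" unfolding im using smooth_atlasD(2)[OF A U] oV by (rule open_Times)
    have "Cinf_on ?W (\<lambda>x. (\<theta> \<circ> inv_into V \<psi>) (snd x))"
      by (rule Cinf_on_compose[OF o oV _ Cinf_on_linear[OF bounded_linear_snd o] smooth_atlas_transition[OF B V X]])
        (unfold im, auto)
    then have "Cinf_on ?W (\<theta> \<circ> snd \<circ> inv_into (U \<times> V) (map_prod \<phi> \<psi>))"
      by (rule Cinf_on_cong[OF o])
        (unfold im, auto simp: inv_into_map_prod[OF smooth_atlasD(3)[OF A U] smooth_atlasD(3)[OF B V]])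
  }
  then show ?case by (auto simp: prod_atlas_def)
qed

section \<open>Tangent vectors in charts\<close>

lemma smooth_at_smooth_map_on: "smooth_map_on A euclidean_atlas W g \<Longrightarrow> open W \<Longrightarrow> x \<in> W \<Longrightarrow> smooth_at A x g"
  by (auto simp: smooth_at_def)

lemma smooth_at_has_derivative:
  assumes A: "smooth_atlas A" and U: "(U, \<phi>) \<in> A" and y: "y \<in> \<phi> ` U" and g: "smooth_at A (inv_into U \<phi> y) g"
  shows "(g \<circ> inv_into U \<phi> has_derivative frechet_derivative (g \<circ> inv_into U \<phi>) (at y)) (at y)"
proof -
  obtain W where W: "open W" "inv_into U \<phi> y \<in> W" "smooth_map_on A euclidean_atlas W g"
    using g by (auto simp: smooth_at_def)
  have "Cinf_on (\<phi> ` (U \<inter> W)) (g \<circ> inv_into U \<phi>)"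
    using smooth_map_onD[OF W(3) U, of UNIV id] by (simp add: euclidean_atlas_def)
  moreover have "y \<in> \<phi> ` (U \<inter> W)"
    using y W(2) by (intro image_eqI[of _ _ "inv_into U \<phi> y"]) (auto simp: f_inv_into_f inv_into_into)
  ultimately show ?thesis by (rule Cinf_on_has_derivative)
qed

lemma smooth_at_compose:
  assumes A: "smooth_atlas A" and B: "smooth_atlas B" and "open W" "x \<in> W" and f: "smooth_map_on A B W f"
    and g: "smooth_at B (f x) g"
  shows "smooth_at A x (g \<circ> f)"
proof -
  obtain V where V: "open V" "f x \<in> V" "smooth_map_on B euclidean_atlas V g"
    using g by (auto simp: smooth_at_def)
  have o: "open (W \<inter> f -` V)"
    by (rule open_Int_vimage[OF \<open>open W\<close> smooth_map_on_continuous[OF f] V(1)])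
  have "smooth_map_on A euclidean_atlas (W \<inter> f -` V) (\<lambda>x. g (f x))"
    by (rule smooth_map_on_compose[OF A B smooth_atlas_euclidean o V(1) _ smooth_map_on_subset[OF f] V(3)]) auto
  then show ?thesis using o V(2) \<open>x \<in> W\<close> by (auto simp: smooth_at_def o_def)
qed

lemma velocity_cong:
  assumes "\<forall>\<^sub>F t in nhds 0. c t = c' t"
  shows "velocity A c = velocity A c'"
proof
  fix g
  have "c 0 = c' 0" using assms by (rule eventually_nhds_x_imp_x)
  moreover have "deriv (\<lambda>t. g (c t)) 0 = deriv (\<lambda>t. g (c' t)) 0"
    by (intro deriv_cong_ev eventually_mono[OF assms]) auto
  ultimately show "velocity A c g = velocity A c' g" by (simp add: velocity_def)
qed

lemma velocity_const: "velocity A (\<lambda>_. x) = (\<lambda>_. 0)"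
  by (auto simp: velocity_def)

lemma velocity_has_derivative:
  assumes A: "smooth_atlas A" and U: "(U, \<phi>) \<in> A" and c: "isCont c 0" "c 0 \<in> U"
    and d: "((\<lambda>t. \<phi> (c t)) has_vector_derivative b) (at 0)" and g: "smooth_at A (c 0) g"
  shows "((\<lambda>t. g (c t)) has_real_derivative frechet_derivative (g \<circ> inv_into U \<phi>) (at (\<phi> (c 0))) b) (at 0)"
proof -
  let ?D = "frechet_derivative (g \<circ> inv_into U \<phi>) (at (\<phi> (c 0)))"
  have inv: "inv_into U \<phi> (\<phi> x) = x" if "x \<in> U" for x
    using that smooth_atlasD(3)[OF A U] by simp
  have D: "(g \<circ> inv_into U \<phi> has_derivative ?D) (at (\<phi> (c 0)))"
    using c(2) g by (intro smooth_at_has_derivative[OF A U]) (auto simp: inv)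
  from diff_chain_at[OF d[unfolded has_vector_derivative_def] D]
  have "((\<lambda>t. g (inv_into U \<phi> (\<phi> (c t)))) has_derivative (\<lambda>t. ?D (t *\<^sub>R b))) (at 0)"
    by (simp add: o_def)
  moreover have "(\<lambda>t. ?D (t *\<^sub>R b)) = (*) (?D b)"
    using has_derivative_linear[OF D] by (auto simp: linear_scale)
  moreover have ev: "\<forall>\<^sub>F t in nhds 0. c t \<in> U"
    using c smooth_atlasD(1)[OF A U] by (auto simp: isCont_def tendsto_at_iff_tendsto_nhds topological_tendstoD)
  ultimately have "((\<lambda>t. g (inv_into U \<phi> (\<phi> (c t)))) has_real_derivative ?D b) (at 0)"
    by (simp add: has_field_derivative_def)
  then show ?thesis
    using DERIV_cong_ev[OF refl eventually_mono[OF ev] refl, of "\<lambda>t. g (inv_into U \<phi> (\<phi> (c t)))" "\<lambda>t. g (c t)"]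
    by (simp add: inv)
qed

lemma velocity_apply:
  assumes "smooth_atlas A" "(U, \<phi>) \<in> A" "isCont c 0" "c 0 \<in> U"
    "((\<lambda>t. \<phi> (c t)) has_vector_derivative b) (at 0)" "smooth_at A (c 0) g"
  shows "velocity A c g = frechet_derivative (g \<circ> inv_into U \<phi>) (at (\<phi> (c 0))) b"
  using DERIV_imp_deriv[OF velocity_has_derivative[OF assms]] assms(6) by (simp add: velocity_def)

text \<open>The coordinate line may leave the chart image, where \<open>inv_into\<close> is
  arbitrary, but only its germ at 0 enters. The explicit directional derivative shows linearity in
  \<open>b\<close>.\<close>

lemma coord_vec_apply:
  assumes A: "smooth_atlas A" and U: "(U, \<phi>) \<in> A" and y: "y \<in> \<phi> ` U"
  shows "coord_vec A U \<phi> y b =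
    (\<lambda>g. if smooth_at A (inv_into U \<phi> y) g then frechet_derivative (g \<circ> inv_into U \<phi>) (at y) b else 0)"
proof
  fix g
  note c = smooth_atlasD[OF A U]
  let ?c = "\<lambda>t::real. inv_into U \<phi> (y + t *\<^sub>R b)"
  have cont: "isCont ?c 0"
  proof (rule isCont_o2[where f = "\<lambda>t. y + t *\<^sub>R b"])
    show "isCont (inv_into U \<phi>) (y + 0 *\<^sub>R b)"
      using c(5) y by (simp only: continuous_on_eq_continuous_at[OF c(2)] scaleR_zero_left add_0_right)
  qed auto
  have "((\<lambda>t. y + t *\<^sub>R b) has_vector_derivative b) (at 0)"
    by (auto intro!: derivative_eq_intros simp: has_vector_derivative_def)
  then have d: "((\<lambda>t. \<phi> (?c t)) has_vector_derivative b) (at 0)"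
  proof (rule has_vector_derivative_transform_within_open)
    show "open ((\<lambda>t. y + t *\<^sub>R b) -` \<phi> ` U)"
      by (intro open_vimage c(2) continuous_intros)
  qed (use y in \<open>auto simp: f_inv_into_f\<close>)
  have "inv_into U \<phi> y \<in> U" "\<phi> (inv_into U \<phi> y) = y" using y by (auto simp: inv_into_into f_inv_into_f)
  then show "coord_vec A U \<phi> y b g =
    (if smooth_at A (inv_into U \<phi> y) g then frechet_derivative (g \<circ> inv_into U \<phi>) (at y) b else 0)"
    using velocity_apply[OF A U cont _ d, of g] by (auto simp: coord_vec_def velocity_def)
qed

lemma velocity_eq_coord_vec:
  assumes A: "smooth_atlas A" and U: "(U, \<phi>) \<in> A" and "isCont c 0" "c 0 \<in> U"
    and "((\<lambda>t. \<phi> (c t)) has_vector_derivative b) (at 0)"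
  shows "velocity A c = coord_vec A U \<phi> (\<phi> (c 0)) b"
proof
  fix g
  have "inv_into U \<phi> (\<phi> (c 0)) = c 0" "\<phi> (c 0) \<in> \<phi> ` U" using assms(4) smooth_atlasD(3)[OF A U] by auto
  then show "velocity A c g = coord_vec A U \<phi> (\<phi> (c 0)) b g"
    using velocity_apply[OF assms, of g] by (simp add: coord_vec_apply[OF A U] velocity_def)
qed

lemma coord_vec_lincomb:
  assumes A: "smooth_atlas A" and U: "(U, \<phi>) \<in> A" and y: "y \<in> \<phi> ` U"
  shows "coord_vec A U \<phi> y (r *\<^sub>R a + s *\<^sub>R b) = (\<lambda>g. r * coord_vec A U \<phi> y a g + s * coord_vec A U \<phi> y b g)"
proof
  fix g
  show "coord_vec A U \<phi> y (r *\<^sub>R a + s *\<^sub>R b) g = r * coord_vec A U \<phi> y a g + s * coord_vec A U \<phi> y b g"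
    using has_derivative_linear[OF smooth_at_has_derivative[OF A U y]]
    by (auto simp: coord_vec_apply[OF A U y] linear_add linear_scale)
qed

lemma coord_vec_zero:
  assumes "smooth_atlas A" "(U, \<phi>) \<in> A" "y \<in> \<phi> ` U"
  shows "coord_vec A U \<phi> y 0 = (\<lambda>_. 0)"
  using coord_vec_lincomb[OF assms, of 0 0 0 0] by simp

text \<open>Each coordinate function of the chart is smooth near the point, and applying the vector
  to it returns a coordinate of \<open>b\<close>.\<close>

lemma coord_vec_eq_zero:
  assumes A: "smooth_atlas A" and U: "(U, \<phi>) \<in> A" and y: "y \<in> \<phi> ` U" and z: "coord_vec A U \<phi> y b = (\<lambda>_. 0)"
  shows "b = 0"
proof (rule euclidean_eqI)
  fix i :: 'b assume "i \<in> Basis"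
  let ?g = "\<lambda>x. \<phi> x \<bullet> i"
  have U': "open U" by (rule smooth_atlasD(1)[OF A U])
  have "smooth_map_on A euclidean_atlas U ?g"
    by (rule smooth_map_on_compose[OF A smooth_atlas_euclidean smooth_atlas_euclidean U' open_UNIV _ smooth_map_on_chart[OF A U]])
      (auto simp: smooth_map_on_Cinf_on intro: Cinf_on_linear bounded_linear_inner_left)
  then have "smooth_at A (inv_into U \<phi> y) ?g"
    using U' y by (auto intro: smooth_at_smooth_map_on inv_into_into)
  then have "0 = frechet_derivative (?g \<circ> inv_into U \<phi>) (at y) b"
    using z by (simp add: coord_vec_apply[OF A U y] fun_eq_iff) metis
  also have "((\<lambda>z. z \<bullet> i) has_derivative (\<lambda>z. z \<bullet> i)) (at y)"
    by (auto intro: derivative_intros)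
  then have "(?g \<circ> inv_into U \<phi> has_derivative (\<lambda>z. z \<bullet> i)) (at y)"
    by (rule has_derivative_transform_within_open[OF _ smooth_atlasD(2)[OF A U] y]) (simp add: f_inv_into_f)
  then have "frechet_derivative (?g \<circ> inv_into U \<phi>) (at y) b = b \<bullet> i"
    by (metis frechet_derivative_at)
  finally show "b \<bullet> i = 0 \<bullet> i" by simp
qed

lemma velocity_along:
  fixes G :: "'d::euclidean_space \<Rightarrow> 'a::topological_space"
  assumes A: "smooth_atlas A" and U: "(U, \<phi>) \<in> A" and "open W" and G: "smooth_map_on euclidean_atlas A W G"
    and u: "u \<in> W" "G u \<in> U"
  shows "velocity A (\<lambda>t. G (u + t *\<^sub>R a)) = coord_vec A U \<phi> (\<phi> (G u)) (frechet_derivative (\<phi> \<circ> G) (at u) a)"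
proof -
  have "Cinf_on (W \<inter> G -` U) (\<phi> \<circ> G)"
    using smooth_map_onD[OF G _ U, of UNIV id] by (simp add: euclidean_atlas_def)
  then have D: "(\<phi> \<circ> G has_derivative frechet_derivative (\<phi> \<circ> G) (at u)) (at u)"
    by (rule Cinf_on_has_derivative) (use u in auto)
  have "((\<lambda>t. u + t *\<^sub>R a) has_derivative (\<lambda>t. t *\<^sub>R a)) (at 0)"
    by (auto intro!: derivative_eq_intros)
  moreover have "(\<phi> \<circ> G has_derivative frechet_derivative (\<phi> \<circ> G) (at u)) (at (u + 0 *\<^sub>R a))" using D by simp
  ultimately have "((\<lambda>t. (\<phi> \<circ> G) (u + t *\<^sub>R a)) has_derivative (\<lambda>t. frechet_derivative (\<phi> \<circ> G) (at u) (t *\<^sub>R a))) (at 0)"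
    by (rule has_derivative_compose)
  with linear_scale[OF has_derivative_linear[OF D]]
  have d: "((\<lambda>t. \<phi> (G (u + t *\<^sub>R a))) has_vector_derivative frechet_derivative (\<phi> \<circ> G) (at u) a) (at 0)"
    by (simp add: has_vector_derivative_def o_def)
  have "isCont (\<lambda>t::real. G (u + t *\<^sub>R a)) 0"
  proof (rule isCont_o2[where f = "\<lambda>t. u + t *\<^sub>R a"])
    show "isCont G (u + 0 *\<^sub>R a)"
      using smooth_map_on_continuous[OF G] \<open>open W\<close> u by (simp add: continuous_on_eq_continuous_at)
  qed auto
  from velocity_eq_coord_vec[OF A U this _ d] u show ?thesis by simp
qed

lemma coord_vec_in_tangent:
  assumes A: "smooth_atlas A" and U: "(U, \<phi>) \<in> A" and y: "y \<in> \<phi> ` U"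
  shows "coord_vec A U \<phi> y b \<in> tangent A (inv_into U \<phi> y)"
proof -
  obtain r where r: "r > 0" "ball y r \<subseteq> \<phi> ` U" using smooth_atlasD(2)[OF A U] y openE by blast
  \<comment> \<open>Chosen so that \<open>e * norm b < r\<close>, which keeps the curve below inside
    the ball; adding 1 covers \<open>b = 0\<close>.\<close>
  define e where "e = r / (norm b + 1)"
  have e: "e > 0" using r by (simp add: e_def add_nonneg_pos)
  have "e * norm b < e * (norm b + 1)" using e by simp
  also have "\<dots> = r" by (simp add: e_def add_nonneg_eq_0_iff)
  finally have eb: "e * norm b < r" .
  \<comment> \<open>A tangent vector needs a curve defined on the whole line; \<open>e sin (t / e)\<close> has unit speed at \<open>0\<close>
    and keeps the straight line in the chart.\<close>
  define s where "s t = e * sin (inverse e * t)" for t :: real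
  have s: "Cinf_on UNIV s"
    unfolding s_def by (intro Cinf_on_mult Cinf_on_const Cinf_on_compose[OF _ _ _ _ Cinf_on_sin]
        Cinf_on_linear bounded_linear_ident) auto
  have line: "y + s t *\<^sub>R b \<in> \<phi> ` U" for t
  proof (rule subsetD[OF r(2)])
    have "\<bar>s t\<bar> \<le> e" using e by (simp add: s_def abs_mult mult_le_cancel_left1)
    then have "\<bar>s t\<bar> * norm b \<le> e * norm b" by (rule mult_right_mono) simp
    then show "y + s t *\<^sub>R b \<in> ball y r" using eb by (simp add: dist_norm)
  qed
  let ?c = "\<lambda>t. inv_into U \<phi> (y + s t *\<^sub>R b)"
  have cc: "Cinf_on UNIV (\<lambda>t. y + s t *\<^sub>R b)"
    by (intro Cinf_on_add Cinf_on_const Cinf_on_scaleR s) auto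
  have c: "smooth_map_on euclidean_atlas A UNIV ?c"
    by (rule smooth_map_on_compose[OF smooth_atlas_euclidean smooth_atlas_euclidean A open_UNIV
          smooth_atlasD(2)[OF A U] _ _ smooth_map_on_chart_inverse[OF A U]])
      (use line cc in \<open>auto simp: smooth_map_on_Cinf_on\<close>)
  have c0: "?c 0 = inv_into U \<phi> y" by (simp add: s_def)
  have "(s has_real_derivative 1) (at 0)"
    unfolding s_def using e by (auto intro!: derivative_eq_intros)
  then have "((\<lambda>t. y + s t *\<^sub>R b) has_vector_derivative b) (at 0)"
    by (auto intro!: derivative_eq_intros)
  then have d: "((\<lambda>t. \<phi> (?c t)) has_vector_derivative b) (at 0)"
    using line by (simp add: f_inv_into_f)
  have "isCont ?c 0"
    using smooth_map_on_continuous[OF c] by (simp add: continuous_on_eq_continuous_at)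
  from velocity_eq_coord_vec[OF A U this _ d] have "velocity A ?c = coord_vec A U \<phi> y b"
    using y by (simp add: c0 inv_into_into f_inv_into_f)
  then show ?thesis using c c0 unfolding tangent_def by (metis (mono_tags, lifting) mem_Collect_eq)
qed

lemma tangent_eq_range_coord_vec:
  assumes A: "smooth_atlas A" and U: "(U, \<phi>) \<in> A" and x: "x \<in> U"
  shows "tangent A x = range (coord_vec A U \<phi> (\<phi> x))"
proof (intro equalityI subsetI)
  fix v assume "v \<in> tangent A x"
  then obtain c where c: "smooth_map euclidean_atlas A c" "c 0 = x" "v = velocity A c"
    by (auto simp: tangent_def)
  then have "v = coord_vec A U \<phi> (\<phi> x) (frechet_derivative (\<phi> \<circ> c) (at 0) 1)"
    using velocity_along[OF A U open_UNIV c(1), of 0 1] x by simp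
  then show "v \<in> range (coord_vec A U \<phi> (\<phi> x))" by blast
next
  fix v assume "v \<in> range (coord_vec A U \<phi> (\<phi> x))"
  then show "v \<in> tangent A x"
    using coord_vec_in_tangent[OF A U, of "\<phi> x"] x smooth_atlasD(3)[OF A U] by auto
qed

lemma tangent_lincomb:
  assumes A: "smooth_atlas A" and "v \<in> tangent A x" "w \<in> tangent A x"
  shows "(\<lambda>g. r * v g + s * w g) \<in> tangent A x"
proof -
  obtain U \<phi> where U: "(U, \<phi>) \<in> A" "x \<in> U" using smooth_atlas_chart[OF A] .
  show ?thesis
    using assms(2,3) unfolding tangent_eq_range_coord_vec[OF A U]
    by (auto simp flip: coord_vec_lincomb[OF A U(1) imageI[OF U(2)]])
qed

lemma tangent_diff:
  assumes A: "smooth_atlas A" and "v \<in> tangent A x" "w \<in> tangent A x"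
  shows "(\<lambda>g. v g - w g) \<in> tangent A x"
  using tangent_lincomb[OF assms, of 1 "-1"] by simp

lemma velocity_along_in_tangent:
  fixes G :: "'d::euclidean_space \<Rightarrow> 'a::topological_space"
  assumes A: "smooth_atlas A" and "open W" "smooth_map_on euclidean_atlas A W G" "u \<in> W"
  shows "velocity A (\<lambda>t. G (u + t *\<^sub>R a)) \<in> tangent A (G u)"
proof -
  obtain U \<phi> where U: "(U, \<phi>) \<in> A" "G u \<in> U" using smooth_atlas_chart[OF A] .
  show ?thesis
    unfolding tangent_eq_range_coord_vec[OF A U] velocity_along[OF A U(1) assms(2-4) U(2)] by blast
qed

section \<open>Tangent maps and the pointwise algebra of forms\<close>

lemma tmap_velocity_on:
  assumes "smooth_atlas A" "smooth_atlas B" "open W" "c 0 \<in> W" "smooth_map_on A B W f"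
  shows "tmap B f (c 0) (velocity A c) = velocity B (\<lambda>t. f (c t))"
  using smooth_at_compose[OF assms] by (auto simp: tmap_def velocity_def)

lemmas tmap_velocity = tmap_velocity_on[OF _ _ open_UNIV UNIV_I]

lemma tmap_coord_vec:
  assumes A: "smooth_atlas A" and B: "smooth_atlas B" and f: "smooth_map A B f"
    and U: "(U, \<phi>) \<in> A" "x \<in> U" and V: "(V, \<psi>) \<in> B" "f x \<in> V"
  shows "tmap B f x (coord_vec A U \<phi> (\<phi> x) a) =
    coord_vec B V \<psi> (\<psi> (f x)) (frechet_derivative (\<psi> \<circ> f \<circ> inv_into U \<phi>) (at (\<phi> x)) a)"
proof -
  let ?G = "\<lambda>y. f (inv_into U \<phi> y)"
  have inv: "inv_into U \<phi> (\<phi> x) = x" using U(2) smooth_atlasD(3)[OF A U(1)] by simp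
  have "smooth_map_on euclidean_atlas B (\<phi> ` U) ?G"
    by (rule smooth_map_on_compose[OF smooth_atlas_euclidean A B smooth_atlasD(2)[OF A U(1)] open_UNIV _
          smooth_map_on_chart_inverse[OF A U(1)] f]) simp
  from velocity_along[OF B V(1) smooth_atlasD(2)[OF A U(1)] this, of "\<phi> x" a] U V inv
  show ?thesis
    using tmap_velocity[OF A B f, of "\<lambda>t. inv_into U \<phi> (\<phi> x + t *\<^sub>R a)"]
    by (simp add: coord_vec_def o_def)
qed

lemma tmap_in_tangent:
  assumes A: "smooth_atlas A" and B: "smooth_atlas B" and f: "smooth_map A B f" and "v \<in> tangent A x"
  shows "tmap B f x v \<in> tangent B (f x)"
proof -
  obtain U \<phi> where U: "(U, \<phi>) \<in> A" "x \<in> U" using smooth_atlas_chart[OF A] .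
  obtain V \<psi> where V: "(V, \<psi>) \<in> B" "f x \<in> V" using smooth_atlas_chart[OF B] .
  show ?thesis
    using assms(4) unfolding tangent_eq_range_coord_vec[OF A U] tangent_eq_range_coord_vec[OF B V]
    by (auto simp: tmap_coord_vec[OF A B f U V])
qed

lemma tmap_lincomb: "tmap B f x (\<lambda>g. r * v g + s * w g) = (\<lambda>g. r * tmap B f x v g + s * tmap B f x w g)"
  by (auto simp: tmap_def)

lemma tmap_diff: "tmap B f x (\<lambda>g. v g - w g) = (\<lambda>g. tmap B f x v g - tmap B f x w g)"
  by (auto simp: tmap_def)

lemma tmap_tmap:
  assumes "smooth_atlas B" "smooth_atlas C" "smooth_map B C g"
  shows "tmap C g (f x) (tmap B f x v) = tmap C (g \<circ> f) x v"
  using smooth_at_compose[OF assms(1,2) open_UNIV UNIV_I assms(3), of "f x"] by (auto simp: tmap_def o_def)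

lemma smooth_form1_lincomb:
  assumes "smooth_form1 A \<beta>" "v \<in> tangent A x" "w \<in> tangent A x"
  shows "\<beta> x (\<lambda>g. r * v g + s * w g) = r * \<beta> x v + s * \<beta> x w"
  using assms by (auto simp: smooth_form1_def)

lemma smooth_form1_diff:
  assumes "smooth_form1 A \<beta>" "v \<in> tangent A x" "w \<in> tangent A x"
  shows "\<beta> x (\<lambda>g. v g - w g) = \<beta> x v - \<beta> x w"
  using smooth_form1_lincomb[OF assms, of 1 "-1"] by simp

lemma smooth_form2_lincomb_right:
  assumes "smooth_form2 A \<eta>" "v \<in> tangent A x" "w \<in> tangent A x" "w' \<in> tangent A x"
  shows "\<eta> x v (\<lambda>g. r * w g + s * w' g) = r * \<eta> x v w + s * \<eta> x v w'"
  using assms unfolding smooth_form2_def by blast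

lemma smooth_form2_antisym:
  assumes "smooth_form2 A \<eta>" "v \<in> tangent A x" "w \<in> tangent A x"
  shows "\<eta> x v w = - \<eta> x w v"
  using assms unfolding smooth_form2_def by blast

text \<open>\<open>smooth_form2\<close> grants linearity in the second slot; antisymmetry carries it
  to the first.\<close>

lemma smooth_form2_lincomb_left:
  assumes A: "smooth_atlas A" and "smooth_form2 A \<eta>" "v \<in> tangent A x" "v' \<in> tangent A x" "w \<in> tangent A x"
  shows "\<eta> x (\<lambda>g. r * v g + s * v' g) w = r * \<eta> x v w + s * \<eta> x v' w"
  using smooth_form2_lincomb_right[OF assms(2,5,3,4), of r s]
    smooth_form2_antisym[OF assms(2) tangent_lincomb[OF assms(1,3,4)] assms(5), of r s]
    smooth_form2_antisym[OF assms(2,3,5)] smooth_form2_antisym[OF assms(2,4,5)] by simp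

section \<open>Differential forms along smooth families\<close>

lemma form1_coord:
  assumes A: "smooth_atlas A" and \<beta>: "smooth_form1 A \<beta>" and U: "(U, \<phi>) \<in> A" and y: "y \<in> \<phi> ` U"
  shows "\<beta> (inv_into U \<phi> y) (coord_vec A U \<phi> y b) =
    (\<Sum>i\<in>Basis. (b \<bullet> i) * \<beta> (inv_into U \<phi> y) (coord_vec A U \<phi> y i))"
proof -
  have "linear (\<lambda>b. \<beta> (inv_into U \<phi> y) (coord_vec A U \<phi> y b))"
    using coord_vec_lincomb[OF A U y, of 1 _ 1] coord_vec_lincomb[OF A U y, of _ _ 0 0]
      smooth_form1_lincomb[OF \<beta> coord_vec_in_tangent[OF A U y] coord_vec_in_tangent[OF A U y], of 1 _ 1]
      smooth_form1_lincomb[OF \<beta> coord_vec_in_tangent[OF A U y] coord_vec_in_tangent[OF A U y], of _ _ 0 0]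
    by (intro linearI) auto
  from linear_Basis_expansion[OF this, of b] show ?thesis by simp
qed

lemma Cinf_on_form1_coord:
  "smooth_form1 A \<beta> \<Longrightarrow> (U, \<phi>) \<in> A \<Longrightarrow> Cinf_on (\<phi> ` U) (\<lambda>y. \<beta> (inv_into U \<phi> y) (coord_vec A U \<phi> y b))"
  by (auto simp: smooth_form1_def)

lemma form1_along_chart:
  fixes G :: "'d::euclidean_space \<Rightarrow> 'a::topological_space"
  assumes A: "smooth_atlas A" and \<beta>: "smooth_form1 A \<beta>" and U: "(U, \<phi>) \<in> A" and "open W"
    and G: "smooth_map_on euclidean_atlas A W G" and u: "u \<in> W" "G u \<in> U"
  shows "\<beta> (G u) (velocity A (\<lambda>t. G (u + t *\<^sub>R a))) =
    (\<Sum>i\<in>Basis. (frechet_derivative (\<phi> \<circ> G) (at u) a \<bullet> i) *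
       \<beta> (inv_into U \<phi> (\<phi> (G u))) (coord_vec A U \<phi> (\<phi> (G u)) i))"
proof -
  have "inv_into U \<phi> (\<phi> (G u)) = G u" using u smooth_atlasD(3)[OF A U] by simp
  then show ?thesis
    using velocity_along[OF A U \<open>open W\<close> G u, of a]
      form1_coord[OF A \<beta> U imageI[OF u(2)], of "frechet_derivative (\<phi> \<circ> G) (at u) a"] by simp
qed

lemma Cinf_on_chart_compose:
  fixes G :: "'d::euclidean_space \<Rightarrow> 'a::topological_space"
  assumes "smooth_map_on euclidean_atlas A W G" "(U, \<phi>) \<in> A"
  shows "Cinf_on (W \<inter> G -` U) (\<phi> \<circ> G)"
  using smooth_map_onD[OF assms(1) _ assms(2), of UNIV id] by (simp add: euclidean_atlas_def)

lemma Cinf_on_form1_along: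
  fixes G :: "'d::euclidean_space \<Rightarrow> 'a::topological_space"
  assumes A: "smooth_atlas A" and \<beta>: "smooth_form1 A \<beta>" and "open W"
    and G: "smooth_map_on euclidean_atlas A W G"
  shows "Cinf_on W (\<lambda>u. \<beta> (G u) (velocity A (\<lambda>t. G (u + t *\<^sub>R a))))"
proof (rule Cinf_on_local)
  fix u assume "u \<in> W"
  obtain U \<phi> where U: "(U, \<phi>) \<in> A" "G u \<in> U" using smooth_atlas_chart[OF A] .
  let ?W = "W \<inter> G -` U"
  have W: "open ?W"
    by (rule open_Int_vimage[OF \<open>open W\<close> smooth_map_on_continuous[OF G] smooth_atlasD(1)[OF A U(1)]])
  note G' = Cinf_on_chart_compose[OF G U(1)]
  have "Cinf_on ?W (\<lambda>u. \<Sum>i\<in>Basis. (frechet_derivative (\<phi> \<circ> G) (at u) a \<bullet> i) *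
       \<beta> (inv_into U \<phi> ((\<phi> \<circ> G) u)) (coord_vec A U \<phi> ((\<phi> \<circ> G) u) i))"
    by (intro Cinf_on_sum Cinf_on_mult Cinf_on_inner_left Cinf_on_frechet_derivative[OF G'] W finite_Basis
        Cinf_on_compose[OF W smooth_atlasD(2)[OF A U(1)] _ G' Cinf_on_form1_coord[OF \<beta> U(1)]]) auto
  then have "Cinf_on ?W (\<lambda>u. \<beta> (G u) (velocity A (\<lambda>t. G (u + t *\<^sub>R a))))"
    by (rule Cinf_on_cong[OF W]) (simp add: form1_along_chart[OF A \<beta> U(1) \<open>open W\<close> G])
  then show "\<exists>V. open V \<and> u \<in> V \<and> Cinf_on V (\<lambda>u. \<beta> (G u) (velocity A (\<lambda>t. G (u + t *\<^sub>R a))))"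
    using W U(2) \<open>u \<in> W\<close> by blast
qed

text \<open>Pullback commutes with the exterior derivative. \<open>has_ext_deriv\<close> speaks of
  constant coordinate fields only; along \<open>G\<close> the directions vary, and the additional
  terms are second derivatives of \<open>G\<close> that cancel by symmetry.\<close>

lemma ext_deriv_along:
  fixes G :: "'d::euclidean_space \<Rightarrow> 'a::topological_space"
  assumes A: "smooth_atlas A" and \<beta>: "smooth_form1 A \<beta>" and d: "has_ext_deriv A \<beta> \<eta>" and "open W"
    and G: "smooth_map_on euclidean_atlas A W G" and u: "u \<in> W"
  defines "vel \<equiv> \<lambda>u a. velocity A (\<lambda>t. G (u + t *\<^sub>R a))"
  shows "\<eta> (G u) (vel u a) (vel u b) =
    frechet_derivative (\<lambda>u. \<beta> (G u) (vel u b)) (at u) a - frechet_derivative (\<lambda>u. \<beta> (G u) (vel u a)) (at u) b"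
proof -
  obtain U \<phi> where U: "(U, \<phi>) \<in> A" "G u \<in> U" using smooth_atlas_chart[OF A] .
  let ?W = "W \<inter> G -` U"
  have W: "open ?W"
    by (rule open_Int_vimage[OF \<open>open W\<close> smooth_map_on_continuous[OF G] smooth_atlasD(1)[OF A U(1)]])
  have uW: "u \<in> ?W" using u U(2) by simp
  note G' = Cinf_on_chart_compose[OF G U(1)]
  define D where "D u a = frechet_derivative (\<phi> \<circ> G) (at u) a" for u a
  define D2 where "D2 a b = frechet_derivative (\<lambda>u. D u a) (at u) b" for a b
  define B where "B i y = \<beta> (inv_into U \<phi> y) (coord_vec A U \<phi> y i)" for i y
  let ?y = "\<phi> (G u)"
  have y: "?y \<in> \<phi> ` U" using U(2) by simp
  have B': "(B i has_derivative frechet_derivative (B i) (at ?y)) (at ?y)" for i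
    unfolding B_def[abs_def] by (rule Cinf_on_has_derivative[OF Cinf_on_form1_coord[OF \<beta> U(1)] y])
  \<comment> \<open>Linearity of the coefficients in the direction recombines the sum over basis
    vectors into one derivative of \<open>B\<close>, taken with the direction \<open>D u b\<close>
    frozen at \<open>u\<close>.\<close>
  have B_lin: "frechet_derivative (B b) (at ?y) c = (\<Sum>i\<in>Basis. (b \<bullet> i) * frechet_derivative (B i) (at ?y) c)" for b c
  proof -
    have "((\<lambda>y. \<Sum>i\<in>Basis. (b \<bullet> i) * B i y) has_derivative (\<lambda>c. \<Sum>i\<in>Basis. (b \<bullet> i) * frechet_derivative (B i) (at ?y) c)) (at ?y)"
      by (intro has_derivative_sum has_derivative_mult_right B')
    then have "(B b has_derivative (\<lambda>c. \<Sum>i\<in>Basis. (b \<bullet> i) * frechet_derivative (B i) (at ?y) c)) (at ?y)"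
      by (rule has_derivative_transform_within_open[OF _ smooth_atlasD(2)[OF A U(1)] y])
        (simp add: B_def form1_coord[OF A \<beta> U(1), of _ b])
    from frechet_derivative_at[OF this] show ?thesis by metis
  qed
  have deriv: "frechet_derivative (\<lambda>u. \<beta> (G u) (vel u b)) (at u) a =
      frechet_derivative (B (D u b)) (at ?y) (D u a) + (\<Sum>i\<in>Basis. (D2 b a \<bullet> i) * B i ?y)" for a b
  proof -
    have "((\<lambda>u. (\<phi> \<circ> G) u) has_derivative D u) (at u)"
      unfolding D_def[abs_def] o_def[symmetric, of \<phi> G] using Cinf_on_has_derivative[OF G' uW] by (simp add: o_def)
    then have BG: "((\<lambda>u. B i ((\<phi> \<circ> G) u)) has_derivative (\<lambda>c. frechet_derivative (B i) (at ?y) (D u c))) (at u)" for i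
      by (rule has_derivative_compose) (use B' in simp)
    have "((\<lambda>u. D u b) has_derivative D2 b) (at u)"
      unfolding D2_def[abs_def] unfolding D_def
      by (rule Cinf_on_has_derivative[OF Cinf_on_frechet_derivative[OF G'] uW])
    then have "((\<lambda>u. \<Sum>i\<in>Basis. (D u b \<bullet> i) * B i ((\<phi> \<circ> G) u)) has_derivative
       (\<lambda>c. \<Sum>i\<in>Basis. (D u b \<bullet> i) * frechet_derivative (B i) (at ?y) (D u c) + (D2 b c \<bullet> i) * B i ((\<phi> \<circ> G) u))) (at u)"
      by (intro has_derivative_sum has_derivative_mult BG has_derivative_inner_left)
    then have "((\<lambda>u. \<beta> (G u) (vel u b)) has_derivative
       (\<lambda>c. \<Sum>i\<in>Basis. (D u b \<bullet> i) * frechet_derivative (B i) (at ?y) (D u c) + (D2 b c \<bullet> i) * B i ((\<phi> \<circ> G) u))) (at u)"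
      by (rule has_derivative_transform_within_open[OF _ W uW])
        (simp add: form1_along_chart[OF A \<beta> U(1) \<open>open W\<close> G] vel_def D_def B_def)
    from frechet_derivative_at[OF this, symmetric] show ?thesis
      by (simp add: B_lin[of "D u b"] sum.distrib)
  qed
  have "D2 a b = D2 b a"
    unfolding D2_def D_def by (rule frechet_derivative_symmetric[OF W G' uW])
  moreover have "\<eta> (G u) (vel u a) (vel u b) =
      frechet_derivative (B (D u b)) (at ?y) (D u a) - frechet_derivative (B (D u a)) (at ?y) (D u b)"
  proof -
    have "inv_into U \<phi> ?y = G u" using U(2) smooth_atlasD(3)[OF A U(1)] by simp
    moreover have "vel u c = coord_vec A U \<phi> ?y (D u c)" for c
      unfolding vel_def D_def by (rule velocity_along[OF A U(1) \<open>open W\<close> G u U(2)])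
    ultimately show ?thesis
      using d U(1) y unfolding has_ext_deriv_def B_def[abs_def] by fastforce
  qed
  ultimately show ?thesis by (simp add: deriv)
qed

section \<open>Extending functions from compact submanifolds\<close>

text \<open>A linear left inverse \<open>P\<close> of the differential makes \<open>P\<close> after
  the chart form of \<open>f\<close> locally invertible, and this inverse builds the retraction.
  That \<open>f\<close> is a homeomorphism onto its image, beyond being an immersion, keeps remote
  parts of \<open>M\<close> out of \<open>N\<close>.\<close>

lemma embedding_local_retraction:
  fixes f :: "'m::topological_space \<Rightarrow> 's::topological_space"
    and MA :: "('m, 'e::euclidean_space) atlas" and SA :: "('s, 'f::euclidean_space) atlas"
  assumes MA: "smooth_atlas MA" and SA: "smooth_atlas SA" and emb: "embedding MA SA f"
  obtains N r where "open N" "f x0 \<in> N" "smooth_map_on SA MA N r" "\<And>x. f x \<in> N \<Longrightarrow> r (f x) = x"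
proof -
  have f: "smooth_map MA SA f" using emb by (simp add: embedding_def)
  obtain U \<phi> where U: "(U, \<phi>) \<in> MA" "x0 \<in> U" using smooth_atlas_chart[OF MA] .
  obtain V \<psi> where V: "(V, \<psi>) \<in> SA" "f x0 \<in> V" using smooth_atlas_chart[OF SA] .
  note cU = smooth_atlasD[OF MA U(1)] and cV = smooth_atlasD[OF SA V(1)]
  define X where "X = \<phi> ` (U \<inter> f -` V)"
  let ?F = "\<psi> \<circ> f \<circ> inv_into U \<phi>"
  have F: "Cinf_on X ?F" using smooth_map_onD[OF f U(1) V(1)] by (simp add: X_def)
  have "open (UNIV \<inter> f -` V)" by (rule open_Int_vimage[OF open_UNIV smooth_map_on_continuous[OF f] cV(1)])
  then have "open X" unfolding X_def by (simp add: open_chart_Int[OF MA U(1)])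
  have x0: "\<phi> x0 \<in> X" using U(2) V(2) by (auto simp: X_def)
  let ?I = "frechet_derivative ?F (at (\<phi> x0))"
  have I: "(?F has_derivative ?I) (at (\<phi> x0))" by (rule Cinf_on_has_derivative[OF F x0])
  have "inj ?I"
  proof (subst linear_injective_0[OF has_derivative_linear[OF I]], intro allI impI)
    fix a assume "?I a = 0"
    then have "tmap SA f x0 (coord_vec MA U \<phi> (\<phi> x0) a) = (\<lambda>_. 0)"
      using tmap_coord_vec[OF MA SA f U V, of a] coord_vec_zero[OF SA V(1) imageI[OF V(2)]] by simp
    moreover have "coord_vec MA U \<phi> (\<phi> x0) a \<in> tangent MA x0"
      by (simp add: tangent_eq_range_coord_vec[OF MA U])
    ultimately have "coord_vec MA U \<phi> (\<phi> x0) a = (\<lambda>_. 0)" using emb by (simp add: embedding_def)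
    then show "a = 0" by (rule coord_vec_eq_zero[OF MA U(1) imageI[OF U(2)]])
  qed
  then obtain P where P: "linear P" "P \<circ> ?I = id"
    using linear_injective_left_inverse[OF has_derivative_linear[OF I]] by blast
  have bP: "bounded_linear P" using P(1) by (simp add: linear_linear)
  let ?G = "\<lambda>y. P (?F y)"
  have G: "Cinf_on X ?G" by (rule Cinf_on_bounded_linear[OF bP \<open>open X\<close> F])
  have "(?G has_derivative (\<lambda>v. P (?I v))) (at (\<phi> x0))"
    by (rule bounded_linear.has_derivative[OF bP I])
  from frechet_derivative_at[OF this, symmetric] have "frechet_derivative ?G (at (\<phi> x0)) = id"
    using P(2) by (simp only: o_def)
  from Cinf_on_local_inverse[OF \<open>open X\<close> G x0 this]
  obtain U' V' H where loc: "open U'" "U' \<subseteq> X" "\<phi> x0 \<in> U'" "open V'" "homeomorphism U' V' ?G H" "Cinf_on V' H" .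
  have HU: "H y \<in> \<phi> ` U" if "y \<in> V'" for y
    using loc(2,5) that by (auto simp: homeomorphism_def X_def)
  define U0 where "U0 = U \<inter> \<phi> -` U'"
  have "open U0" unfolding U0_def by (rule open_Int_vimage[OF cU(1,4) loc(1)])
  obtain g where g: "homeomorphism UNIV (range f) f g" using emb by (auto simp: embedding_def)
  then have "inj f" by (metis homeomorphism_def injI UNIV_I)
  have "openin (top_of_set (range f)) (f ` U0)"
    using homeomorphism_imp_open_map[OF g, of U0] \<open>open U0\<close> by simp
  \<comment> \<open>Intersecting with \<open>O'\<close> leaves in \<open>N\<close> only those image
    points that come from \<open>U0\<close>, where \<open>H\<close> inverts
    \<open>?G\<close>.\<close>
  then obtain O' where O': "open O'" "f ` U0 = range f \<inter> O'" by (auto simp: openin_open)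
  define N where "N = O' \<inter> (V \<inter> \<psi> -` (P -` V'))"
  have oN: "open (V \<inter> \<psi> -` (P -` V'))"
    using open_vimage[OF loc(4) linear_continuous_on[OF bP]] by (rule open_Int_vimage[OF cV(1,4)])
  then have "open N" by (simp add: N_def O'(1) open_Int)
  show ?thesis
  proof (rule that[of N "\<lambda>s. inv_into U \<phi> (H (P (\<psi> s)))"])
    show "open N" by fact
    have "f x0 \<in> O'" using O'(2) U(2) loc(3) by (auto simp: U0_def)
    moreover have "P (\<psi> (f x0)) \<in> V'"
      using homeomorphism_image1[OF loc(5)] loc(3) U(2) cU(3) by force
    ultimately show "f x0 \<in> N" using V(2) by (simp add: N_def)
    have "smooth_map_on SA euclidean_atlas N (\<lambda>s. P (\<psi> s))"
      by (rule smooth_map_on_compose[OF SA smooth_atlas_euclidean smooth_atlas_euclidean \<open>open N\<close> open_UNIV _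
            smooth_map_on_subset[OF smooth_map_on_chart[OF SA V(1)]]])
        (auto simp: smooth_map_on_Cinf_on N_def intro: Cinf_on_linear bP)
    then have "smooth_map_on SA euclidean_atlas N (\<lambda>s. H (P (\<psi> s)))"
      by (rule smooth_map_on_compose[OF SA smooth_atlas_euclidean smooth_atlas_euclidean \<open>open N\<close> loc(4), rotated])
        (use loc(4,6) in \<open>auto simp: smooth_map_on_Cinf_on N_def\<close>)
    then show "smooth_map_on SA MA N (\<lambda>s. inv_into U \<phi> (H (P (\<psi> s))))"
      by (rule smooth_map_on_compose[OF SA smooth_atlas_euclidean MA \<open>open N\<close> cU(2) _ _ smooth_map_on_chart_inverse[OF MA U(1)], rotated])
        (use HU in \<open>auto simp: N_def\<close>)
    fix x assume "f x \<in> N"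
    then have "f x \<in> f ` U0" using O'(2) by (auto simp: N_def)
    then have x: "x \<in> U" "\<phi> x \<in> U'" using \<open>inj f\<close> by (auto simp: U0_def inj_image_mem_iff dest: injD)
    then have "H (?G (\<phi> x)) = \<phi> x" using loc(5) by (simp add: homeomorphism_def)
    then show "inv_into U \<phi> (H (P (\<psi> (f x)))) = x" using x cU(3) by simp
  qed
qed

text \<open>The bump is transported from a closed ball inside a chart. Its preimage \<open>K\<close>
  is compact, hence closed in a Hausdorff space, so the chart domain and the complement of
  \<open>K\<close> form an open cover and extension by zero is smooth.\<close>

lemma exists_smooth_bump:
  fixes SA :: "('s::t2_space, 'f::euclidean_space) atlas"
  assumes SA: "smooth_atlas SA" and "open N" "s \<in> N"
  obtains b K where "smooth_function SA b" "\<And>x. b x \<ge> 0" "b s > 0" "closed K" "K \<subseteq> N" "\<And>x. x \<notin> K \<Longrightarrow> b x = 0"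
proof -
  obtain V \<psi> where V: "(V, \<psi>) \<in> SA" "s \<in> V" using smooth_atlas_chart[OF SA] .
  note c = smooth_atlasD[OF SA V(1)]
  have "open (\<psi> ` (V \<inter> N))" by (rule open_chart_Int[OF SA V(1) \<open>open N\<close>])
  then obtain r where r: "r > 0" "cball (\<psi> s) r \<subseteq> \<psi> ` (V \<inter> N)"
    using V(2) \<open>s \<in> N\<close> open_contains_cball[of "\<psi> ` (V \<inter> N)"] by blast
  obtain b0 :: "'f \<Rightarrow> real" where b0: "Cinf_on UNIV b0" "\<And>x. b0 x \<ge> 0" "\<And>x. b0 x > 0 \<longleftrightarrow> x \<in> ball (\<psi> s) r"
    using exists_Cinf_bump[OF r(1), of "\<psi> s"] by blast
  define K where "K = inv_into V \<psi> ` cball (\<psi> s) r"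
  have "compact K" unfolding K_def
    by (rule compact_continuous_image[OF continuous_on_subset[OF c(5)] compact_cball]) (use r in auto)
  then have "closed K" by (rule compact_imp_closed)
  have "inv_into V \<psi> ` \<psi> ` (V \<inter> N) = V \<inter> N"
    by (rule inv_into_image_cancel[OF c(3)]) simp
  then have "K \<subseteq> V \<inter> N" using image_mono[OF r(2), of "inv_into V \<psi>"] by (simp add: K_def)
  define b where "b x = (if x \<in> V then b0 (\<psi> x) else 0)" for x
  have zero: "b x = 0" if "x \<notin> K" for x
  proof (cases "x \<in> V")
    case True
    then have "\<psi> x \<notin> ball (\<psi> s) r"
      using that c(3) imageI[of "\<psi> x" "cball (\<psi> s) r" "inv_into V \<psi>"] by (auto simp: K_def)
    then show ?thesis using b0(2,3)[of "\<psi> x"] by (simp add: b_def True)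
  qed (simp add: b_def)
  have "smooth_map_on SA euclidean_atlas V (\<lambda>x. b0 (\<psi> x))"
    by (rule smooth_map_on_compose[OF SA smooth_atlas_euclidean smooth_atlas_euclidean c(1) open_UNIV _ smooth_map_on_chart[OF SA V(1)]])
      (auto simp: smooth_map_on_Cinf_on b0)
  then have "smooth_map_on SA euclidean_atlas V b"
    by (rule smooth_map_on_cong[OF SA smooth_atlas_euclidean c(1)]) (simp add: b_def)
  moreover have "smooth_map_on SA euclidean_atlas (- K) b"
    by (rule smooth_map_on_cong[OF SA smooth_atlas_euclidean _ smooth_map_on_const[of _ _ _ 0]])
      (use \<open>closed K\<close> zero in \<open>auto simp: open_Compl\<close>)
  ultimately have "smooth_function SA b"
    using c(1) open_Compl[OF \<open>closed K\<close>] \<open>K \<subseteq> V \<inter> N\<close>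
    by (intro smooth_map_on_local[OF SA smooth_atlas_euclidean]) blast
  then show ?thesis
    using that[of b K] b0 V(2) r(1) \<open>closed K\<close> \<open>K \<subseteq> V \<inter> N\<close> zero by (auto simp: b_def)
qed

text \<open>Composing with a retraction extends a function locally; bump functions at finitely many
  points, enough by compactness, glue these extensions.\<close>

lemma embedding_extends_smooth_function:
  fixes f :: "'m::topological_space \<Rightarrow> 's::t2_space"
    and MA :: "('m, 'e::euclidean_space) atlas" and SA :: "('s, 'f::euclidean_space) atlas"
  assumes MA: "smooth_atlas MA" and SA: "smooth_atlas SA" and emb: "embedding MA SA f"
    and "compact (UNIV :: 'm set)" and k: "smooth_function MA k"
  obtains h where "smooth_function SA h" "\<And>x. h (f x) = k x"
proof -
  have f: "smooth_map MA SA f" using emb by (simp add: embedding_def)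
  have "\<exists>N r b K. open N \<and> smooth_map_on SA MA N r \<and> (\<forall>x. f x \<in> N \<longrightarrow> r (f x) = x) \<and>
      smooth_function SA b \<and> (\<forall>s. b s \<ge> 0) \<and> b (f x) > 0 \<and> closed K \<and> K \<subseteq> N \<and> (\<forall>s. s \<notin> K \<longrightarrow> b s = 0)" for x
    by (rule embedding_local_retraction[OF MA SA emb, of x], rule exists_smooth_bump[OF SA], assumption+, blast)
  then obtain N r b K where N: "\<And>x. open (N x)" "\<And>x. smooth_map_on SA MA (N x) (r x)"
      "\<And>x y. f y \<in> N x \<Longrightarrow> r x (f y) = y"
    and b: "\<And>x. smooth_function SA (b x)" "\<And>x s. b x s \<ge> 0" "\<And>x. b x (f x) > 0"
    and K: "\<And>x. closed (K x)" "\<And>x. K x \<subseteq> N x" "\<And>x s. s \<notin> K x \<Longrightarrow> b x s = 0"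
    by metis
  define C where "C x = {y. b x (f y) > 0}" for x
  have bf: "smooth_function MA (\<lambda>y. b x (f y))" for x
    by (rule smooth_map_on_compose[OF MA SA smooth_atlas_euclidean open_UNIV open_UNIV _ f b(1)]) simp
  have "open (C x)" for x
    unfolding C_def using smooth_map_on_continuous[OF bf]
    by (simp add: open_Collect_less continuous_on_const)
  moreover have "UNIV \<subseteq> (\<Union>x. C x)" using b(3) by (auto simp: C_def)
  ultimately obtain I where I: "finite I" "UNIV \<subseteq> (\<Union>x\<in>I. C x)"
    using compactE_image[OF \<open>compact UNIV\<close>, of UNIV C] by metis
  define D where "D s = (\<Sum>x\<in>I. b x s)" for s
  have D: "D (f y) > 0" for y
  proof -
    obtain x where "x \<in> I" "b x (f y) > 0" using I(2) by (auto simp: C_def)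
    then show ?thesis unfolding D_def using b(2) I(1) by (intro sum_pos2) auto
  qed
  \<comment> \<open>The sum \<open>D\<close> of the bumps is known to be positive only along the
    image of \<open>f\<close>; hence the normalisation takes place on \<open>M\<close>, before
    extending.\<close>
  define k' where "k' y = k y * inverse (D (f y))" for y
  have "smooth_function MA (\<lambda>y. D (f y))"
    unfolding D_def by (rule smooth_map_on_sum[OF MA open_UNIV I(1) bf])
  then have k': "smooth_function MA k'"
    unfolding k'_def using D by (intro smooth_map_on_mult[OF MA open_UNIV k] smooth_map_on_inverse[OF MA open_UNIV])
      (auto simp: less_imp_neq[symmetric])
  define h where "h s = (\<Sum>x\<in>I. b x s * k' (r x s))" for s
  have "smooth_function SA (\<lambda>s. b x s * k' (r x s))" for x
  proof (rule smooth_map_on_local[OF SA smooth_atlas_euclidean])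
    fix s
    have 1: "smooth_map_on SA euclidean_atlas (N x) (\<lambda>s. b x s * k' (r x s))"
      by (intro smooth_map_on_mult[OF SA N(1)] smooth_map_on_subset[OF b(1)]
          smooth_map_on_compose[OF SA MA smooth_atlas_euclidean N(1) open_UNIV _ N(2) k']) auto
    have 2: "smooth_map_on SA euclidean_atlas (- K x) (\<lambda>s. b x s * k' (r x s))"
      by (rule smooth_map_on_cong[OF SA smooth_atlas_euclidean _ smooth_map_on_const[of _ _ _ 0]])
        (use K(1,3) in \<open>auto simp: open_Compl\<close>)
    show "\<exists>V. open V \<and> s \<in> V \<and> smooth_map_on SA euclidean_atlas V (\<lambda>s. b x s * k' (r x s))"
      using 1 2 N(1)[of x] K(1,2)[of x] by (cases "s \<in> N x") (auto simp: open_Compl)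
  qed
  then have "smooth_function SA h"
    unfolding h_def by (intro smooth_map_on_sum[OF SA open_UNIV I(1)])
  moreover have "h (f y) = k y" for y
  proof -
    \<comment> \<open>Off \<open>K x\<close> the bump vanishes, so the value of \<open>r x\<close>
      matters only where it retracts.\<close>
    have "b x (f y) * k' (r x (f y)) = b x (f y) * k' y" for x
      using N(3)[of y x] K(2)[of x] K(3)[of "f y" x] by (cases "f y \<in> K x") auto
    then have "h (f y) = D (f y) * k' y"
      by (simp only: h_def D_def sum_distrib_right)
    then show ?thesis using D[of y] by (simp add: k'_def)
  qed
  ultimately show ?thesis by (rule that)
qed

section \<open>The geometry of a prequantum bundle\<close>

lemma cis_Ln_of_unit:
  assumes "norm u = 1" shows "cis (Im (Ln u)) = u"
proof -
  have "u \<noteq> 0" using assms by auto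
  then have "u = exp (Ln u)" by simp
  also have "\<dots> = cis (Im (Ln u))"
    using assms \<open>u \<noteq> 0\<close> by (simp add: exp_eq_polar)
  finally show ?thesis by simp
qed

locale smooth_prequantum =
  fixes B :: "('s::t2_space, 'f::euclidean_space, 'p::topological_space, 'g::euclidean_space) prequantum"
  assumes base_atlas: "smooth_atlas (base_atlas B)" and total_atlas: "smooth_atlas (total_atlas B)"
    and symplectic: "symplectic_form (base_atlas B) (symp B)" and prequantum: "prequantum_bundle B"
begin

abbreviation "SA \<equiv> base_atlas B"
abbreviation "PA \<equiv> total_atlas B"
abbreviation "gen \<equiv> generator PA (act B)"

lemma smooth_proj: "smooth_map PA SA (proj B)"
  and smooth_act: "smooth_map (prod_atlas euclidean_atlas PA) PA (\<lambda>(t::real, y). act B (cis t) y)"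
  and act_1: "act B 1 y = y"
  and act_mult: "norm z = 1 \<Longrightarrow> norm z' = 1 \<Longrightarrow> act B (z * z') y = act B z (act B z' y)"
  and proj_act: "norm z = 1 \<Longrightarrow> proj B (act B z y) = proj B y"
  using prequantum by (simp_all add: prequantum_bundle_def principal_circle_bundle_def)

lemma conn_form: "smooth_form1 PA (conn B)"
  and conn_generator: "conn B y (gen y) = 1"
  and curvature: "has_ext_deriv PA (conn B) (\<lambda>y v w. symp B (proj B y) (tmap SA (proj B) y v) (tmap SA (proj B) y w))"
  using prequantum by (simp_all add: prequantum_bundle_def principal_connection_def)

lemma symp_form: "smooth_form2 SA (symp B)"
  and symp_nondegenerate: "v \<in> tangent SA s \<Longrightarrow> (\<And>w. w \<in> tangent SA s \<Longrightarrow> symp B s v w = 0) \<Longrightarrow> v = (\<lambda>_. 0)"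
  using symplectic by (auto simp: symplectic_form_def)

section \<open>Local trivialisations, vertical vectors and horizontal lifts\<close>

lemma local_trivialisation:
  obtains U \<sigma> \<tau> where "open U" "s \<in> U" "smooth_map_on SA PA U \<sigma>"
    "smooth_map_on PA (euclidean_atlas :: (complex, complex) atlas) (proj B -` U) \<tau>"
    "\<And>r. r \<in> U \<Longrightarrow> proj B (\<sigma> r) = r"
    "\<And>y. proj B y \<in> U \<Longrightarrow> norm (\<tau> y) = 1" "\<And>y. proj B y \<in> U \<Longrightarrow> act B (\<tau> y) (\<sigma> (proj B y)) = y"
proof -
  have "\<exists>U \<sigma> \<tau>. open U \<and> s \<in> U \<and> smooth_map_on SA PA U \<sigma> \<and>
        smooth_map_on PA (euclidean_atlas :: (complex, complex) atlas) (proj B -` U) \<tau> \<and>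
        (\<forall>r\<in>U. proj B (\<sigma> r) = r \<and> (\<forall>z\<in>sphere 0 1. \<tau> (act B z (\<sigma> r)) = z)) \<and>
        (\<forall>y\<in>proj B -` U. \<tau> y \<in> sphere 0 1 \<and> act B (\<tau> y) (\<sigma> (proj B y)) = y)"
    using prequantum unfolding prequantum_bundle_def principal_circle_bundle_def by blast
  then obtain U \<sigma> \<tau> where *: "open U" "s \<in> U" "smooth_map_on SA PA U \<sigma>"
        "smooth_map_on PA (euclidean_atlas :: (complex, complex) atlas) (proj B -` U) \<tau>"
        "\<forall>r\<in>U. proj B (\<sigma> r) = r \<and> (\<forall>z\<in>sphere 0 1. \<tau> (act B z (\<sigma> r)) = z)"
        "\<forall>y\<in>proj B -` U. \<tau> y \<in> sphere 0 1 \<and> act B (\<tau> y) (\<sigma> (proj B y)) = y" by blast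
  show ?thesis
    by (rule that[OF *(1-4)]) (use *(5,6) in auto)
qed

lemma generator_in_tangent: "gen y \<in> tangent PA y"
proof -
  have "smooth_map euclidean_atlas PA (\<lambda>t::real. (\<lambda>(t, y). act B (cis t) y) (t, y))"
    by (rule smooth_map_on_compose[OF smooth_atlas_euclidean smooth_atlas_prod[OF smooth_atlas_euclidean total_atlas]
          total_atlas open_UNIV open_UNIV _ _ smooth_act])
      (auto intro!: smooth_map_on_Pair smooth_atlas_euclidean total_atlas smooth_map_on_id smooth_map_on_const)
  from velocity_along_in_tangent[OF total_atlas open_UNIV this, of 0 1]
  show ?thesis by (simp add: generator_def act_1)
qed

lemma tmap_generator: "tmap SA (proj B) y (gen y) = (\<lambda>_. 0)"
  using tmap_velocity[OF total_atlas base_atlas smooth_proj, of "\<lambda>t. act B (cis t) y"]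
  by (simp add: generator_def proj_act act_1 velocity_const)

lemma smooth_trivialisation:
  assumes "open U" "smooth_map_on SA PA U \<sigma>"
  shows "smooth_map_on (prod_atlas euclidean_atlas SA) PA (UNIV \<times> U) (\<lambda>(t::real, s). act B (cis t) (\<sigma> s))"
proof -
  let ?E = "euclidean_atlas :: (real, real) atlas"
  note at = smooth_atlas_prod[OF smooth_atlas_euclidean base_atlas]
  have o: "open (UNIV \<times> U)" using assms(1) by (simp add: open_Times)
  have \<sigma>: "smooth_map_on (prod_atlas ?E SA) PA (UNIV \<times> U) (\<lambda>x. \<sigma> (snd x))"
    by (rule smooth_map_on_compose[OF at base_atlas total_atlas o assms(1) _ smooth_map_on_subset[OF smooth_map_snd[OF smooth_atlas_euclidean base_atlas]] assms(2)]) auto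
  have "smooth_map_on (prod_atlas ?E SA) PA (UNIV \<times> U) (\<lambda>x. (\<lambda>(t, y). act B (cis t) y) (fst x, \<sigma> (snd x)))"
    by (rule smooth_map_on_compose[OF at smooth_atlas_prod[OF smooth_atlas_euclidean total_atlas] total_atlas o open_UNIV _ _ smooth_act])
      (auto intro!: smooth_map_on_Pair at smooth_atlas_euclidean total_atlas o \<sigma> smooth_map_on_subset[OF smooth_map_fst[OF smooth_atlas_euclidean base_atlas]])
  then show ?thesis by (simp add: case_prod_beta')
qed

text \<open>In a trivialisation \<open>(t, s) \<mapsto> act (cis t) (\<sigma> s)\<close> a curve whose projection is stationary to first
  order moves, to first order, along the fibre only.\<close>

lemma vertical_tangent:
  assumes w: "w \<in> tangent PA y" and vert: "tmap SA (proj B) y w = (\<lambda>_. 0)"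
  obtains l where "w = (\<lambda>g. l * gen y g)"
proof -
  obtain c where c: "smooth_map euclidean_atlas PA c" "c 0 = y" "w = velocity PA c"
    using w by (auto simp: tangent_def)
  obtain U \<sigma> \<tau> where U: "open U" "proj B y \<in> U" "smooth_map_on SA PA U \<sigma>"
    "smooth_map_on PA (euclidean_atlas :: (complex, complex) atlas) (proj B -` U) \<tau>"
    "\<And>r. r \<in> U \<Longrightarrow> proj B (\<sigma> r) = r"
    "\<And>y. proj B y \<in> U \<Longrightarrow> norm (\<tau> y) = 1" "\<And>y. proj B y \<in> U \<Longrightarrow> act B (\<tau> y) (\<sigma> (proj B y)) = y"
    by (rule local_trivialisation[of "proj B y"]) (rule that)
  let ?\<Psi> = "\<lambda>(t::real, s). act B (cis t) (\<sigma> s)"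
  obtain V \<psi> where V: "(V, \<psi>) \<in> SA" "proj B y \<in> V" using smooth_atlas_chart[OF base_atlas] .
  have pc: "smooth_map euclidean_atlas SA (\<lambda>t. proj B (c t))"
    by (rule smooth_map_on_compose[OF smooth_atlas_euclidean total_atlas base_atlas open_UNIV open_UNIV _ c(1) smooth_proj]) simp
  define T where "T = (\<lambda>t. proj B (c t)) -` U"
  have "open T" unfolding T_def
    using open_Int_vimage[OF open_UNIV smooth_map_on_continuous[OF pc] U(1)] by simp
  have 0: "0 \<in> T" using U(2) c(2) by (simp add: T_def)
  have o_pU: "open (proj B -` U)"
    using open_Int_vimage[OF open_UNIV smooth_map_on_continuous[OF smooth_proj] U(1)] by simp
  define z where "z t = \<tau> (c t)" for t
  have "smooth_map_on euclidean_atlas euclidean_atlas T z"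
    unfolding z_def
    by (rule smooth_map_on_compose[OF smooth_atlas_euclidean total_atlas smooth_atlas_euclidean \<open>open T\<close> o_pU _
          smooth_map_on_subset[OF c(1)] U(4)]) (auto simp: T_def)
  then have z: "Cinf_on T z" by (simp add: smooth_map_on_Cinf_on \<open>open T\<close>)
  have nz: "norm (z t) = 1" if "t \<in> T" for t using U(6) that by (simp add: z_def T_def)
  define \<theta>0 where "\<theta>0 = Im (Ln (z 0))"
  have \<theta>0: "cis \<theta>0 = z 0" unfolding \<theta>0_def by (rule cis_Ln_of_unit[OF nz[OF 0]])
  \<comment> \<open>Multiplication by the conjugate of \<open>z 0\<close> moves the initial value to
    1, away from the branch cut of \<open>Ln\<close>, so that \<theta> is differentiable at
    0.\<close>
  define \<theta> where "\<theta> t = \<theta>0 + Im (Ln (z t * cnj (z 0)))" for t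
  have cnj0: "z 0 * cnj (z 0) = 1" using nz[OF 0] by (simp add: complex_norm_square[symmetric])
  have \<theta>: "cis (\<theta> t) = z t" if "t \<in> T" for t
  proof -
    have "cis (\<theta> t) = z 0 * (z t * cnj (z 0))"
      using nz[OF that] nz[OF 0] by (simp add: \<theta>_def cis_mult[symmetric] \<theta>0 cis_Ln_of_unit norm_mult)
    then show ?thesis using cnj0 by (simp add: mult.left_commute)
  qed
  have "\<theta> 0 = \<theta>0" using cnj0 by (simp add: \<theta>_def)
  have "(Ln has_derivative (\<lambda>x. inverse (z 0 * cnj (z 0)) * x)) (at (z 0 * cnj (z 0)))"
    using has_field_derivative_Ln[of "z 0 * cnj (z 0)"] by (simp add: has_field_derivative_def cnj0 lambda_one)
  from has_derivative_compose[OF has_derivative_mult_left[OF Cinf_on_has_derivative[OF z 0]] this]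
  have "((\<lambda>t. Ln (z t * cnj (z 0))) has_derivative
      (\<lambda>t. inverse (z 0 * cnj (z 0)) * (frechet_derivative z (at 0) t * cnj (z 0)))) (at 0)" .
  from has_derivative_add[OF has_derivative_const bounded_linear.has_derivative[OF bounded_linear_Im this]]
  obtain \<theta>' where \<theta>': "(\<theta> has_derivative \<theta>') (at 0)" unfolding \<theta>_def[abs_def] by blast
  \<comment> \<open>\<open>e\<close> is the curve \<open>c\<close> read in the trivialisation:
    \<open>?\<Psi> (e t) = c t\<close> near 0.\<close>
  define e where "e t = (\<theta> t, proj B (c t))" for t
  let ?A = "prod_atlas (euclidean_atlas :: (real, real) atlas) SA"
  have atl: "smooth_atlas ?A" by (rule smooth_atlas_prod[OF smooth_atlas_euclidean base_atlas])
  have W: "(UNIV \<times> V, map_prod id \<psi>) \<in> ?A" using V(1) by (auto simp: prod_atlas_def euclidean_atlas_def)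
  have e0: "e 0 = (\<theta>0, proj B y)" by (simp add: e_def \<open>\<theta> 0 = \<theta>0\<close> c(2))
  have e0': "e 0 \<in> UNIV \<times> V" using V(2) by (simp add: e0)
  have "velocity SA (\<lambda>t. proj B (c t)) = (\<lambda>_. 0)"
    using tmap_velocity[OF total_atlas base_atlas smooth_proj, of c] vert c(2,3) by simp
  then have "coord_vec SA V \<psi> (\<psi> (proj B y)) (frechet_derivative (\<psi> \<circ> (\<lambda>t. proj B (c t))) (at 0) 1) = (\<lambda>_. 0)"
    using velocity_along[OF base_atlas V(1) open_UNIV pc, of 0 1] c(2) V(2) by simp
  then have zero: "frechet_derivative (\<psi> \<circ> (\<lambda>t. proj B (c t))) (at 0) 1 = 0"
    by (rule coord_vec_eq_zero[OF base_atlas V(1) imageI[OF V(2)]])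
  have psi: "(\<psi> \<circ> (\<lambda>t. proj B (c t)) has_derivative frechet_derivative (\<psi> \<circ> (\<lambda>t. proj B (c t))) (at 0)) (at 0)"
    by (rule Cinf_on_has_derivative[OF Cinf_on_chart_compose[OF pc V(1)]]) (use V(2) c(2) in simp)
  have "frechet_derivative (\<psi> \<circ> (\<lambda>t. proj B (c t))) (at 0) = (\<lambda>t. 0)"
    using linear_scale[OF has_derivative_linear[OF psi], of _ 1] zero by (auto simp: fun_eq_iff)
  then have psi: "((\<lambda>t. \<psi> (proj B (c t))) has_derivative (\<lambda>t. 0)) (at 0)"
    using psi by (simp add: o_def)
  define l where "l = \<theta>' 1"
  have \<theta>'1: "\<theta>' t = t * l" for t
    using linear_scale[OF has_derivative_linear[OF \<theta>'], of t 1] by (simp add: l_def)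
  have "((\<lambda>t. map_prod id \<psi> (e t)) has_vector_derivative (l, 0)) (at 0)"
    using has_derivative_Pair[OF \<theta>' psi] \<theta>'1 by (simp add: e_def has_vector_derivative_def)
  moreover have "isCont e 0"
  proof -
    have "isCont \<theta> 0" using \<theta>' has_derivative_continuous by blast
    moreover have "isCont (\<lambda>t. proj B (c t)) 0"
      using smooth_map_on_continuous[OF pc] by (simp add: continuous_on_eq_continuous_at)
    ultimately show ?thesis unfolding e_def[abs_def] isCont_def by (intro tendsto_Pair)
  qed
  ultimately have ve: "velocity ?A e = coord_vec ?A (UNIV \<times> V) (map_prod id \<psi>) (map_prod id \<psi> (e 0)) (l, 0)"
    by (intro velocity_eq_coord_vec[OF atl W, where c = e] e0')
  \<comment> \<open>A reference curve, carried by the trivialisation to the orbit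
    \<open>act B (cis t) y\<close>, whose velocity is the generator. The base part of
    \<open>e\<close> is stationary to first order, so the two velocities are proportional, the
    factor being the derivative \<open>l\<close> of the angle.\<close>
  define e1 where "e1 t = (\<theta>0 + t, proj B y)" for t
  have e1: "velocity ?A e1 = coord_vec ?A (UNIV \<times> V) (map_prod id \<psi>) (map_prod id \<psi> (e1 0)) (1, 0)"
  proof (rule velocity_eq_coord_vec[OF atl W])
    show "isCont e1 0" unfolding e1_def isCont_def by (intro tendsto_intros)
    show "((\<lambda>t. map_prod id \<psi> (e1 t)) has_vector_derivative (1, 0)) (at 0)"
      by (auto simp: e1_def has_vector_derivative_def intro!: derivative_eq_intros)
  qed (use V(2) in \<open>simp add: e1_def\<close>)
  have e10: "e1 0 = e 0" by (simp add: e1_def e0)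
  have "velocity ?A e = (\<lambda>g. l * velocity ?A e1 g)"
    using coord_vec_lincomb[OF atl W imageI[OF e0'], of "l" "(1, 0)" 0 0] by (simp add: ve e1 e10)
  then have tm: "tmap PA ?\<Psi> (e 0) (velocity ?A e) = (\<lambda>g. l * tmap PA ?\<Psi> (e 0) (velocity ?A e1) g)"
    using tmap_lincomb[of PA ?\<Psi> "e 0" "l" "velocity ?A e1" 0 "velocity ?A e1"] by simp
  have oU: "open (UNIV \<times> U)" using U(1) by (simp add: open_Times)
  note \<Psi> = smooth_trivialisation[OF U(1,3)]
  have "tmap PA ?\<Psi> (e 0) (velocity ?A e) = velocity PA (\<lambda>t. ?\<Psi> (e t))"
    by (rule tmap_velocity_on[OF atl total_atlas oU _ \<Psi>]) (use U(2) in \<open>simp add: e0\<close>)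
  also have "\<dots> = velocity PA c"
  proof (rule velocity_cong)
    have "\<forall>\<^sub>F t in nhds 0. t \<in> T" using \<open>open T\<close> 0 by (simp add: eventually_nhds_in_open)
    then show "\<forall>\<^sub>F t in nhds 0. ?\<Psi> (e t) = c t"
      by (rule eventually_mono) (use U(7) \<theta> in \<open>auto simp: e_def z_def T_def\<close>)
  qed
  finally have 1: "tmap PA ?\<Psi> (e 0) (velocity ?A e) = w" by (simp add: c(3))
  have "tmap PA ?\<Psi> (e 0) (velocity ?A e1) = velocity PA (\<lambda>t. ?\<Psi> (e1 t))"
    unfolding e10[symmetric]
    by (rule tmap_velocity_on[OF atl total_atlas oU _ \<Psi>]) (use U(2) in \<open>simp add: e1_def\<close>)
  also have "(\<lambda>t. ?\<Psi> (e1 t)) = (\<lambda>t. act B (cis t) y)"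
  proof
    fix t
    have "?\<Psi> (e1 t) = act B (cis t * cis \<theta>0) (\<sigma> (proj B y))" by (simp add: e1_def cis_mult add.commute)
    also have "\<dots> = act B (cis t) (act B (\<tau> y) (\<sigma> (proj B y)))"
      using \<theta>0 U(6)[OF U(2)] by (subst act_mult) (auto simp: z_def c(2))
    finally show "?\<Psi> (e1 t) = act B (cis t) y" using U(2,7) by simp
  qed
  finally have 2: "tmap PA ?\<Psi> (e 0) (velocity ?A e1) = gen y" by (simp add: generator_def)
  show ?thesis by (rule that[of l]) (use tm in \<open>simp only: 1 2\<close>)
qed

text \<open>A vertical vector is \<open>l\<close> times the generator, and the connection reads off
  \<open>l\<close>. Below, tangent vectors of the total space are shown equal by comparing
  projections and connection values.\<close>

lemma tangent_eq_0:
  assumes w: "w \<in> tangent PA y" and vert: "tmap SA (proj B) y w = (\<lambda>_. 0)" and hor: "conn B y w = 0"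
  shows "w = (\<lambda>_. 0)"
proof -
  obtain l where l: "w = (\<lambda>g. l * gen y g)" using vertical_tangent[OF w vert] .
  have "conn B y w = l"
    using smooth_form1_lincomb[OF conn_form generator_in_tangent generator_in_tangent, of y l 0]
    by (simp add: l conn_generator)
  then show ?thesis using l hor by simp
qed

text \<open>A curve in the base is lifted at a constant angle of a trivialisation; subtracting a
  multiple of the generator then corrects the connection value without changing the
  projection.\<close>

lemma horizontal_lift_exists:
  assumes v: "v \<in> tangent SA (proj B y)"
  obtains w where "w \<in> tangent PA y" "conn B y w = 0" "tmap SA (proj B) y w = v"
proof -
  obtain c where c: "smooth_map euclidean_atlas SA c" "c 0 = proj B y" "v = velocity SA c"
    using v by (auto simp: tangent_def)
  obtain U \<sigma> \<tau> where U: "open U" "proj B y \<in> U" "smooth_map_on SA PA U \<sigma>"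
    "smooth_map_on PA (euclidean_atlas :: (complex, complex) atlas) (proj B -` U) \<tau>"
    "\<And>r. r \<in> U \<Longrightarrow> proj B (\<sigma> r) = r"
    "\<And>y. proj B y \<in> U \<Longrightarrow> norm (\<tau> y) = 1" "\<And>y. proj B y \<in> U \<Longrightarrow> act B (\<tau> y) (\<sigma> (proj B y)) = y"
    by (rule local_trivialisation[of "proj B y"]) (rule that)
  \<comment> \<open>The constant angle is that of \<open>y\<close> itself, so that the lifted curve
    starts at \<open>y\<close>.\<close>
  define \<theta> where "\<theta> = Im (Ln (\<tau> y))"
  have \<theta>: "cis \<theta> = \<tau> y" unfolding \<theta>_def by (rule cis_Ln_of_unit[OF U(6)[OF U(2)]])
  define T where "T = c -` U"
  have "open T" unfolding T_def
    using open_Int_vimage[OF open_UNIV smooth_map_on_continuous[OF c(1)] U(1)] by simp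
  have 0: "0 \<in> T" using U(2) c(2) by (simp add: T_def)
  let ?c = "\<lambda>t. (\<lambda>(t, s). act B (cis t) (\<sigma> s)) (\<theta>, c t)"
  have oU: "open (UNIV \<times> U)" using U(1) by (simp add: open_Times)
  have sc: "smooth_map_on euclidean_atlas PA T ?c"
    by (rule smooth_map_on_compose[OF smooth_atlas_euclidean smooth_atlas_prod[OF smooth_atlas_euclidean base_atlas]
          total_atlas \<open>open T\<close> oU _ _ smooth_trivialisation[OF U(1,3)]])
      (auto simp: T_def intro!: smooth_map_on_Pair smooth_atlas_euclidean base_atlas \<open>open T\<close>[unfolded T_def]
        smooth_map_on_const smooth_map_on_subset[OF c(1)])
  have c0: "?c 0 = y" using U(2,7) by (simp add: c(2) \<theta>)
  define w where "w = velocity PA ?c"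
  have w: "w \<in> tangent PA y"
    using velocity_along_in_tangent[OF total_atlas \<open>open T\<close> sc 0, of 1] c0 by (simp add: w_def)
  have "tmap SA (proj B) y w = velocity SA (\<lambda>t. proj B (?c t))"
    unfolding w_def using tmap_velocity[OF total_atlas base_atlas smooth_proj, of ?c] c0 by simp
  also have "\<dots> = velocity SA c"
  proof (rule velocity_cong)
    have "\<forall>\<^sub>F t in nhds 0. t \<in> T" using \<open>open T\<close> 0 by (simp add: eventually_nhds_in_open)
    then show "\<forall>\<^sub>F t in nhds 0. proj B (?c t) = c t"
      by (rule eventually_mono) (use U(5) in \<open>auto simp: T_def proj_act\<close>)
  qed
  finally have tw: "tmap SA (proj B) y w = v" by (simp add: c(3))
  let ?w = "\<lambda>g. 1 * w g + (- conn B y w) * gen y g"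
  show ?thesis
  proof (rule that)
    show "?w \<in> tangent PA y" by (rule tangent_lincomb[OF total_atlas w generator_in_tangent])
    show "conn B y ?w = 0"
      by (subst smooth_form1_lincomb[OF conn_form w generator_in_tangent]) (simp add: conn_generator)
    show "tmap SA (proj B) y ?w = v"
      by (subst tmap_lincomb) (simp add: tw tmap_generator)
  qed
qed

lemma hor_lift:
  assumes "v \<in> tangent SA (proj B y)"
  shows "hor_lift B y v \<in> tangent PA y" "conn B y (hor_lift B y v) = 0" "tmap SA (proj B) y (hor_lift B y v) = v"
proof -
  have "\<exists>!w. w \<in> tangent PA y \<and> conn B y w = 0 \<and> tmap SA (proj B) y w = v"
  proof (rule ex_ex1I)
    show "\<exists>w. w \<in> tangent PA y \<and> conn B y w = 0 \<and> tmap SA (proj B) y w = v"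
      using horizontal_lift_exists[OF assms] by blast
    fix w w'
    assume w: "w \<in> tangent PA y \<and> conn B y w = 0 \<and> tmap SA (proj B) y w = v"
      and w': "w' \<in> tangent PA y \<and> conn B y w' = 0 \<and> tmap SA (proj B) y w' = v"
    have "(\<lambda>g. w g - w' g) = (\<lambda>_. 0)"
      using w w' by (intro tangent_eq_0 tangent_diff[OF total_atlas]) (auto simp: tmap_diff smooth_form1_diff[OF conn_form])
    then show "w = w'" by (simp add: fun_eq_iff)
  qed
  from theI'[OF this] show "hor_lift B y v \<in> tangent PA y" "conn B y (hor_lift B y v) = 0"
    "tmap SA (proj B) y (hor_lift B y v) = v"
    unfolding hor_lift_def by auto
qed

section \<open>Linear symplectic algebra in a chart\<close>

lemma symp_coord:
  assumes U: "(U, \<phi>) \<in> SA" "s \<in> U"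
  obtains J :: "'f \<Rightarrow> 'f" where "linear J" "inj J"
    "\<And>a b. symp B s (coord_vec SA U \<phi> (\<phi> s) a) (coord_vec SA U \<phi> (\<phi> s) b) = J a \<bullet> b"
proof -
  let ?c = "coord_vec SA U \<phi> (\<phi> s)"
  let ?b = "\<lambda>a b. symp B s (?c a) (?c b)"
  have t: "?c a \<in> tangent SA s" for a by (simp add: tangent_eq_range_coord_vec[OF base_atlas U])
  note lc = coord_vec_lincomb[OF base_atlas U(1) imageI[OF U(2)]]
  have r: "?b a (x *\<^sub>R b + y *\<^sub>R b') = x * ?b a b + y * ?b a b'" for a b b' x y
    using smooth_form2_lincomb_right[OF symp_form t t t] by (simp add: lc)
  have l: "?b (x *\<^sub>R a + y *\<^sub>R a') b = x * ?b a b + y * ?b a' b" for a a' b x y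
    using smooth_form2_lincomb_left[OF base_atlas symp_form t t t] by (simp add: lc)
  \<comment> \<open>\<open>J\<close> represents the symplectic form through the Euclidean inner
    product of the chart, so nondegeneracy becomes injectivity. It is not an almost complex
    structure.\<close>
  define J where "J a = (\<Sum>i\<in>Basis. ?b a i *\<^sub>R i)" for a
  have J: "?b a b = J a \<bullet> b" for a b
  proof -
    have "linear (?b a)" using r[of a 1 _ 1] r[of a _ _ 0 0] by (intro linearI) auto
    from linear_Basis_expansion[OF this, of b] show ?thesis
      by (simp add: J_def inner_sum_left inner_commute[of b] mult.commute)
  qed
  have "linear J"
    using l[of 1 _ 1] l[of _ _ 0 0]
    by (intro linearI) (auto simp: J_def sum.distrib scaleR_add_left scaleR_sum_right)
  moreover have "inj J"
  proof (subst linear_injective_0[OF \<open>linear J\<close>], intro allI impI)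
    fix a assume "J a = 0"
    then have "symp B s (?c a) w = 0" if "w \<in> tangent SA s" for w
      using that J by (auto simp: tangent_eq_range_coord_vec[OF base_atlas U])
    then have "?c a = (\<lambda>_. 0)" by (rule symp_nondegenerate[OF t])
    then show "a = 0" by (rule coord_vec_eq_zero[OF base_atlas U(1) imageI[OF U(2)]])
  qed
  ultimately show ?thesis using J that by blast
qed

lemma ham_field:
  assumes h: "smooth_function SA h"
  shows "ham_field B h s \<in> tangent SA s" "w \<in> tangent SA s \<Longrightarrow> symp B s (ham_field B h s) w = w h"
proof -
  have "\<exists>!v. v \<in> tangent SA s \<and> (\<forall>w\<in>tangent SA s. symp B s v w = w h)"
  proof (rule ex_ex1I)
    obtain U \<phi> where U: "(U, \<phi>) \<in> SA" "s \<in> U" using smooth_atlas_chart[OF base_atlas] .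
    obtain J where J: "linear J" "inj J"
      "\<And>a b. symp B s (coord_vec SA U \<phi> (\<phi> s) a) (coord_vec SA U \<phi> (\<phi> s) b) = J a \<bullet> b"
      by (rule symp_coord[OF U]) (rule that)
    let ?c = "coord_vec SA U \<phi> (\<phi> s)"
    \<comment> \<open>Injective linear maps in finite dimension are onto, so the differential of
      \<open>h\<close>, written as a Euclidean vector, has a preimage: the coordinates of the
      Hamiltonian vector.\<close>
    have "surj J" using J(1,2) by (rule linear_inj_imp_surj)
    then obtain a where a: "J a = (\<Sum>i\<in>Basis. ?c i h *\<^sub>R i)" unfolding surj_def by metis
    have "linear (\<lambda>b. ?c b h)"
      using coord_vec_lincomb[OF base_atlas U(1) imageI[OF U(2)], of 1 _ 1]
        coord_vec_lincomb[OF base_atlas U(1) imageI[OF U(2)], of _ _ 0 0] by (intro linearI) auto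
    then have "J a \<bullet> b = ?c b h" for b
      unfolding a by (subst linear_Basis_expansion[of "\<lambda>b. ?c b h" b]) (simp_all add: inner_sum_left inner_commute[of b] mult.commute)
    then show "\<exists>v. v \<in> tangent SA s \<and> (\<forall>w\<in>tangent SA s. symp B s v w = w h)"
      by (intro exI[of _ "?c a"]) (auto simp: tangent_eq_range_coord_vec[OF base_atlas U] J(3))
    fix v v'
    assume v: "v \<in> tangent SA s \<and> (\<forall>w\<in>tangent SA s. symp B s v w = w h)"
      and v': "v' \<in> tangent SA s \<and> (\<forall>w\<in>tangent SA s. symp B s v' w = w h)"
    have "(\<lambda>g. v g - v' g) = (\<lambda>_. 0)"
    proof (rule symp_nondegenerate[of _ s])
      show "(\<lambda>g. v g - v' g) \<in> tangent SA s" using v v' tangent_diff[OF base_atlas] by blast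
      show "symp B s (\<lambda>g. v g - v' g) w = 0" if "w \<in> tangent SA s" for w
        using v v' that smooth_form2_lincomb_left[OF base_atlas symp_form, of v s v' w 1 "-1"] by simp
    qed
    then show "v = v'" by (simp add: fun_eq_iff)
  qed
  from theI'[OF this] show "ham_field B h s \<in> tangent SA s"
    "w \<in> tangent SA s \<Longrightarrow> symp B s (ham_field B h s) w = w h"
    unfolding ham_field_def by auto
qed

text \<open>Isotropy says that \<open>J\<close> maps the image \<open>?R\<close> of the differential
  into its Euclidean complement \<open>?O\<close>; half dimension makes this map onto. Orthogonality
  of \<open>v\<close> puts \<open>J a\<close> into \<open>?O\<close>, and injectivity of
  \<open>J\<close> brings \<open>a\<close> back to \<open>?R\<close>.\<close>

lemma lagrangian_maximal:
  fixes MA :: "('m::topological_space, 'e::euclidean_space) atlas"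
  assumes MA: "smooth_atlas MA" and f: "f \<in> Emb_Lag MA B" and dim: "2 * DIM('e) = DIM('f)"
    and v: "v \<in> tangent SA (f x)" and orth: "\<And>w. w \<in> tangent MA x \<Longrightarrow> symp B (f x) v (tmap SA f x w) = 0"
  obtains w where "w \<in> tangent MA x" "v = tmap SA f x w"
proof -
  have emb: "embedding MA SA f" and iso: "\<And>v w. v \<in> tangent MA x \<Longrightarrow> w \<in> tangent MA x \<Longrightarrow>
      symp B (f x) (tmap SA f x v) (tmap SA f x w) = 0"
    using f by (auto simp: Emb_Lag_def)
  have sf: "smooth_map MA SA f" using emb by (simp add: embedding_def)
  obtain U \<phi> where U: "(U, \<phi>) \<in> MA" "x \<in> U" using smooth_atlas_chart[OF MA] .
  obtain V \<psi> where V: "(V, \<psi>) \<in> SA" "f x \<in> V" using smooth_atlas_chart[OF base_atlas] .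
  let ?c = "coord_vec MA U \<phi> (\<phi> x)" and ?d = "coord_vec SA V \<psi> (\<psi> (f x))"
  have tc: "?c a \<in> tangent MA x" for a by (simp add: tangent_eq_range_coord_vec[OF MA U])
  obtain J where J: "linear J" "inj J" "\<And>a b. symp B (f x) (?d a) (?d b) = J a \<bullet> b"
    by (rule symp_coord[OF V]) (rule that)
  let ?F = "\<psi> \<circ> f \<circ> inv_into U \<phi>"
  let ?I = "frechet_derivative ?F (at (\<phi> x))"
  have I: "tmap SA f x (?c a) = ?d (?I a)" for a by (rule tmap_coord_vec[OF MA base_atlas sf U V])
  have "(?F has_derivative ?I) (at (\<phi> x))"
    by (rule Cinf_on_has_derivative[OF smooth_map_onD[OF sf U(1) V(1)]]) (use U(2) V(2) in auto)
  then have lin: "linear ?I" by (rule has_derivative_linear)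
  have "inj ?I"
  proof (subst linear_injective_0[OF lin], intro allI impI)
    fix a assume "?I a = 0"
    then have "tmap SA f x (?c a) = (\<lambda>_. 0)" by (simp add: I coord_vec_zero[OF base_atlas V(1) imageI[OF V(2)]])
    then have "?c a = (\<lambda>_. 0)" using emb tc unfolding embedding_def by blast
    then show "a = 0" by (rule coord_vec_eq_zero[OF MA U(1) imageI[OF U(2)]])
  qed
  let ?R = "range ?I"
  let ?O = "{y \<in> UNIV. \<forall>r\<in>?R. orthogonal r y}"
  have sR: "subspace ?R" by (rule linear_subspace_image[OF lin subspace_UNIV])
  have dR: "dim ?R = DIM('e)" using dim_image_eq[OF lin, of UNIV] \<open>inj ?I\<close> by simp
  have dO: "dim ?O + dim ?R = DIM('f)"
    using dim_subspace_orthogonal_to_vectors[OF sR subspace_UNIV subset_UNIV] by simp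
  have sO: "subspace ?O" by (simp only: UNIV_I simp_thms subspace_orthogonal_to_vectors)
  have sJ: "subspace (J ` ?R)" by (rule linear_subspace_image[OF J(1) sR])
  have "J (?I a) \<bullet> ?I b = 0" for a b
    using iso[OF tc tc, of a b] by (simp add: I J(3))
  then have sub: "J ` ?R \<subseteq> ?O" by (auto simp: orthogonal_def inner_commute)
  have "dim (J ` ?R) = dim ?R" using dim_image_eq[OF J(1), of ?R] J(2) inj_on_subset by blast
  then have JO: "J ` ?R = ?O" using dO dR dim by (intro subspace_dim_equal[OF sJ sO sub]) simp
  obtain a where a: "v = ?d a" using v by (auto simp: tangent_eq_range_coord_vec[OF base_atlas V])
  have "J a \<bullet> ?I b = 0" for b using orth[OF tc, of b] by (simp add: a I J(3))
  then have "J a \<in> ?O" by (auto simp: orthogonal_def inner_commute)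
  then have "J a \<in> J ` ?R" by (simp only: JO)
  then obtain b where "J a = J (?I b)" by auto
  then have "v = tmap SA f x (?c b)" using J(2) by (simp add: a I inj_eq)
  then show ?thesis using that tc by blast
qed

end

section \<open>Velocities of horizontal families\<close>

lemma family_compose:
  fixes MA :: "('m::topological_space, 'e::euclidean_space) atlas"
    and XA :: "('x::topological_space, 'h::euclidean_space) atlas" and a :: "'d::euclidean_space \<Rightarrow> plane"
  assumes MA: "smooth_atlas MA" and XA: "smooth_atlas XA"
    and F: "smooth_map (prod_atlas euclidean_atlas MA) XA (\<lambda>(u, x). F u x)"
    and "open W" and a: "Cinf_on W a" and g: "smooth_map_on euclidean_atlas MA W g"
  shows "smooth_map_on euclidean_atlas XA W (\<lambda>y. F (a y) (g y))"
proof -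
  have "smooth_map_on euclidean_atlas (prod_atlas euclidean_atlas MA) W (\<lambda>y. (a y, g y))"
    using a by (intro smooth_map_on_Pair[OF smooth_atlas_euclidean smooth_atlas_euclidean MA \<open>open W\<close> _ g])
      (simp add: smooth_map_on_Cinf_on \<open>open W\<close>)
  from smooth_map_on_compose[OF smooth_atlas_euclidean smooth_atlas_prod[OF smooth_atlas_euclidean MA] XA
      \<open>open W\<close> open_UNIV subset_UNIV this F]
  show ?thesis by simp
qed

text \<open>The plane has a single chart, so only charts of \<open>M\<close> are left to test; in
  this form partial derivatives in the parameter can be taken.\<close>

lemma smooth_map_prod_chart:
  fixes MA :: "('m::topological_space, 'e::euclidean_space) atlas" and q :: "plane \<times> 'm \<Rightarrow> real"
  assumes MA: "smooth_atlas MA"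
  shows "smooth_function (prod_atlas euclidean_atlas MA) q \<longleftrightarrow>
    (\<forall>(U, \<phi>)\<in>MA. Cinf_on (UNIV \<times> \<phi> ` U) (\<lambda>y. q (fst y, inv_into U \<phi> (snd y))))"
proof -
  let ?A = "prod_atlas euclidean_atlas MA :: (plane \<times> 'm, plane \<times> 'e) atlas"
  have chart: "Cinf_on (map_prod id \<phi> ` ((UNIV \<times> U) \<inter> UNIV)) (q \<circ> inv_into (UNIV \<times> U) (map_prod id \<phi>)) \<longleftrightarrow>
      Cinf_on (UNIV \<times> \<phi> ` U) (\<lambda>y. q (fst y, inv_into U \<phi> (snd y)))" if U: "(U, \<phi>) \<in> MA" for U \<phi>
  proof -
    have im: "map_prod id \<phi> ` ((UNIV \<times> U) \<inter> UNIV) = (UNIV :: plane set) \<times> \<phi> ` U"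
      by (simp add: map_prod_surj_on)
    have o: "open ((UNIV :: plane set) \<times> \<phi> ` U)" using smooth_atlasD(2)[OF MA U] by (simp add: open_Times)
    have eq: "(q \<circ> inv_into (UNIV \<times> U) (map_prod id \<phi>)) y = q (fst y, inv_into U \<phi> (snd y))" if "y \<in> UNIV \<times> \<phi> ` U" for y
      using that inv_into_map_prod[OF inj_on_id[of "UNIV :: plane set"] smooth_atlasD(3)[OF MA U]] by (auto simp: inv_id)
    show ?thesis
      unfolding im by (rule iffI; erule Cinf_on_cong[OF o]) (simp_all only: eq)
  qed
  show ?thesis
    unfolding smooth_map_on_euclidean_iff[OF smooth_atlas_prod[OF smooth_atlas_euclidean MA] open_UNIV]
  proof (intro iffI ballI; clarify)
    fix U \<phi> assume all: "\<forall>(W, \<theta>)\<in>?A. Cinf_on (\<theta> ` (W \<inter> UNIV)) (q \<circ> inv_into W \<theta>)" and U: "(U, \<phi>) \<in> MA"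
    have "(UNIV \<times> U, map_prod id \<phi>) \<in> ?A" using U by (auto simp: prod_atlas_def euclidean_atlas_def)
    with all chart[OF U] show "Cinf_on (UNIV \<times> \<phi> ` U) (\<lambda>y. q (fst y, inv_into U \<phi> (snd y)))" by blast
  next
    fix W \<theta> assume all: "\<forall>(U, \<phi>)\<in>MA. Cinf_on (UNIV \<times> \<phi> ` U) (\<lambda>y. q (fst y, inv_into U \<phi> (snd y)))" and "(W, \<theta>) \<in> ?A"
    then obtain U \<phi> where U: "(U, \<phi>) \<in> MA" "W = UNIV \<times> U" "\<theta> = map_prod id \<phi>"
      by (auto simp: prod_atlas_def euclidean_atlas_def)
    with all chart[OF U(1)] show "Cinf_on (\<theta> ` (W \<inter> UNIV)) (q \<circ> inv_into W \<theta>)" by blast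
  qed
qed

context smooth_prequantum
begin

text \<open>The integrand of \<open>\<alpha>0\<close>. The direction \<open>a\<close> comes before
  the point so that \<open>conn_vel F a\<close> is itself a family of functions on \<open>M\<close>,
  ready for differentiation under the integral.\<close>

definition conn_vel :: "(plane \<Rightarrow> 'm \<Rightarrow> 'p) \<Rightarrow> plane \<Rightarrow> plane \<Rightarrow> 'm \<Rightarrow> real" where
  "conn_vel F a u x = conn B (F u x) (family_vel PA F u a x)"

lemma smooth_conn_vel:
  fixes MA :: "('m::topological_space, 'e::euclidean_space) atlas"
  assumes MA: "smooth_atlas MA" and F: "smooth_map (prod_atlas euclidean_atlas MA) PA (\<lambda>(u, x). F u x)"
  shows "smooth_function (prod_atlas euclidean_atlas MA) (\<lambda>(u, x). conn_vel F a u x)"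
proof -
  {
  fix U \<phi> assume U: "(U, \<phi>) \<in> MA"
  let ?X = "(UNIV :: plane set) \<times> \<phi> ` U"
  have o: "open ?X" using smooth_atlasD(2)[OF MA U] by (simp add: open_Times)
  let ?G = "\<lambda>y. F (fst y) (inv_into U \<phi> (snd y))"
  have "smooth_map_on euclidean_atlas MA ?X (\<lambda>y. inv_into U \<phi> (snd y))"
    by (rule smooth_map_on_compose[OF smooth_atlas_euclidean smooth_atlas_euclidean MA o smooth_atlasD(2)[OF MA U] _ _
          smooth_map_on_chart_inverse[OF MA U]])
      (auto simp: smooth_map_on_Cinf_on[OF o] intro: Cinf_on_linear bounded_linear_snd o)
  then have G: "smooth_map_on euclidean_atlas PA ?X ?G"
    by (rule family_compose[OF MA total_atlas F o Cinf_on_linear[OF bounded_linear_fst o]])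
  \<comment> \<open>The direction \<open>(a, 0)\<close> moves the parameter and holds the point of
    \<open>M\<close> fixed.\<close>
  from Cinf_on_form1_along[OF total_atlas conn_form o G, of "(a, 0)"]
  have "Cinf_on ?X (\<lambda>y. conn_vel F a (fst y) (inv_into U \<phi> (snd y)))"
    by (simp add: conn_vel_def family_vel_def)
  }
  then show ?thesis unfolding smooth_map_prod_chart[OF MA] by auto
qed

lemma smooth_conn_vel_at:
  fixes MA :: "('m::topological_space, 'e::euclidean_space) atlas"
  assumes MA: "smooth_atlas MA" and F: "smooth_map (prod_atlas euclidean_atlas MA) PA (\<lambda>(u, x). F u x)"
  shows "smooth_function MA (conn_vel F a u)"
proof -
  have "smooth_map MA (prod_atlas euclidean_atlas MA) (\<lambda>x. (u, x))"
    by (intro smooth_map_on_Pair MA smooth_atlas_euclidean open_UNIV smooth_map_on_const smooth_map_on_id)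
  from smooth_map_on_compose[OF MA smooth_atlas_prod[OF smooth_atlas_euclidean MA] smooth_atlas_euclidean
      open_UNIV open_UNIV subset_UNIV this smooth_conn_vel[OF MA F, of a]]
  show ?thesis by simp
qed

lemma family_vel_in_tangent:
  fixes MA :: "('m::topological_space, 'e::euclidean_space) atlas"
  assumes MA: "smooth_atlas MA" and F: "smooth_map (prod_atlas euclidean_atlas MA) PA (\<lambda>(u, x). F u x)"
  shows "family_vel PA F u a x \<in> tangent PA (F u x)"
proof -
  have "smooth_map euclidean_atlas PA (\<lambda>u. F u x)"
    by (rule family_compose[OF MA total_atlas F open_UNIV Cinf_on_linear[OF bounded_linear_ident open_UNIV] smooth_map_on_const])
  from velocity_along_in_tangent[OF total_atlas open_UNIV this UNIV_I, of u a]
  show ?thesis by (simp add: family_vel_def)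
qed

lemma tmap_proj_family_vel:
  "tmap SA (proj B) (F u x) (family_vel PA F u a x) = family_vel SA (\<lambda>u. proj B \<circ> F u) u a x"
  using tmap_velocity[OF total_atlas base_atlas smooth_proj, of "\<lambda>t. F (u + t *\<^sub>R a) x"]
  by (simp add: family_vel_def)

text \<open>The structure equation with \<open>x\<close> fixed and only the parameter moving: it
  makes the integrand of \<open>\<omega>0\<close> the exterior derivative, on the plane, of the
  integrand of \<open>\<alpha>0\<close>.\<close>

lemma symp_family_vel:
  fixes MA :: "('m::topological_space, 'e::euclidean_space) atlas"
  assumes MA: "smooth_atlas MA" and F: "smooth_map (prod_atlas euclidean_atlas MA) PA (\<lambda>(u, x). F u x)"
  shows "symp B (proj B (F u x)) (family_vel SA (\<lambda>u. proj B \<circ> F u) u a x) (family_vel SA (\<lambda>u. proj B \<circ> F u) u b x) =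
    frechet_derivative (\<lambda>u. conn_vel F b u x) (at u) a - frechet_derivative (\<lambda>u. conn_vel F a u x) (at u) b"
proof -
  have "smooth_map euclidean_atlas PA (\<lambda>u. F u x)"
    by (rule family_compose[OF MA total_atlas F open_UNIV Cinf_on_linear[OF bounded_linear_ident open_UNIV] smooth_map_on_const])
  from ext_deriv_along[OF total_atlas conn_form curvature open_UNIV this UNIV_I, of u a b]
  show ?thesis
    unfolding conn_vel_def tmap_proj_family_vel[symmetric] by (simp add: family_vel_def)
qed

text \<open>The structure equation on the surface \<open>(s, t) \<mapsto> F (u + s a) (\<gamma> t)\<close>, whose \<open>t\<close>-curves are horizontal.\<close>

lemma symp_family_vel_tangential:
  fixes MA :: "('m::topological_space, 'e::euclidean_space) atlas"
  assumes MA: "smooth_atlas MA" and F: "F \<in> families MA PA (Emb_hor MA B)" and w: "w \<in> tangent MA x"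
  shows "symp B (proj B (F u x)) (tmap SA (proj B) (F u x) (family_vel PA F u a x)) (tmap SA (proj B \<circ> F u) x w) =
    w (\<lambda>x. (- 1) * conn_vel F a u x)"
proof -
  have Fs: "smooth_map (prod_atlas euclidean_atlas MA) PA (\<lambda>(u, x). F u x)" and hor: "\<And>u. F u \<in> Emb_hor MA B"
    using F unfolding families_def by blast+
  have Fu: "smooth_map MA PA (F u)" for u using hor[of u] by (simp add: Emb_hor_def embedding_def)
  obtain \<gamma> where \<gamma>: "smooth_map euclidean_atlas MA \<gamma>" "\<gamma> 0 = x" "w = velocity MA \<gamma>"
    using w by (auto simp: tangent_def)
  let ?G = "\<lambda>y :: real \<times> real. F (u + fst y *\<^sub>R a) (\<gamma> (snd y))"
  have lin: "Cinf_on UNIV (\<lambda>y :: real \<times> real. u + fst y *\<^sub>R a)"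
    by (intro Cinf_on_add Cinf_on_const Cinf_on_linear open_UNIV bounded_linear_scaleR_const bounded_linear_fst)
  have "smooth_map euclidean_atlas MA (\<lambda>y :: real \<times> real. \<gamma> (snd y))"
    by (rule smooth_map_on_compose[OF smooth_atlas_euclidean smooth_atlas_euclidean MA open_UNIV open_UNIV subset_UNIV _ \<gamma>(1)])
      (simp add: smooth_map_on_Cinf_on Cinf_on_linear bounded_linear_snd)
  then have G: "smooth_map euclidean_atlas PA ?G"
    by (rule family_compose[OF MA total_atlas Fs open_UNIV lin])
  let ?v = "\<lambda>y d. velocity PA (\<lambda>t. ?G (y + t *\<^sub>R d))"
  have v2: "?v y (0, 1) = tmap PA (F (u + fst y *\<^sub>R a)) (\<gamma> (snd y)) (velocity MA (\<lambda>t. \<gamma> (snd y + t)))" for y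
    using tmap_velocity[OF MA total_atlas Fu, of "u + fst y *\<^sub>R a" "\<lambda>t. \<gamma> (snd y + t)"] by simp
  have "velocity MA (\<lambda>t. \<gamma> (s + t)) \<in> tangent MA (\<gamma> s)" for s
    using velocity_along_in_tangent[OF MA open_UNIV \<gamma>(1) UNIV_I, of s 1] by simp
  \<comment> \<open>Needed at every \<open>y\<close>, because the structure equation differentiates
    this function; it vanishes identically, so one of the two terms drops out.\<close>
  then have c2: "conn B (?G y) (?v y (0, 1)) = 0" for y
    unfolding v2 using hor by (simp add: Emb_hor_def)
  have v1: "?v y (1, 0) = family_vel PA F (u + fst y *\<^sub>R a) a (\<gamma> (snd y))" for y
    by (simp add: family_vel_def algebra_simps)
  let ?q = "\<lambda>y. conn B (?G y) (?v y (1, 0))"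
  have q: "?q y = conn_vel F a (u + fst y *\<^sub>R a) (\<gamma> (snd y))" for y
    unfolding v1 conn_vel_def ..
  have "(?q has_derivative frechet_derivative ?q (at 0)) (at 0)"
    by (rule Cinf_on_has_derivative[OF Cinf_on_form1_along[OF total_atlas conn_form open_UNIV G] UNIV_I])
  then have "((\<lambda>t. ?q (0 + t *\<^sub>R (0, 1))) has_real_derivative frechet_derivative ?q (at 0) (0, 1)) (at 0)"
    by (rule has_derivative_along)
  then have "((\<lambda>t. conn_vel F a u (\<gamma> t)) has_real_derivative frechet_derivative ?q (at 0) (0, 1)) (at 0)"
    unfolding q by simp
  from DERIV_cmult[OF this, of "- 1"]
  have "((\<lambda>t. (- 1) * conn_vel F a u (\<gamma> t)) has_real_derivative (- 1) * frechet_derivative ?q (at 0) (0, 1)) (at 0)" .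
  moreover have "smooth_at MA x (\<lambda>x. (- 1) * conn_vel F a u x)"
    by (rule smooth_at_smooth_map_on[OF _ open_UNIV UNIV_I])
      (intro smooth_map_on_mult[OF MA open_UNIV] smooth_map_on_const smooth_conn_vel_at[OF MA Fs])
  ultimately have w: "w (\<lambda>x. (- 1) * conn_vel F a u x) = (- 1) * frechet_derivative ?q (at 0) (0, 1)"
    by (simp only: \<gamma>(2,3) velocity_def DERIV_imp_deriv if_True)
  have "?v 0 (0, 1) = tmap PA (F u) x w"
    unfolding v2 by (simp add: \<gamma>(2,3))
  moreover have "tmap SA (proj B) (F u x) (tmap PA (F u) x w) = tmap SA (proj B \<circ> F u) x w"
    by (rule tmap_tmap[OF total_atlas base_atlas smooth_proj])
  moreover have "?v 0 (1, 0) = family_vel PA F u a x"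
    unfolding v1 by (simp add: \<gamma>(2))
  ultimately show ?thesis
    using ext_deriv_along[OF total_atlas conn_form curvature open_UNIV G UNIV_I, of 0 "(1, 0)" "(0, 1)"]
    unfolding c2 w by (simp add: \<gamma>(2))
qed

lemma velocity_represented:
  fixes MA :: "('m::topological_space, 'e::euclidean_space) atlas"
  assumes MA: "smooth_atlas MA" and "compact (UNIV :: 'm set)" and dim: "2 * DIM('e) = DIM('f)"
    and F: "F \<in> families MA PA (Emb_hor MA B)"
  obtains h where "represents MA B (F u) (family_vel PA F u a) h" "\<And>x. h (proj B (F u x)) = - conn_vel F a u x"
proof -
  have Fs: "smooth_map (prod_atlas euclidean_atlas MA) PA (\<lambda>(u, x). F u x)" and hor: "F u \<in> Emb_hor MA B"
    using F unfolding families_def by blast+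
  have Fu: "smooth_map MA PA (F u)" using hor by (simp add: Emb_hor_def embedding_def)
  let ?f = "proj B \<circ> F u"
  have lag: "?f \<in> Emb_Lag MA B" using hor by (simp add: Emb_hor_def)
  then have emb: "embedding MA SA ?f" by (simp add: Emb_Lag_def)
  then have fs: "smooth_map MA SA ?f" by (simp add: embedding_def)
  have "smooth_function MA (\<lambda>x. (- 1) * conn_vel F a u x)"
    by (intro smooth_map_on_mult[OF MA open_UNIV] smooth_map_on_const smooth_conn_vel_at[OF MA Fs])
  from embedding_extends_smooth_function[OF MA base_atlas emb \<open>compact UNIV\<close> this]
  obtain h where h: "smooth_function SA h" "\<And>x. h (?f x) = (- 1) * conn_vel F a u x" by blast
  have "\<exists>w\<in>tangent MA x. family_vel PA F u a x = (\<lambda>g. xi B h (F u x) g + tmap PA (F u) x w g)" for x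
  proof -
    let ?y = "F u x" and ?v = "family_vel PA F u a x"
    let ?X = "ham_field B h (proj B ?y)"
    have v: "?v \<in> tangent PA ?y" by (rule family_vel_in_tangent[OF MA Fs])
    have X: "?X \<in> tangent SA (proj B ?y)" by (rule ham_field(1)[OF h(1)])
    have pv: "tmap SA (proj B) ?y ?v \<in> tangent SA (proj B ?y)"
      by (rule tmap_in_tangent[OF total_atlas base_atlas smooth_proj v])
    obtain w where w: "w \<in> tangent MA x" "(\<lambda>g. tmap SA (proj B) ?y ?v g - ?X g) = tmap SA ?f x w"
    proof (rule lagrangian_maximal[OF MA lag dim, where v = "\<lambda>g. tmap SA (proj B) ?y ?v g - ?X g" and x = x])
      show "(\<lambda>g. tmap SA (proj B) ?y ?v g - ?X g) \<in> tangent SA (?f x)"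
        using tangent_diff[OF base_atlas pv X] by simp
      fix w assume w: "w \<in> tangent MA x"
      have tw: "tmap SA ?f x w \<in> tangent SA (proj B ?y)"
        using tmap_in_tangent[OF MA base_atlas fs w] by simp
      \<comment> \<open>\<open>tmap\<close> evaluates \<open>w\<close> on
        \<open>h \<circ> ?f\<close>, so pairing \<open>X_h\<close> with the submanifold gives the
        differential of \<open>- \<alpha>(v)\<close>. The structure equation gives the same for
        \<open>Tp v\<close>, and the difference is orthogonal.\<close>
      have "h \<circ> ?f = (\<lambda>x. (- 1) * conn_vel F a u x)" using h(2) by (simp add: fun_eq_iff)
      then have "symp B (proj B ?y) ?X (tmap SA ?f x w) = w (\<lambda>x. (- 1) * conn_vel F a u x)"
        using ham_field(2)[OF h(1) tw] smooth_at_smooth_map_on[OF h(1) open_UNIV UNIV_I, of "?f x"]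
        by (simp only: tmap_def if_True)
      then show "symp B (?f x) (\<lambda>g. tmap SA (proj B) ?y ?v g - ?X g) (tmap SA ?f x w) = 0"
        using smooth_form2_lincomb_left[OF base_atlas symp_form pv X tw, of 1 "-1"]
          symp_family_vel_tangential[OF MA F w, of u a] by simp
    qed (rule that)
    \<comment> \<open>\<open>r\<close> is the error in the desired decomposition of the velocity.
      Its projection vanishes by the choice of \<open>w\<close>, and its connection value
      \<open>\<alpha>(v) + h\<close> by the choice of \<open>h\<close>.\<close>
    define r where "r = (\<lambda>g. (?v g - xi B h ?y g) - tmap PA (F u) x w g)"
    let ?L = "hor_lift B ?y ?X"
    note L = hor_lift[OF X]
    have xi: "xi B h ?y = (\<lambda>g. 1 * ?L g + (- h (proj B ?y)) * gen ?y g)" by (simp add: xi_def)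
    have xt: "xi B h ?y \<in> tangent PA ?y"
      unfolding xi by (rule tangent_lincomb[OF total_atlas L(1) generator_in_tangent])
    have xc: "conn B ?y (xi B h ?y) = - h (proj B ?y)"
      unfolding xi by (subst smooth_form1_lincomb[OF conn_form L(1) generator_in_tangent]) (simp add: L(2) conn_generator)
    have xp: "tmap SA (proj B) ?y (xi B h ?y) = ?X"
      unfolding xi tmap_lincomb by (simp add: L(3) tmap_generator)
    have wt: "tmap PA (F u) x w \<in> tangent PA ?y" by (rule tmap_in_tangent[OF MA total_atlas Fu w(1)])
    have wc: "conn B ?y (tmap PA (F u) x w) = 0" using hor w(1) by (simp add: Emb_hor_def)
    have wp: "tmap SA (proj B) ?y (tmap PA (F u) x w) = tmap SA ?f x w"
      by (rule tmap_tmap[OF total_atlas base_atlas smooth_proj])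
    have vx: "(\<lambda>g. ?v g - xi B h ?y g) \<in> tangent PA ?y" by (rule tangent_diff[OF total_atlas v xt])
    have "r = (\<lambda>_. 0)"
    proof (rule tangent_eq_0)
      show "r \<in> tangent PA ?y" unfolding r_def by (rule tangent_diff[OF total_atlas vx wt])
      have "conn B ?y r = (conn B ?y ?v - conn B ?y (xi B h ?y)) - conn B ?y (tmap PA (F u) x w)"
        unfolding r_def smooth_form1_diff[OF conn_form vx wt] smooth_form1_diff[OF conn_form v xt] ..
      then show "conn B ?y r = 0" using h(2)[of x] by (simp add: xc wc conn_vel_def)
      show "tmap SA (proj B) ?y r = (\<lambda>_. 0)"
        unfolding r_def tmap_diff xp wp w(2)[symmetric] by simp
    qed
    then have "?v = (\<lambda>g. xi B h ?y g + tmap PA (F u) x w g)"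
      by (simp add: r_def fun_eq_iff algebra_simps)
    then show ?thesis using w(1) by blast
  qed
  then show ?thesis using h by (intro that[of h]) (auto simp: represents_def)
qed

end

section \<open>Differentiation under the integral\<close>

text \<open>In a chart of \<open>M\<close> the derivative in the parameter is a partial derivative
  of a jointly smooth function, hence continuous in both variables.\<close>

lemma frechet_derivative_prod_continuous:
  fixes MA :: "('m::topological_space, 'e::euclidean_space) atlas" and q :: "plane \<Rightarrow> 'm \<Rightarrow> real"
  assumes MA: "smooth_atlas MA" and q: "smooth_function (prod_atlas euclidean_atlas MA) (\<lambda>(u, x). q u x)"
  shows "((\<lambda>u. q u x) has_derivative frechet_derivative (\<lambda>u. q u x) (at u)) (at u)"
    and "continuous_on UNIV (\<lambda>(u, x). frechet_derivative (\<lambda>u. q u x) (at u) a)"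
proof -
  have chart: "((\<lambda>u. q u x) has_derivative (\<lambda>a. frechet_derivative (\<lambda>y. q (fst y) (inv_into U \<phi> (snd y))) (at (u, \<phi> x)) (a, 0))) (at u)"
    if U: "(U, \<phi>) \<in> MA" "x \<in> U" for U \<phi> x u
  proof -
    let ?q = "\<lambda>y. q (fst y) (inv_into U \<phi> (snd y))"
    have "Cinf_on (UNIV \<times> \<phi> ` U) ?q"
      using q U(1) unfolding smooth_map_prod_chart[OF MA] by auto
    then have "(?q has_derivative frechet_derivative ?q (at (u, \<phi> x))) (at (u, \<phi> x))"
      by (rule Cinf_on_has_derivative) (use U(2) in auto)
    moreover have "((\<lambda>u. (u, \<phi> x)) has_derivative (\<lambda>a. (a, 0))) (at u)"
      by (auto intro!: derivative_eq_intros)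
    ultimately have "((\<lambda>u. ?q (u, \<phi> x)) has_derivative (\<lambda>a. frechet_derivative ?q (at (u, \<phi> x)) (a, 0))) (at u)"
      by (rule has_derivative_compose[rotated])
    then show ?thesis using U(2) smooth_atlasD(3)[OF MA U(1)] by simp
  qed
  show "((\<lambda>u. q u x) has_derivative frechet_derivative (\<lambda>u. q u x) (at u)) (at u)"
  proof -
    obtain U \<phi> where "(U, \<phi>) \<in> MA" "x \<in> U" using smooth_atlas_chart[OF MA] .
    from chart[OF this, of u] show ?thesis by (simp add: frechet_derivative_at[OF chart[OF \<open>(U, \<phi>) \<in> MA\<close> \<open>x \<in> U\<close>], symmetric])
  qed
  show "continuous_on UNIV (\<lambda>(u, x). frechet_derivative (\<lambda>u. q u x) (at u) a)"
  proof (rule continuous_on_local, clarify)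
    fix u :: plane and x :: 'm
    obtain U \<phi> where U: "(U, \<phi>) \<in> MA" "x \<in> U" using smooth_atlas_chart[OF MA] .
    let ?q = "\<lambda>y. q (fst y) (inv_into U \<phi> (snd y))"
    have "Cinf_on (UNIV \<times> \<phi> ` U) ?q"
      using q U(1) unfolding smooth_map_prod_chart[OF MA] by auto
    then have c: "continuous_on (UNIV \<times> \<phi> ` U) (\<lambda>y. frechet_derivative ?q (at y) (a, 0))"
      by (intro Cinf_on_imp_continuous_on Cinf_on_frechet_derivative)
    have eq: "frechet_derivative ?q (at (v, \<phi> z)) (a, 0) = frechet_derivative (\<lambda>u. q u z) (at v) a" if "z \<in> U" for v z
      by (simp add: frechet_derivative_at[OF chart[OF U(1) that], symmetric])
    have "continuous_on (UNIV \<times> U) (\<lambda>z :: plane \<times> 'm. (fst z, \<phi> (snd z)))"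
      by (intro continuous_on_Pair continuous_on_compose2[OF smooth_atlasD(4)[OF MA U(1)]]
          continuous_on_fst continuous_on_snd continuous_on_id) auto
    then have "continuous_on (UNIV \<times> U) (\<lambda>z :: plane \<times> 'm. frechet_derivative ?q (at (fst z, \<phi> (snd z))) (a, 0))"
      by (rule continuous_on_compose2[OF c]) auto
    then have "continuous_on (UNIV \<times> U) (\<lambda>(u, x). frechet_derivative (\<lambda>u. q u x) (at u) a)"
      by (rule continuous_on_eq) (auto simp: eq)
    moreover have "open ((UNIV :: plane set) \<times> U)" using smooth_atlasD(1)[OF MA U(1)] by (simp add: open_Times)
    ultimately show "\<exists>V. open V \<and> (u, x) \<in> V \<and> continuous_on V (\<lambda>(u, x). frechet_derivative (\<lambda>u. q u x) (at u) a)"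
      using U(2) by blast
  qed
qed

lemma integrable_continuous_compact:
  fixes g :: "'m::topological_space \<Rightarrow> real"
  assumes "compact (UNIV :: 'm set)" "finite_measure \<mu>" "sets \<mu> = sets borel" "continuous_on UNIV g"
  shows "integrable \<mu> g"
proof -
  obtain K where "\<And>x. \<bar>g x\<bar> \<le> K"
    using compact_imp_bounded[OF compact_continuous_image[OF assms(4,1)]] by (auto simp: bounded_iff)
  then show ?thesis
    using borel_measurable_continuous_onI[OF assms(4)] assms(3)
    by (intro finite_measure.integrable_const_bound[OF assms(2), of _ K]) (auto cong: measurable_cong_sets)
qed

text \<open>Differentiability of the integral enters through \<open>D\<close>; what remains is its
  value along the line \<open>u + t a\<close>, found by dominated convergence of difference
  quotients.\<close>

lemma frechet_derivative_integral:
  fixes MA :: "('m::topological_space, 'e::euclidean_space) atlas" and q :: "plane \<Rightarrow> 'm \<Rightarrow> real"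
  assumes MA: "smooth_atlas MA" and M: "compact (UNIV :: 'm set)" and \<mu>: "finite_measure \<mu>" "sets \<mu> = sets borel"
    and q: "smooth_function (prod_atlas euclidean_atlas MA) (\<lambda>(u, x). q u x)"
    and D: "((\<lambda>u. \<integral>x. q u x \<partial>\<mu>) has_derivative D) (at u)"
  shows "D a = (\<integral>x. frechet_derivative (\<lambda>u. q u x) (at u) a \<partial>\<mu>)"
    and "integrable \<mu> (\<lambda>x. frechet_derivative (\<lambda>u. q u x) (at u) a)"
proof -
  define r where "r u x = frechet_derivative (\<lambda>u. q u x) (at u) a" for u x
  have r: "continuous_on UNIV (\<lambda>(u, x). r u x)"
    unfolding r_def by (rule frechet_derivative_prod_continuous(2)[OF MA q])
  have rx: "continuous_on UNIV (r u)" for u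
    using continuous_on_compose2[OF r, of UNIV "\<lambda>x. (u, x)"] by (simp add: continuous_on_Pair)
  have qx: "continuous_on UNIV (q u)" for u
    using continuous_on_compose2[OF smooth_map_on_continuous[OF q], of UNIV "\<lambda>x. (u, x)"]
    by (simp add: continuous_on_Pair)
  show "integrable \<mu> (\<lambda>x. frechet_derivative (\<lambda>u. q u x) (at u) a)"
    using integrable_continuous_compact[OF M \<mu> rx] by (simp add: r_def[abs_def])
  \<comment> \<open>The derivative is bounded on the compact product of [-1, 1] and
    \<open>M\<close>; by the mean value inequality the bound \<open>K\<close> dominates all
    difference quotients with \<open>t\<close> in that interval.\<close>
  have "continuous_on ({-1..1} \<times> UNIV) (\<lambda>z :: real \<times> 'm. (\<lambda>(u, x). r u x) (u + fst z *\<^sub>R a, snd z))"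
    by (rule continuous_on_compose2[OF r]) (auto intro!: continuous_intros)
  from compact_imp_bounded[OF compact_continuous_image[OF this compact_Times[OF compact_Icc M]]]
  obtain K where "\<forall>y\<in>(\<lambda>z. (\<lambda>(u, x). r u x) (u + fst z *\<^sub>R a, snd z)) ` ({-1..1} \<times> (UNIV :: 'm set)). norm y \<le> K"
    unfolding bounded_iff by blast
  then have K: "\<bar>r (u + t *\<^sub>R a) x\<bar> \<le> K" if "t \<in> {-1..1}" for t x
    using that by force
  have qd: "((\<lambda>t. q (u + t *\<^sub>R a) x) has_real_derivative r (u + t *\<^sub>R a) x) (at t)" for t x
  proof -
    have "((\<lambda>u. q u x) has_derivative frechet_derivative (\<lambda>u. q u x) (at (u + t *\<^sub>R a))) (at (u + t *\<^sub>R a))"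
      by (rule frechet_derivative_prod_continuous(1)[OF MA q])
    from has_derivative_along[OF this, of a]
    show ?thesis
      using DERIV_shift[of "\<lambda>t. q (u + t *\<^sub>R a) x" "r (u + t *\<^sub>R a) x" 0 t]
      by (simp add: r_def algebra_simps)
  qed
  have bound: "\<bar>(q (u + t *\<^sub>R a) x - q u x) / t\<bar> \<le> K" if t: "t \<in> {-1..1}" "t \<noteq> 0" for t x
  proof -
    have "norm (q (u + t *\<^sub>R a) x - q (u + 0 *\<^sub>R a) x) \<le> K * norm (t - 0)"
      by (rule field_differentiable_bound[of "{-1..1}" _ "\<lambda>t. r (u + t *\<^sub>R a) x"])
        (use t K in \<open>auto intro: has_field_derivative_at_within[OF qd]\<close>)
    then show ?thesis using t by (simp add: field_simps)
  qed
  define Q where "Q t = (\<integral>x. q (u + t *\<^sub>R a) x \<partial>\<mu>)" for t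
  have meas: "(\<lambda>x. (q (u + t *\<^sub>R a) x - q u x) / t) \<in> borel_measurable \<mu>" for t
    using borel_measurable_continuous_onI[OF qx] \<mu>(2) by (auto cong: measurable_cong_sets)
  have "((\<lambda>t. (Q t - Q 0) / t) \<longlongrightarrow> (\<integral>x. r u x \<partial>\<mu>)) (at 0 within {-1..1})"
    unfolding tendsto_at_iff_sequentially
  proof (intro allI impI)
    fix X :: "nat \<Rightarrow> real" assume X: "\<forall>i. X i \<in> {-1..1} - {0}" "X \<longlonglongrightarrow> 0"
    have "(\<lambda>i. \<integral>x. (q (u + X i *\<^sub>R a) x - q u x) / X i \<partial>\<mu>) \<longlonglongrightarrow> (\<integral>x. r u x \<partial>\<mu>)"
    proof (rule integral_dominated_convergence[where w = "\<lambda>_. K"])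
      show "r u \<in> borel_measurable \<mu>"
        using borel_measurable_continuous_onI[OF rx] \<mu>(2) by (auto cong: measurable_cong_sets)
      show "integrable \<mu> (\<lambda>_. K)" by (rule finite_measure.integrable_const[OF \<mu>(1)])
      show "AE x in \<mu>. (\<lambda>i. (q (u + X i *\<^sub>R a) x - q u x) / X i) \<longlonglongrightarrow> r u x"
      proof (rule AE_I2)
        fix x
        have "((\<lambda>t. (q (u + t *\<^sub>R a) x - q u x) / t) \<longlongrightarrow> r u x) (at 0)"
          using qd[of x 0] by (simp add: DERIV_def)
        moreover have "filterlim X (at 0) sequentially"
          using X by (auto simp: filterlim_at)
        ultimately show "(\<lambda>i. (q (u + X i *\<^sub>R a) x - q u x) / X i) \<longlonglongrightarrow> r u x"
          by (rule filterlim_compose)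
      qed
      show "AE x in \<mu>. norm ((q (u + X i *\<^sub>R a) x - q u x) / X i) \<le> K" for i
        using X(1) bound by auto
    qed (rule meas)
    moreover have "(\<integral>x. (q (u + X i *\<^sub>R a) x - q u x) / X i \<partial>\<mu>) = (Q (X i) - Q 0) / X i" for i
      using integrable_continuous_compact[OF M \<mu> qx] by (simp add: Q_def)
    ultimately show "((\<lambda>t. (Q t - Q 0) / t) \<circ> X) \<longlonglongrightarrow> (\<integral>x. r u x \<partial>\<mu>)"
      by (simp only: o_def)
  qed
  then have "(Q has_real_derivative (\<integral>x. r u x \<partial>\<mu>)) (at 0)"
    by (simp add: DERIV_def at_within_Icc_at)
  moreover have "(Q has_real_derivative D a) (at 0)"
    unfolding Q_def by (rule has_derivative_along[OF D])
  ultimately show "D a = (\<integral>x. frechet_derivative (\<lambda>u. q u x) (at u) a \<partial>\<mu>)"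
    using DERIV_unique by (auto simp: r_def)
qed

section \<open>Weighted submanifolds\<close>

lemma dens_push_push:
  assumes "continuous_on UNIV p"
  shows "dens_push p (push \<mu> F \<rho>) = push \<mu> (p \<circ> F) \<rho>"
proof -
  have "k \<circ> p \<in> borel_measurable borel" if "k \<in> borel_measurable borel" for k :: "_ \<Rightarrow> real"
    using measurable_comp[OF borel_measurable_continuous_onI[OF assms] that] .
  then show ?thesis by (auto simp: dens_push_def push_def fun_eq_iff)
qed

lemma dens_total_push: "dens_total (push \<mu> F \<rho>) = (\<integral>x. \<rho> x \<partial>\<mu>)"
  by (simp add: dens_total_def push_def)

text \<open>Densities on the base are paired with functions on all of it; with \<open>j\<close> a
  section over \<open>L\<close>, this turns a Borel test function upstairs into one on the
  base.\<close>

lemma borel_measurable_extend_zero: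
  fixes L :: "'s::topological_space set" and j :: "'s \<Rightarrow> 'p::topological_space" and k :: "'p \<Rightarrow> real"
  assumes "closed L" "continuous_on L j" "k \<in> borel_measurable borel"
  shows "(\<lambda>s. if s \<in> L then k (j s) else 0) \<in> borel_measurable borel"
proof -
  have "(\<lambda>s. k (j s)) \<in> borel_measurable (restrict_space borel L)"
    using measurable_comp[OF borel_measurable_continuous_on_restrict[OF assms(2)] assms(3)] by (simp add: o_def)
  then show ?thesis
    using assms(1) by (simp add: measurable_restrict_space_iff[of L borel 0] borel_closed)
qed

section \<open>Transport of volumes from \<open>Q\<close> to \<open>p(Q)\<close>, and the comparison
  of plots and forms\<close>

context smooth_prequantum
begin

lemma proj_continuous: "continuous_on UNIV (proj B)"
  by (rule smooth_map_on_continuous[OF smooth_proj])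

lemma level_ident_image: "level_ident B (range F, push \<mu> F \<rho>) = (range F, push \<mu> (proj B \<circ> F) \<rho>)"
  by (simp add: level_ident_def dens_push_push[OF proj_continuous])

lemma Gr_proj_image: "Gr_proj B (range F, push \<mu> F \<rho>) = (range (proj B \<circ> F), push \<mu> (proj B \<circ> F) \<rho>)"
  by (simp add: Gr_proj_def dens_push_push[OF proj_continuous] image_comp)

text \<open>On the image of \<open>F\<close> the projection has the continuous inverse
  \<open>F \<circ> g\<close>. Hence each test function on \<open>P\<close> agrees there with the
  pullback of a Borel function on the base, and the density downstairs determines the one
  upstairs.\<close>

lemma level_ident_inj:
  fixes MA :: "('m::topological_space, 'e::euclidean_space) atlas"
  assumes M: "compact (UNIV :: 'm set)" and F: "F \<in> Emb_hor MA B"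
    and range: "range F = range F'"
    and eq: "push \<mu> (proj B \<circ> F) \<rho> = push \<mu> (proj B \<circ> F') \<rho>'"
  shows "push \<mu> F \<rho> = push \<mu> F' \<rho>'"
proof
  fix k :: "'p \<Rightarrow> real"
  let ?f = "proj B \<circ> F"
  have Fc: "continuous_on UNIV F"
    using F by (auto simp: Emb_hor_def embedding_def dest: smooth_map_on_continuous)
  obtain g where g: "homeomorphism UNIV (range ?f) ?f g"
    using F by (auto simp: Emb_hor_def Emb_Lag_def embedding_def)
  have "compact (range ?f)"
    using g M by (metis compact_continuous_image homeomorphism_def)
  then have "closed (range ?f)" by (rule compact_imp_closed)
  have j: "continuous_on (range ?f) (\<lambda>s. F (g s))"
    using g Fc by (intro continuous_on_compose2[OF Fc]) (auto simp: homeomorphism_def)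
  let ?k = "\<lambda>s. if s \<in> range ?f then k (F (g s)) else 0"
  have kF: "?k (?f x) = k (F x)" for x
    using g by (simp add: homeomorphism_def)
  \<comment> \<open>Both maps have the same image, so \<open>F' x\<close> is some \<open>F y\<close>
    and the identity for \<open>F\<close> applies.\<close>
  have kF': "?k ((proj B \<circ> F') x) = k (F' x)" for x
  proof -
    obtain y where "F' x = F y" using range by (metis rangeE rangeI)
    then show ?thesis using kF[of y] by simp
  qed
  show "push \<mu> F \<rho> k = push \<mu> F' \<rho>' k"
  proof (cases "k \<in> borel_measurable borel")
    case True
    have "?k \<in> borel_measurable borel"
      by (rule borel_measurable_extend_zero[OF \<open>closed (range ?f)\<close> j True])
    then show ?thesis
      using fun_cong[OF eq, of ?k] True unfolding push_def kF kF' by simp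
  qed (simp add: push_def)
qed

text \<open>One weight \<rho> describes both a volume on \<open>Q\<close> and its transport to
  \<open>p(Q)\<close>, with equal totals; total mass 1 of \<mu> selects the level one of the
  momentum map.\<close>

lemma level_ident_bij_betw:
  fixes MA :: "('m::topological_space, 'e::euclidean_space) atlas"
  assumes M: "compact (UNIV :: 'm set)" and \<mu>: "measure \<mu> UNIV = 1"
  shows "bij_betw (level_ident B) (Gr_hor MA \<mu> B) (J_level_one MA \<mu> B)"
  unfolding bij_betw_def
proof
  show "inj_on (level_ident B) (Gr_hor MA \<mu> B)"
  proof (rule inj_onI)
    fix q q' assume "q \<in> Gr_hor MA \<mu> B" "q' \<in> Gr_hor MA \<mu> B" and eq: "level_ident B q = level_ident B q'"
    then obtain F \<rho> F' \<rho>' where q: "F \<in> Emb_hor MA B" "q = (range F, push \<mu> F \<rho>)" "q' = (range F', push \<mu> F' \<rho>')"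
      by (auto simp: Gr_weighted_def Vol_def)
    with eq level_ident_inj[OF M q(1), of F' \<mu> \<rho> \<rho>'] show "q = q'"
      by (simp add: level_ident_image)
  qed
  show "level_ident B ` Gr_hor MA \<mu> B = J_level_one MA \<mu> B"
  proof (intro equalityI subsetI)
    fix \<zeta> assume "\<zeta> \<in> level_ident B ` Gr_hor MA \<mu> B"
    then obtain F \<rho> where "F \<in> Emb_hor MA B" "smooth_function MA \<rho>" "\<forall>x. \<rho> x > 0"
      "dens_total (push \<mu> F \<rho>) = measure \<mu> UNIV" "\<zeta> = (range F, push \<mu> (proj B \<circ> F) \<rho>)"
      by (auto simp: Gr_weighted_def Vol_def level_ident_image)
    then show "\<zeta> \<in> J_level_one MA \<mu> B"
      unfolding J_level_one_def cotangent_def Den_def Vol_def momentum_def by (auto simp: dens_total_push \<mu>)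
  next
    fix \<zeta> assume "\<zeta> \<in> J_level_one MA \<mu> B"
    then obtain F \<rho> where F: "F \<in> Emb_hor MA B" "smooth_function MA \<rho>" "\<forall>x. \<rho> x > 0"
      "\<zeta> = (range F, push \<mu> (proj B \<circ> F) \<rho>)" "momentum \<zeta> = 1"
      unfolding J_level_one_def Vol_def by (cases \<zeta>) auto
    then have "(range F, push \<mu> F \<rho>) \<in> Gr_hor MA \<mu> B"
      unfolding Gr_weighted_def Vol_def by (auto simp: dens_total_push \<mu> momentum_def)
    then show "\<zeta> \<in> level_ident B ` Gr_hor MA \<mu> B"
      using F(4) by (force simp: level_ident_image intro!: image_eqI)
  qed
qed

text \<open>Weighted plots push forward \<mu> itself, so all variation lies in \<open>F\<close> and
  the cotangent weight is constantly 1.\<close>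

lemma level_ident_plots:
  assumes "c \<in> Gr_hor_plots MA \<mu> B"
  obtains F where "F \<in> families MA PA (Emb_hor MA B)" "c = (\<lambda>u. weighted_image \<mu> (F u))"
    "level_ident B \<circ> c = (\<lambda>u. cotangent_vec \<mu> B (F u) (\<lambda>_. 1))"
proof -
  obtain F where "F \<in> families MA PA (Emb_hor MA B)" "c = (\<lambda>u. weighted_image \<mu> (F u))"
    using assms by (auto simp: Gr_weighted_plots_def)
  then show ?thesis
    by (intro that[of F]) (auto simp: weighted_image_def level_ident_image cotangent_vec_def fun_eq_iff)
qed

lemma const_family: "(\<lambda>_ _. 1) \<in> families MA euclidean_atlas UNIV"
  by (auto simp: families_def case_prod_unfold intro: smooth_map_on_const)

lemma proj_family:
  fixes MA :: "('m::topological_space, 'e::euclidean_space) atlas"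
  assumes MA: "smooth_atlas MA" and F: "F \<in> families MA PA (Emb_hor MA B)"
  shows "(\<lambda>u. proj B \<circ> F u) \<in> families MA SA (Emb_Lag MA B)"
proof -
  have "smooth_map (prod_atlas euclidean_atlas MA) PA (\<lambda>(u, x). F u x)" "\<forall>u. F u \<in> Emb_hor MA B"
    using F unfolding families_def by blast+
  moreover from smooth_map_on_compose[OF smooth_atlas_prod[OF smooth_atlas_euclidean MA] total_atlas base_atlas
      open_UNIV open_UNIV subset_UNIV this(1) smooth_proj]
  have "smooth_map (prod_atlas euclidean_atlas MA) SA (\<lambda>(u, x). (proj B \<circ> F u) x)"
    by (simp add: case_prod_unfold)
  ultimately show ?thesis unfolding families_def Emb_hor_def by blast
qed

lemma level_ident_plot_in_level:
  fixes MA :: "('m::topological_space, 'e::euclidean_space) atlas"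
  assumes M: "compact (UNIV :: 'm set)" and \<mu>: "measure \<mu> UNIV = 1" "space \<mu> = UNIV"
    and c: "c \<in> Gr_hor_plots MA \<mu> B"
  shows "level_ident B \<circ> c \<in> J_level_one_plots MA \<mu> B"
proof -
  obtain F where F: "F \<in> families MA PA (Emb_hor MA B)" "c = (\<lambda>u. weighted_image \<mu> (F u))"
    "level_ident B \<circ> c = (\<lambda>u. cotangent_vec \<mu> B (F u) (\<lambda>_. 1))" by (rule level_ident_plots[OF c])
  have "c u \<in> Gr_hor MA \<mu> B" for u
  proof -
    have "F u \<in> Emb_hor MA B" using F(1) unfolding families_def by blast
    moreover have "push \<mu> (F u) (\<lambda>_. 1) \<in> Vol MA \<mu> (F u)"
      unfolding Vol_def using smooth_map_on_const[of MA euclidean_atlas UNIV "1::real"] by force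
    moreover have "dens_total (push \<mu> (F u) (\<lambda>_. 1)) = measure \<mu> UNIV"
      using \<mu> by (simp add: dens_total_push)
    ultimately show ?thesis unfolding F(2) weighted_image_def Gr_weighted_def by blast
  qed
  then have "(level_ident B \<circ> c) u \<in> J_level_one MA \<mu> B" for u
    unfolding o_apply by (rule bij_betwE[OF level_ident_bij_betw[OF M \<mu>(1)], rule_format])
  moreover have "level_ident B \<circ> c \<in> cotangent_plots MA \<mu> B"
    unfolding F(3) cotangent_plots_def using F(1) const_family by force
  ultimately show ?thesis by (simp add: J_level_one_plots_def)
qed

text \<open>\<open>velocity_represented\<close> supplies an \<open>h\<close> equal to
  \<open>- \<alpha>(v)\<close> along the submanifold; its sign cancels the one in the convention for
  \<Theta>.\<close>

lemma canonical_form_eq: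
  fixes MA :: "('m::topological_space, 'e::euclidean_space) atlas"
  assumes MA: "smooth_atlas MA" and M: "compact (UNIV :: 'm set)" and dim: "2 * DIM('e) = DIM('f)"
    and \<Theta>: "is_canonical_form MA \<mu> B \<Theta>" and F: "F \<in> families MA PA (Emb_hor MA B)"
  shows "\<Theta> (\<lambda>u. cotangent_vec \<mu> B (F u) (\<lambda>_. 1)) u a = (\<integral>x. conn_vel F a u x \<partial>\<mu>)"
proof -
  obtain h where h: "represents MA B (F u) (family_vel PA F u a) h" "\<And>x. h (proj B (F u x)) = - conn_vel F a u x"
    using velocity_represented[OF MA M dim F] by blast
  have "\<Theta> (\<lambda>u. cotangent_vec \<mu> B (F u) (\<lambda>_. 1)) u a = - snd (cotangent_vec \<mu> B (F u) (\<lambda>_. 1)) h"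
    by (rule \<Theta>[unfolded is_canonical_form_def, THEN conjunct2, rule_format, OF F const_family h(1)])
  \<comment> \<open>\<open>push\<close> integrates Borel functions only and returns 0 on all
    others.\<close>
  moreover have "h \<in> borel_measurable borel"
    using h(1) unfolding represents_def by (blast intro: borel_measurable_continuous_onI smooth_map_on_continuous)
  ultimately show ?thesis
    by (simp add: cotangent_vec_def push_def h(2))
qed

end

theorem proposition5p7:
  fixes MA :: "('m::{t2_space,second_countable_topology}, 'e::euclidean_space) atlas"
    and \<mu> :: "'m measure"
    and B :: "('s::{t2_space,second_countable_topology}, 'f::euclidean_space,
               'p::{t2_space,second_countable_topology}, 'g::euclidean_space) prequantum"
    and \<alpha>0 :: "('p set \<times> 'p dens) plot_form1"
    and \<omega>0 :: "('s set \<times> 's dens) plot_form2"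
    and \<Theta> :: "('p set \<times> 's dens) plot_form1"
    and \<Omega>1 :: "('s set \<times> 's dens) plot_form2"
  assumes "smooth_atlas (base_atlas B)" and "smooth_atlas (total_atlas B)"
    and "symplectic_form (base_atlas B) (symp B)"
    and "prequantum_bundle B"
    and "smooth_atlas MA" and "compact (UNIV :: 'm set)"
    and "volume_measure MA \<mu>" and "measure \<mu> UNIV = 1"
    and "H1_zero MA"
    and "2 * DIM('e) = DIM('f)"
    and "is_alpha0 MA \<mu> B \<alpha>0"
    and "is_omega0 MA \<mu> B \<omega>0"
    and "is_canonical_form MA \<mu> B \<Theta>"
    and "is_reduced_form MA \<mu> B (plot_d \<Theta>) \<Omega>1"
  shows "(bij_betw (level_ident B) (Gr_hor MA \<mu> B) (J_level_one MA \<mu> B)) \<and>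
     (\<forall>c\<in>Gr_hor_plots MA \<mu> B. level_ident B \<circ> c \<in> J_level_one_plots MA \<mu> B) \<and>
     (\<forall>z\<in>sphere 0 1. \<forall>q\<in>Gr_hor MA \<mu> B.
           level_ident B (Gr_act B z q) = cotangent_act B z (level_ident B q)) \<and>
     (\<forall>q\<in>Gr_hor MA \<mu> B. Gr_proj B q \<in> Gr_Lag MA \<mu> B \<and>
           reduced_proj B (level_ident B q) = Gr_proj B q) \<and>
     (\<forall>c\<in>Gr_hor_plots MA \<mu> B. \<Theta> (level_ident B \<circ> c) = \<alpha>0 c) \<and>
     (\<forall>c\<in>Gr_hor_plots MA \<mu> B. \<Omega>1 (Gr_proj B \<circ> c) = \<omega>0 (Gr_proj B \<circ> c))"
proof -
  interpret smooth_prequantum B using assms(1-4) by unfold_locales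
  note MA = assms(5) and M = assms(6) and \<mu>1 = assms(8) and dim = assms(10)
  have sets: "sets \<mu> = sets borel" using assms(7) by (simp add: volume_measure_def)
  then have space: "space \<mu> = UNIV" using sets_eq_imp_space_eq by fastforce
  \<comment> \<open>\<open>measure\<close> returns 0 for infinite total mass, so the value 1 forces
    finiteness.\<close>
  have fin: "finite_measure \<mu>"
    using \<mu>1 space by (intro finite_measureI) (auto simp: measure_def)
  have \<alpha>0: "\<Theta> (level_ident B \<circ> c) = \<alpha>0 c" if c: "c \<in> Gr_hor_plots MA \<mu> B" for c
  proof (intro ext)
    fix u a
    obtain F where F: "F \<in> families MA PA (Emb_hor MA B)" "c = (\<lambda>u. weighted_image \<mu> (F u))"
      "level_ident B \<circ> c = (\<lambda>u. cotangent_vec \<mu> B (F u) (\<lambda>_. 1))" by (rule level_ident_plots[OF c])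
    have "\<alpha>0 c u a = (\<integral>x. conn_vel F a u x \<partial>\<mu>)"
      using assms(11) F(1) unfolding is_alpha0_def F(2) conn_vel_def by blast
    then show "\<Theta> (level_ident B \<circ> c) u a = \<alpha>0 c u a"
      unfolding F(3) canonical_form_eq[OF MA M dim assms(13) F(1)] by simp
  qed
  have \<omega>0: "\<Omega>1 (Gr_proj B \<circ> c) = \<omega>0 (Gr_proj B \<circ> c)" if c: "c \<in> Gr_hor_plots MA \<mu> B" for c
  proof (intro ext)
    fix u a b
    obtain F where F: "F \<in> families MA PA (Emb_hor MA B)" "c = (\<lambda>u. weighted_image \<mu> (F u))"
      "level_ident B \<circ> c = (\<lambda>u. cotangent_vec \<mu> B (F u) (\<lambda>_. 1))" by (rule level_ident_plots[OF c])
    have Fs: "smooth_map (prod_atlas euclidean_atlas MA) PA (\<lambda>(u, x). F u x)"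
      using F(1) unfolding families_def by blast
    note level = level_ident_plot_in_level[OF M \<mu>1 space c]
    \<comment> \<open>This exhibits the base plot as the reduction of a plot in the level set, where
      \<Omega>1 is given by \<open>plot_d \<Theta>\<close>.\<close>
    have red: "Gr_proj B \<circ> c = reduced_proj B \<circ> (level_ident B \<circ> c)"
      by (auto simp: fun_eq_iff Gr_proj_def reduced_proj_def level_ident_def split: prod.split)
    have proj: "Gr_proj B \<circ> c = (\<lambda>u. weighted_image \<mu> (proj B \<circ> F u))"
      unfolding F(2) weighted_image_def by (auto simp: Gr_proj_image)
    \<comment> \<open>Stated for every \<open>u\<close>, since \<open>plot_d\<close> differentiates
      these functions of \<open>u\<close>.\<close>
    have \<Theta>: "\<Theta> (level_ident B \<circ> c) u a = (\<integral>x. conn_vel F a u x \<partial>\<mu>)" for u a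
      unfolding F(3) by (rule canonical_form_eq[OF MA M dim assms(13) F(1)])
    \<comment> \<open>The integral is the coefficient of \<Theta> on a plot, and such coefficients
      are smooth by \<open>plot_form1\<close>.\<close>
    have D: "((\<lambda>u. \<integral>x. conn_vel F a u x \<partial>\<mu>) has_derivative
        frechet_derivative (\<lambda>u. \<integral>x. conn_vel F a u x \<partial>\<mu>) (at u)) (at u)" for a
    proof (rule Cinf_on_has_derivative[OF _ UNIV_I])
      have "level_ident B \<circ> c \<in> cotangent_plots MA \<mu> B" using level by (simp add: J_level_one_plots_def)
      then have "Cinf_on UNIV (\<lambda>u. \<Theta> (level_ident B \<circ> c) u a)"
        using assms(13) unfolding is_canonical_form_def plot_form1_def by blast
      then show "Cinf_on UNIV (\<lambda>u. \<integral>x. conn_vel F a u x \<partial>\<mu>)" unfolding \<Theta> .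
    qed
    note D' = frechet_derivative_integral[OF MA M fin sets smooth_conn_vel[OF MA Fs] D]
    have "\<Omega>1 (Gr_proj B \<circ> c) u a b = plot_d \<Theta> (level_ident B \<circ> c) u a b"
      unfolding red assms(14)[unfolded is_reduced_form_def, THEN conjunct2, rule_format, OF level] ..
    also have "\<dots> = (\<integral>x. frechet_derivative (\<lambda>u. conn_vel F b u x) (at u) a \<partial>\<mu>) -
        (\<integral>x. frechet_derivative (\<lambda>u. conn_vel F a u x) (at u) b \<partial>\<mu>)"
      unfolding plot_d_def \<Theta> D'(1) ..
    also have "\<dots> = (\<integral>x. frechet_derivative (\<lambda>u. conn_vel F b u x) (at u) a -
        frechet_derivative (\<lambda>u. conn_vel F a u x) (at u) b \<partial>\<mu>)"
      by (rule Bochner_Integration.integral_diff[OF D'(2) D'(2), symmetric])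
    also have "\<dots> = (\<integral>x. symp B ((proj B \<circ> F u) x) (family_vel SA (\<lambda>u. proj B \<circ> F u) u a x)
        (family_vel SA (\<lambda>u. proj B \<circ> F u) u b x) \<partial>\<mu>)"
      using symp_family_vel[OF MA Fs] by simp
    also have "\<dots> = \<omega>0 (Gr_proj B \<circ> c) u a b"
      unfolding proj
      by (rule assms(12)[unfolded is_omega0_def, THEN conjunct2, rule_format, OF proj_family[OF MA F(1)], symmetric])
    finally show "\<Omega>1 (Gr_proj B \<circ> c) u a b = \<omega>0 (Gr_proj B \<circ> c) u a b" .
  qed
  have equiv: "level_ident B (Gr_act B z q) = cotangent_act B z (level_ident B q)"
    if z: "z \<in> sphere 0 1" for z q
  proof -
    \<comment> \<open>\<open>dens_push\<close> tests measurability at each composition; continuity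
      of the projection passes the test, and invariance of the projection under the action makes the
      rotation invisible on the base.\<close>
    have "k \<circ> proj B \<in> borel_measurable borel" if "k \<in> borel_measurable borel" for k :: "'s \<Rightarrow> real"
      using measurable_comp[OF borel_measurable_continuous_onI[OF proj_continuous] that] .
    moreover have "proj B \<circ> act B z = proj B"
      using proj_act[of z] z by (simp add: fun_eq_iff)
    then have "k \<circ> proj B \<circ> act B z = k \<circ> proj B" for k :: "'s \<Rightarrow> real"
      by (simp only: comp_assoc)
    ultimately have "dens_push (proj B) (dens_push (act B z) \<nu>) = dens_push (proj B) \<nu>" for \<nu>
      unfolding dens_push_def by (intro ext) simp
    then show ?thesis
      by (simp add: level_ident_def Gr_act_def cotangent_act_def case_prod_unfold)
  qed
  have base: "Gr_proj B q \<in> Gr_Lag MA \<mu> B \<and> reduced_proj B (level_ident B q) = Gr_proj B q"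
    if q: "q \<in> Gr_hor MA \<mu> B" for q
  proof -
    obtain F \<rho> where F: "F \<in> Emb_hor MA B" "smooth_function MA \<rho>" "\<forall>x. \<rho> x > 0"
      "dens_total (push \<mu> F \<rho>) = measure \<mu> UNIV" "q = (range F, push \<mu> F \<rho>)"
      using q by (auto simp: Gr_weighted_def Vol_def)
    have "proj B \<circ> F \<in> Emb_Lag MA B" using F(1) by (simp add: Emb_hor_def)
    moreover have "push \<mu> (proj B \<circ> F) \<rho> \<in> Vol MA \<mu> (proj B \<circ> F)" using F(2,3) unfolding Vol_def by blast
    moreover have "dens_total (push \<mu> (proj B \<circ> F) \<rho>) = measure \<mu> UNIV"
      using F(4) by (simp add: dens_total_push)
    ultimately have "Gr_proj B q \<in> Gr_Lag MA \<mu> B"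
      unfolding F(5) Gr_proj_image Gr_weighted_def by blast
    moreover have "reduced_proj B (level_ident B q) = Gr_proj B q"
      unfolding F(5) Gr_proj_image level_ident_image by (simp add: reduced_proj_def image_comp)
    ultimately show ?thesis ..
  qed
  show ?thesis
    using level_ident_bij_betw[OF M \<mu>1] level_ident_plot_in_level[OF M \<mu>1 space] \<alpha>0 \<omega>0 equiv base by blast
qed

end
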